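(* Let $n\ge2$, $k\ge3$, $\varepsilon>0$, and let $f:S_k^n\to[k]$ be a social choice function with $\mathbf{D}(f,\overline{\mathrm{NONMANIP}})\ge\varepsilon$. Let $\sigma\in S_k^n$ be uniformly random. Then $$\mathbb{P}(\sigma\in M(f))\ge\mathbb{P}(\sigma\in M_4(f))\ge\frac{\varepsilon^5}{10^9\,n^7\,k^{46}}.$$
   Context: $[k]=\{1,\dots,k\}$, $S_k$ is the set of total orderings of $[k]$, a social choice function is a map $f:S_k^n\to[k]$. Write $a\overset{\sigma_i}{>}b$ if $\sigma_i$ ranks $a$ above $b$. $\sigma$ is a manipulation point if there are $i$ and $\sigma'$ differing from $\sigma$ only in coordinate $i$ with $f(\sigma')\overset{\sigma_i}{>}f(\sigma)$; it is an $r$-manipulation point if such $\sigma'$ exists with $\sigma'_i$ obtained from $\sigma_i$ by permuting at most $r$ alternatives occupying adjacent positions in $\sigma_i$. $M(f)$, $M_r(f)$ denote these sets. $\overline{\mathrm{NONMANIP}}$ is the set of SCFs that depend on only one coordinate or take at most two values. $\mathbf{D}(f,g)=\mathbb{P}(f(\sigma)\ne g(\sigma))$ for uniform $\sigma$, $\mathbf{D}(f,G)=\min_{g\in G}\mathbf{D}(f,g)$. *)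

theory Defs
  imports "HOL-Probability.Probability" "HOL-Combinatorics.Permutations"
begin

definition rankings :: "nat \<Rightarrow> nat rel set" where
  "rankings k = {r. linear_order_on {1..k} r}"

text \<open>A ranking is a reflexive linear order in which larger means better:
  \<open>(b, a) \<in> r\<close> says that \<open>a\<close> is ranked at least as high as \<open>b\<close>.\<close>

definition ranks_above :: "nat rel \<Rightarrow> nat \<Rightarrow> nat \<Rightarrow> bool" where
  "ranks_above r a b \<longleftrightarrow> (b, a) \<in> r \<and> a \<noteq> b"

text \<open>The set \<open>above r a\<close> contains \<open>a\<close> itself, so positions run from 1 (top) to \<open>k\<close> (bottom).\<close>

definition position :: "nat rel \<Rightarrow> nat \<Rightarrow> nat" where
  "position r a = card (above r a)"

definition profiles :: "nat \<Rightarrow> nat \<Rightarrow> (nat \<Rightarrow> nat rel) set" where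
  "profiles n k = {1..n} \<rightarrow>\<^sub>E rankings k"

definition scfs :: "nat \<Rightarrow> nat \<Rightarrow> ((nat \<Rightarrow> nat rel) \<Rightarrow> nat) set" where
  "scfs n k = profiles n k \<rightarrow>\<^sub>E {1..k}"

text \<open>The alternatives in \<open>B\<close> are permuted by \<open>\<pi>\<close>; all others keep their positions.\<close>

definition adjacent_permutation :: "nat \<Rightarrow> nat \<Rightarrow> nat rel \<Rightarrow> nat rel \<Rightarrow> bool" where
  "adjacent_permutation k r \<rho> \<rho>' \<longleftrightarrow>
     (\<exists>B \<pi> p q. B \<subseteq> {1..k} \<and> card B \<le> r \<and> position \<rho> ` B = {p..q} \<and>
        \<pi> permutes B \<and> \<rho>' = map_prod \<pi> \<pi> ` \<rho>)"

definition manipulation_points ::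
  "nat \<Rightarrow> nat \<Rightarrow> ((nat \<Rightarrow> nat rel) \<Rightarrow> nat) \<Rightarrow> (nat \<Rightarrow> nat rel) set" where
  "manipulation_points n k f =
     {\<sigma> \<in> profiles n k. \<exists>i\<in>{1..n}. \<exists>\<sigma>'\<in>profiles n k.
        (\<forall>j\<in>{1..n} - {i}. \<sigma>' j = \<sigma> j) \<and> ranks_above (\<sigma> i) (f \<sigma>') (f \<sigma>)}"

definition r_manipulation_points ::
  "nat \<Rightarrow> nat \<Rightarrow> nat \<Rightarrow> ((nat \<Rightarrow> nat rel) \<Rightarrow> nat) \<Rightarrow> (nat \<Rightarrow> nat rel) set" where
  "r_manipulation_points r n k f =
     {\<sigma> \<in> profiles n k. \<exists>i\<in>{1..n}. \<exists>\<sigma>'\<in>profiles n k.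
        (\<forall>j\<in>{1..n} - {i}. \<sigma>' j = \<sigma> j) \<and> ranks_above (\<sigma> i) (f \<sigma>') (f \<sigma>) \<and>
        adjacent_permutation k r (\<sigma> i) (\<sigma>' i)}"

definition depends_on_one_coordinate ::
  "nat \<Rightarrow> nat \<Rightarrow> ((nat \<Rightarrow> nat rel) \<Rightarrow> nat) \<Rightarrow> bool" where
  "depends_on_one_coordinate n k g \<longleftrightarrow>
     (\<exists>i\<in>{1..n}. \<forall>\<sigma>\<in>profiles n k. \<forall>\<tau>\<in>profiles n k. \<sigma> i = \<tau> i \<longrightarrow> g \<sigma> = g \<tau>)"

definition nonmanip_bar :: "nat \<Rightarrow> nat \<Rightarrow> ((nat \<Rightarrow> nat rel) \<Rightarrow> nat) set" where
  "nonmanip_bar n k =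
     {g \<in> scfs n k. depends_on_one_coordinate n k g \<or> card (g ` profiles n k) \<le> 2}"

definition profile_pmf :: "nat \<Rightarrow> nat \<Rightarrow> (nat \<Rightarrow> nat rel) pmf" where
  "profile_pmf n k = pmf_of_set (profiles n k)"

definition scf_dist ::
  "nat \<Rightarrow> nat \<Rightarrow> ((nat \<Rightarrow> nat rel) \<Rightarrow> nat) \<Rightarrow> ((nat \<Rightarrow> nat rel) \<Rightarrow> nat) \<Rightarrow> real" where
  "scf_dist n k f g = measure_pmf.prob (profile_pmf n k) {\<sigma>. f \<sigma> \<noteq> g \<sigma>}"

definition scf_set_dist ::
  "nat \<Rightarrow> nat \<Rightarrow> ((nat \<Rightarrow> nat rel) \<Rightarrow> nat) \<Rightarrow> ((nat \<Rightarrow> nat rel) \<Rightarrow> nat) set \<Rightarrow> real" where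
  "scf_set_dist n k f G = Min (scf_dist n k f ` G)"

text \<open>\<^const>\<open>pmf_of_set\<close> and \<^const>\<open>Min\<close> are meaningful only on finite nonempty sets;
  the following facts show that they are applied to such sets.\<close>

lemma finite_rankings: "finite (rankings k)"
proof (rule finite_subset)
  show "rankings k \<subseteq> Pow ({1..k} \<times> {1..k})"
    by (auto simp: rankings_def order_on_defs)
qed simp

lemma rankings_nonempty: "rankings k \<noteq> {}"
proof -
  have "{(a, b). a \<in> {1..k} \<and> b \<in> {1..k} \<and> a \<le> b} \<in> rankings k"
    by (auto simp: rankings_def order_on_defs refl_on_def trans_def antisym_def total_on_def)
  then show ?thesis by blast
qed

lemma finite_profiles: "finite (profiles n k)"
  by (simp add: profiles_def finite_PiE finite_rankings)

lemma profiles_nonempty: "profiles n k \<noteq> {}"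
  by (simp add: profiles_def PiE_eq_empty_iff rankings_nonempty)

lemma finite_nonmanip_bar: "finite (nonmanip_bar n k)"
proof (rule finite_subset)
  show "nonmanip_bar n k \<subseteq> scfs n k" by (auto simp: nonmanip_bar_def)
  show "finite (scfs n k)" by (simp add: scfs_def finite_PiE finite_profiles)
qed

lemma nonmanip_bar_nonempty:
  assumes "k \<ge> 1"
  shows "nonmanip_bar n k \<noteq> {}"
proof -
  let ?g = "restrict (\<lambda>_. 1) (profiles n k) :: (nat \<Rightarrow> nat rel) \<Rightarrow> nat"
  have "?g ` profiles n k \<subseteq> {1}" by auto
  then have "card (?g ` profiles n k) \<le> card {1::nat}" by (intro card_mono) auto
  moreover have "?g \<in> scfs n k" using assms by (auto simp: scfs_def)
  ultimately have "?g \<in> nonmanip_bar n k" by (simp add: nonmanip_bar_def)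
  then show ?thesis by blast
qed

end

theory Submission
  imports Defs
begin

text \<open>Only swaps of two adjacent alternatives are used. If no manipulation point is involved, such a
  swap changes the outcome only from the upper to the lower of the two swapped alternatives. Since
  \<open>f\<close> is far from depending on one voter and from taking two values, isoperimetry yields voters
  \<open>i \<noteq> j\<close> and pairs \<open>{a, b} \<noteq> {c, d}\<close> for which \<open>i\<close> is often pivotal between \<open>a\<close> and \<open>b\<close>, and \<open>j\<close>
  between \<open>c\<close> and \<open>d\<close>. Partition the profiles by the preferences of all voters between \<open>a\<close> and \<open>b\<close>.
  Either pivotality of \<open>i\<close> (with \<open>a\<close>, \<open>b\<close> lifted to the top) has a large boundary inside the fibres,
  and every boundary point is close to a manipulation point; or it has density almost \<open>1\<close> in many
  fibres. If the latter holds for both \<open>(i, a, b)\<close> and \<open>(j, c, d)\<close>, reverse hypercontractivity shows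
  that many profiles lie in large fibres of both kinds, where the outcome would have to be \<open>a\<close> and \<open>c\<close>
  at the same time.\<close>

section \<open>Rankings as permutations\<close>

text \<open>The pivotal events found for the two voters have density only of order \<epsilon> / (n
  k^4), and two events that small need not meet. Reverse hypercontractivity bounds an intersection
  from below, but only for events that depend on the bits alone (voter by voter: \<open>a\<close>
  above \<open>b\<close>, and \<open>c\<close> above \<open>d\<close>). Hence the dichotomy: density
  close to 1 in a fibre turns pivotality, up to a small exception, into a property of the bits. The
  pairs must differ because the two bits of one voter would otherwise be equal or opposite; for
  different pairs their correlation is at most 1/2 in absolute value. The voters must differ so that
  both liftings can be carried out in one profile. In \<epsilon>^5, four factors are the squares of
  the two densities in the hypercontractive bound; the fifth is the density of pivotality in the
  isoperimetric step that produces large fibres.\<close>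

text \<open>A ranking is represented by the permutation \<open>\<pi>\<close> with \<open>\<pi> a\<close> the position of \<open>a\<close>:
  \<open>a\<close> is directly above \<open>b\<close> iff \<open>\<pi> b = Suc (\<pi> a)\<close>. Composition on the right relabels alternatives,
  composition on the left rearranges positions.\<close>

definition perms :: "nat \<Rightarrow> (nat \<Rightarrow> nat) set" where
  "perms k = {\<pi>. \<pi> permutes {1..k}}"

text \<open>The unqualified name denotes the transpose of a matrix.\<close>

abbreviation tr :: "nat \<Rightarrow> nat \<Rightarrow> nat \<Rightarrow> nat" where
  "tr \<equiv> Transposition.transpose"

definition swap_at :: "nat \<Rightarrow> nat \<Rightarrow> nat \<Rightarrow> (nat \<Rightarrow> nat \<Rightarrow> nat) \<Rightarrow> nat \<Rightarrow> nat \<Rightarrow> nat" where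
  "swap_at l a b x = x(l := x l \<circ> tr a b)"

lemma finite_perms: "finite (perms k)"
  by (simp add: perms_def finite_permutations)

lemma card_perms: "card (perms k) = fact k"
  by (simp add: perms_def card_permutations)

lemma perms_comp: "g \<in> perms k \<Longrightarrow> h \<in> perms k \<Longrightarrow> g \<circ> h \<in> perms k"
  by (simp add: perms_def permutes_compose)

lemma perms_transpose: "a \<in> {1..k} \<Longrightarrow> b \<in> {1..k} \<Longrightarrow> tr a b \<in> perms k"
  by (simp add: perms_def permutes_swap_id)

lemma perms_inj: "\<pi> \<in> perms k \<Longrightarrow> inj \<pi>"
  by (simp add: perms_def permutes_inj)

lemma perms_eq_iff: "\<pi> \<in> perms k \<Longrightarrow> \<pi> a = \<pi> b \<longleftrightarrow> a = b"
  by (meson inj_eq perms_inj)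

lemma perms_range: "\<pi> \<in> perms k \<Longrightarrow> \<pi> a \<in> {1..k} \<longleftrightarrow> a \<in> {1..k}"
  unfolding perms_def by (simp only: mem_Collect_eq permutes_in_image)

text \<open>\<open>\<kappa>\<close> records whatever \<open>\<phi>\<close> forgets, so a point of
  \<open>C\<close> has at most \<open>card K\<close> preimages. Below, \<open>\<phi>\<close> lifts
  alternatives and \<open>\<kappa>\<close> keeps their old positions.\<close>

lemma card_fibres_le:
  assumes "finite C" "finite K" "inj_on (\<lambda>x. (\<phi> x, \<kappa> x)) X" "\<phi> ` X \<subseteq> C" "\<kappa> ` X \<subseteq> K"
  shows "card X \<le> card K * card C"
proof -
  have "card X \<le> card (C \<times> K)"
    using assms by (intro card_inj_on_le[where f = "\<lambda>x. (\<phi> x, \<kappa> x)"]) auto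
  then show ?thesis by (simp add: card_cartesian_product mult.commute)
qed

section \<open>Isoperimetry on the set of profiles\<close>

locale profile_space =
  fixes I :: "nat set" and k :: nat
  assumes finite_I: "finite I"
begin

definition \<Omega> :: "(nat \<Rightarrow> nat \<Rightarrow> nat) set" where
  "\<Omega> = I \<rightarrow>\<^sub>E perms k"

text \<open>The value type is left free: \<open>boundary\<close> is applied to outcomes, to outcomes
  with two values merged, and to membership predicates.\<close>

definition boundary :: "((nat \<Rightarrow> nat \<Rightarrow> nat) \<Rightarrow> 'v) \<Rightarrow> nat \<Rightarrow> (nat \<Rightarrow> nat \<Rightarrow> nat) set" where
  "boundary g l = {x \<in> \<Omega>. \<exists>a\<in>{1..k}. \<exists>b\<in>{1..k}.
     x l b = Suc (x l a) \<and> g x \<noteq> g (swap_at l a b x)}"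

lemma finite_\<Omega>: "finite \<Omega>"
  by (simp add: \<Omega>_def finite_PiE finite_I finite_perms)

lemma id_perms: "id \<in> perms k"
  by (simp add: perms_def permutes_id)

lemma \<Omega>_nonempty: "\<Omega> \<noteq> {}"
  using id_perms by (auto simp: \<Omega>_def PiE_eq_empty_iff)

lemma card_\<Omega>_pos: "0 < card \<Omega>"
  using finite_\<Omega> \<Omega>_nonempty by (simp add: card_gt_0_iff)

lemma \<Omega>_upd: "x \<in> \<Omega> \<Longrightarrow> l \<in> I \<Longrightarrow> \<pi> \<in> perms k \<Longrightarrow> x(l := \<pi>) \<in> \<Omega>"
  by (auto simp: \<Omega>_def PiE_iff extensional_def)

lemma \<Omega>_perms: "x \<in> \<Omega> \<Longrightarrow> l \<in> I \<Longrightarrow> x l \<in> perms k"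
  by (auto simp: \<Omega>_def)

lemma swap_at_\<Omega>:
  "x \<in> \<Omega> \<Longrightarrow> l \<in> I \<Longrightarrow> a \<in> {1..k} \<Longrightarrow> b \<in> {1..k} \<Longrightarrow> swap_at l a b x \<in> \<Omega>"
  unfolding swap_at_def by (intro \<Omega>_upd perms_comp perms_transpose \<Omega>_perms)

lemma swap_at_swap_at: "swap_at l a b (swap_at l a b x) = x"
  by (simp add: swap_at_def comp_assoc)

lemma finite_boundary: "finite (boundary g l)"
  using finite_\<Omega> by (simp add: boundary_def)

section \<open>Left multiplication and words in adjacent transpositions\<close>

definition act :: "nat \<Rightarrow> (nat \<Rightarrow> nat) \<Rightarrow> (nat \<Rightarrow> nat \<Rightarrow> nat) \<Rightarrow> nat \<Rightarrow> nat \<Rightarrow> nat" where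
  "act l h x = x(l := h \<circ> x l)"

definition disagreements ::
  "((nat \<Rightarrow> nat \<Rightarrow> nat) \<Rightarrow> 'v) \<Rightarrow> ((nat \<Rightarrow> nat \<Rightarrow> nat) \<Rightarrow> nat \<Rightarrow> nat \<Rightarrow> nat) \<Rightarrow> nat" where
  "disagreements g T = card {x \<in> \<Omega>. g x \<noteq> g (T x)}"

text \<open>A disagreement of the composite occurs on one of the two steps; on the second step it is
  a disagreement of \<open>T'\<close> at \<open>T x\<close>, and \<open>T\<close> is
  injective.\<close>

lemma disagreements_comp:
  assumes "inj_on T \<Omega>" "T ` \<Omega> \<subseteq> \<Omega>"
  shows "disagreements g (T' \<circ> T) \<le> disagreements g T + disagreements g T'"
proof -
  let ?A = "{x \<in> \<Omega>. g x \<noteq> g (T x)}" and ?B = "{x \<in> \<Omega>. g (T x) \<noteq> g (T' (T x))}"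
  have "card {x \<in> \<Omega>. g x \<noteq> g ((T' \<circ> T) x)} \<le> card (?A \<union> ?B)"
    using finite_\<Omega> by (intro card_mono) auto
  also have "\<dots> \<le> card ?A + card ?B" by (rule card_Un_le)
  also have "card ?B \<le> card {x \<in> \<Omega>. g x \<noteq> g (T' x)}"
    using assms finite_\<Omega> by (intro card_inj_on_le[where f = T]) (auto intro: inj_on_subset)
  finally show ?thesis by (simp add: disagreements_def)
qed

lemma act_act: "act l h (act l h' x) = act l (h \<circ> h') x"
  by (simp add: act_def comp_assoc)

lemma act_id: "act l id x = x"
  by (simp add: act_def)

lemma disagreements_act_id: "disagreements g (act l id) = 0"
  unfolding disagreements_def act_id by simp

lemma act_\<Omega>: "x \<in> \<Omega> \<Longrightarrow> l \<in> I \<Longrightarrow> h \<in> perms k \<Longrightarrow> act l h x \<in> \<Omega>"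
  unfolding act_def by (rule \<Omega>_upd) (auto intro: perms_comp \<Omega>_perms)

lemma act_inj: "h \<in> perms k \<Longrightarrow> inj_on (act l h) X"
proof (rule inj_onI)
  fix x y assume h: "h \<in> perms k" and eq: "act l h x = act l h y"
  have "act l (inv h) (act l h z) = z" for z
    using h by (simp add: act_act perms_inj act_id)
  then show "x = y" using eq by metis
qed

lemma disagreements_act_comp:
  assumes "l \<in> I" "h \<in> perms k"
  shows "disagreements g (act l (h' \<circ> h)) \<le> disagreements g (act l h) + disagreements g (act l h')"
proof -
  have "act l (h' \<circ> h) = act l h' \<circ> act l h"
    by (simp add: fun_eq_iff[of "act l (h' \<circ> h)"] act_act)
  moreover have "act l h ` \<Omega> \<subseteq> \<Omega>" using act_\<Omega> assms by blast
  ultimately show ?thesis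
    using disagreements_comp[of "act l h" g "act l h'"] act_inj[OF assms(2)] by metis
qed

text \<open>Exchanging positions p and p + 1 on the left is the same as exchanging, on the right,
  the two alternatives that occupy them. The action is thus an adjacent swap whose pair depends on
  \<open>x\<close>.\<close>

lemma disagreements_adjacent:
  assumes "l \<in> I" "1 \<le> p" "p < k"
  shows "disagreements g (act l (tr p (Suc p))) \<le> card (boundary g l)"
  unfolding disagreements_def
proof (rule card_mono[OF finite_boundary], safe)
  fix x assume x: "x \<in> \<Omega>" and neq: "g x \<noteq> g (act l (tr p (Suc p)) x)"
  have px: "x l permutes {1..k}" using \<Omega>_perms[OF x assms(1)] by (simp add: perms_def)
  define a where "a = inv (x l) p"
  define b where "b = inv (x l) (Suc p)"
  have pa: "x l a = p" and pb: "x l b = Suc p"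
    using px by (simp_all add: a_def b_def permutes_inverses(1))
  have ab: "a \<in> {1..k}" "b \<in> {1..k}"
    using assms px pa pb by (metis atLeastAtMost_iff less_imp_le permutes_in_image,
      metis Suc_leI atLeastAtMost_iff le_SucI permutes_in_image)
  have tr_eq: "tr p (Suc p) \<circ> x l = x l \<circ> tr a b"
  proof
    fix z show "(tr p (Suc p) \<circ> x l) z = (x l \<circ> tr a b) z"
    proof -
      have "x l z = p \<longleftrightarrow> z = a" "x l z = Suc p \<longleftrightarrow> z = b"
        using pa pb permutes_inj[OF px] by (metis inj_eq)+
      then show ?thesis using pa pb by (simp add: Transposition.transpose_def)
    qed
  qed
  have "act l (tr p (Suc p)) x = swap_at l a b x"
    using tr_eq by (simp add: act_def swap_at_def)
  then show "x \<in> boundary g l"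
    using ab x neq pa pb unfolding boundary_def
    by (intro CollectI conjI bexI[of _ a] bexI[of _ b]) simp_all
qed

text \<open>One insertion step: \<open>c\<close> moves the entry at position \<open>Suc m\<close> up
  by \<open>j\<close> places, one adjacent transposition at a time. Only its cost is recorded, not
  the word.\<close>

lemma cycle_word:
  assumes "l \<in> I" "m < k" "j \<le> m"
  shows "\<exists>c. c permutes {1..Suc m} \<and> c (Suc m) = Suc m - j \<and>
     disagreements g (act l c) \<le> j * card (boundary g l)"
  using assms(3)
proof (induction j)
  case 0
  show ?case
  proof (intro exI conjI)
    show "id permutes {1..Suc m}" by (rule permutes_id)
    show "disagreements g (act l id) \<le> 0 * card (boundary g l)"
      unfolding disagreements_act_id by simp
  qed simp
next
  case (Suc j)
  then obtain c where c: "c permutes {1..Suc m}" "c (Suc m) = Suc m - j"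
    "disagreements g (act l c) \<le> j * card (boundary g l)" by auto
  define p where "p = Suc m - Suc j"
  have p: "1 \<le> p" "p < k" "Suc p = Suc m - j" "Suc p \<le> Suc m"
    using Suc.prems assms by (auto simp: p_def)
  have "tr p (Suc p) permutes {1..Suc m}" using p by (intro permutes_swap_id) auto
  then have 1: "tr p (Suc p) \<circ> c permutes {1..Suc m}" using c by (simp add: permutes_compose)
  have "c permutes {1..k}" using c(1) by (rule permutes_subset) (use assms in auto)
  then have "disagreements g (act l (tr p (Suc p) \<circ> c)) \<le>
    j * card (boundary g l) + card (boundary g l)"
    using disagreements_act_comp[OF assms(1), of c g "tr p (Suc p)"]
      disagreements_adjacent[OF assms(1) p(1,2), of g] c(3) by (simp add: perms_def)
  moreover have "(tr p (Suc p) \<circ> c) (Suc m) = Suc m - Suc j"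
    using c(2) p(3) by (simp add: p_def)
  ultimately show ?case using 1 by (metis add.commute mult_Suc)
qed

text \<open>Insertion sort: \<open>c\<close> agrees with \<open>h\<close> at \<open>Suc m\<close>,
  so \<open>inv c \<circ> h\<close> fixes that point and the induction continues on \<open>m\<close>
  points; m^2 + m \<le> (m + 1)^2.\<close>

lemma disagreements_act_le:
  assumes "l \<in> I" "m \<le> k" "h permutes {1..m}"
  shows "disagreements g (act l h) \<le> m\<^sup>2 * card (boundary g l)"
  using assms(2,3)
proof (induction m arbitrary: h)
  case 0
  then have "h = id" by simp
  then show ?case by (simp add: disagreements_act_id del: id_apply)
next
  case (Suc m)
  have "h (Suc m) \<in> {1..Suc m}" using permutes_in_image[OF Suc.prems(2), of "Suc m"] by simp
  then have j: "Suc m - h (Suc m) \<le> m" "Suc m - (Suc m - h (Suc m)) = h (Suc m)" by auto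
  then obtain c where c: "c permutes {1..Suc m}" "c (Suc m) = h (Suc m)"
    and "disagreements g (act l c) \<le> (Suc m - h (Suc m)) * card (boundary g l)"
    using cycle_word[OF assms(1), of m "Suc m - h (Suc m)" g] Suc.prems by auto
  then have dc: "disagreements g (act l c) \<le> m * card (boundary g l)"
    using j(1) by (meson le_trans mult_le_mono1)
  define h' where "h' = inv c \<circ> h"
  have h'0: "h' permutes {1..Suc m}"
    unfolding h'_def using c Suc.prems by (intro permutes_compose permutes_inv) auto
  have h'1: "h' (Suc m) = Suc m"
    using c permutes_inverses(2)[OF c(1), of "Suc m"] by (simp add: h'_def)
  have h': "h' permutes {1..m}"
  proof (rule permutes_superset[OF h'0])
    show "\<And>x. x \<in> {1..Suc m} - {1..m} \<Longrightarrow> h' x = x"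
      using h'1 by (metis Diff_iff atLeastAtMost_iff le_antisym not_less_eq_eq)
  qed
  have h: "h = c \<circ> h'"
    using permutes_inverses(1)[OF c(1)] by (simp add: fun_eq_iff h'_def)
  have "h' \<in> perms k"
    using h' Suc.prems(1) by (auto simp: perms_def intro: permutes_subset)
  then have "disagreements g (act l h) \<le> disagreements g (act l h') + disagreements g (act l c)"
    unfolding h by (rule disagreements_act_comp[OF assms(1)])
  also have "\<dots> \<le> m\<^sup>2 * card (boundary g l) + m * card (boundary g l)"
    using Suc.IH[OF _ h'] Suc.prems dc by (intro add_mono) auto
  also have "\<dots> \<le> (Suc m)\<^sup>2 * card (boundary g l)"
    by (simp add: power2_eq_square algebra_simps)
  finally show ?case .
qed

definition act_on :: "nat set \<Rightarrow> (nat \<Rightarrow> nat \<Rightarrow> nat) \<Rightarrow> (nat \<Rightarrow> nat \<Rightarrow> nat) \<Rightarrow> nat \<Rightarrow> nat \<Rightarrow> nat" where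
  "act_on J h x = (\<lambda>l. if l \<in> J then h l \<circ> x l else x l)"

lemma act_on_\<Omega>: "J \<subseteq> I \<Longrightarrow> h \<in> \<Omega> \<Longrightarrow> x \<in> \<Omega> \<Longrightarrow> act_on J h x \<in> \<Omega>"
  by (auto simp: act_on_def \<Omega>_def PiE_iff extensional_def intro: perms_comp)

lemma act_on_inj:
  assumes "J \<subseteq> I" "h \<in> \<Omega>"
  shows "inj_on (act_on J h) X"
proof (rule inj_onI)
  fix x y assume eq: "act_on J h x = act_on J h y"
  show "x = y"
  proof
    fix l
    have "inj (h l)" if "l \<in> J" using that assms \<Omega>_perms perms_inj by blast
    then show "x l = y l"
      using fun_cong[OF eq, of l] by (auto simp: act_on_def fun_eq_iff inj_eq split: if_splits)
  qed
qed

lemma disagreements_act_on_le: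
  assumes "J \<subseteq> I" "h \<in> \<Omega>"
  shows "disagreements g (act_on J h) \<le> k\<^sup>2 * (\<Sum>l\<in>J. card (boundary g l))"
  using finite_subset[OF assms(1) finite_I] assms
proof (induction J rule: finite_induct)
  case empty
  then show ?case by (simp add: disagreements_def act_on_def)
next
  case (insert l J)
  have "act_on (insert l J) h = act l (h l) \<circ> act_on J h"
    using insert.hyps by (auto simp: act_on_def act_def fun_eq_iff)
  then have "disagreements g (act_on (insert l J) h)
      \<le> disagreements g (act_on J h) + disagreements g (act l (h l))"
    using disagreements_comp[of "act_on J h" g "act l (h l)"] act_on_inj[of J h \<Omega>]
      act_on_\<Omega>[of J h] insert.prems by auto
  also have "\<dots> \<le> k\<^sup>2 * (\<Sum>l\<in>J. card (boundary g l)) + k\<^sup>2 * card (boundary g l)"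
    using insert \<Omega>_perms[of h l]
    by (intro add_mono disagreements_act_le) (auto simp: perms_def)
  finally show ?case using insert.hyps by (simp add: algebra_simps)
qed

text \<open>Two independent profiles differ by left multiplication with a uniform \<open>h\<close>. For fixed \<open>h\<close>
  every intermediate profile along a word for \<open>h\<close> in adjacent transpositions is again uniform, so
  each letter costs one boundary; \<open>k\<^sup>2\<close> bounds the word length per voter.\<close>

lemma isoperimetry:
  "card {(x, y) \<in> \<Omega> \<times> \<Omega>. g x \<noteq> g y} \<le> k\<^sup>2 * card \<Omega> * (\<Sum>l\<in>I. card (boundary g l))"
proof -
  have "card {(x, y) \<in> \<Omega> \<times> \<Omega>. g x \<noteq> g y} \<le> card (SIGMA h:\<Omega>. {x \<in> \<Omega>. g x \<noteq> g (act_on I h x)})"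
  proof (rule card_inj_on_le)
    \<comment> \<open>The quotient of \<open>y\<close> by \<open>x\<close>, voter by voter;
      \<open>undefined\<close> outside \<open>I\<close> makes it an element of
      \<open>\<Omega>\<close>.\<close>
    define q where "q x y = (\<lambda>l. if l \<in> I then y l \<circ> inv (x l) else undefined)"
      for x y :: "nat \<Rightarrow> nat \<Rightarrow> nat"
    have q: "act_on I (q x y) x = y" if "x \<in> \<Omega>" "y \<in> \<Omega>" for x y
    proof
      fix l show "act_on I (q x y) x l = y l"
        using that \<Omega>_perms[OF that(1), of l]
        by (auto simp: act_on_def q_def \<Omega>_def PiE_iff extensional_def comp_assoc perms_inj)
    qed
    have q\<Omega>: "q x y \<in> \<Omega>" if "x \<in> \<Omega>" "y \<in> \<Omega>" for x y
      using that unfolding \<Omega>_def q_def PiE_iff extensional_def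
      by (auto simp: perms_def intro!: permutes_compose permutes_inv)
    show "inj_on (\<lambda>(x, y). (q x y, x)) {(x, y) \<in> \<Omega> \<times> \<Omega>. g x \<noteq> g y}"
      by (rule inj_onI) (auto, metis q)
    show "(\<lambda>(x, y). (q x y, x)) ` {(x, y) \<in> \<Omega> \<times> \<Omega>. g x \<noteq> g y}
        \<subseteq> (SIGMA h:\<Omega>. {x \<in> \<Omega>. g x \<noteq> g (act_on I h x)})"
      using q q\<Omega> by auto
    show "finite (SIGMA h:\<Omega>. {x \<in> \<Omega>. g x \<noteq> g (act_on I h x)})"
      using finite_\<Omega> by (intro finite_SigmaI) auto
  qed
  also have "\<dots> = (\<Sum>h\<in>\<Omega>. disagreements g (act_on I h))"
    using finite_\<Omega> by (simp add: disagreements_def)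
  also have "\<dots> \<le> (\<Sum>h\<in>\<Omega>. k\<^sup>2 * (\<Sum>l\<in>I. card (boundary g l)))"
    by (intro sum_mono disagreements_act_on_le) auto
  finally show ?thesis by (simp add: mult_ac)
qed

end

section \<open>Lifting alternatives\<close>

text \<open>The first branch leaves \<open>\<pi>\<close> unchanged when \<open>c\<close> already
  stands above position \<open>t\<close>, so \<open>up\<close> is meaningful for every
  \<open>t\<close> and never lowers \<open>c\<close>.\<close>

definition up :: "nat \<Rightarrow> nat \<Rightarrow> (nat \<Rightarrow> nat) \<Rightarrow> nat \<Rightarrow> nat" where
  "up c t \<pi> = (\<lambda>x. if \<pi> c < t then \<pi> x else if x = c then t
     else if t \<le> \<pi> x \<and> \<pi> x < \<pi> c then Suc (\<pi> x) else \<pi> x)"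

definition top2 :: "nat \<Rightarrow> nat \<Rightarrow> (nat \<Rightarrow> nat) \<Rightarrow> nat \<Rightarrow> nat" where
  "top2 a b \<pi> = up b 2 (up a 1 \<pi>)"

lemma up_perms:
  assumes "\<pi> \<in> perms k" "c \<in> {1..k}" "1 \<le> t"
  shows "up c t \<pi> \<in> perms k"
proof -
  have \<pi>: "\<pi> permutes {1..k}" using assms by (simp add: perms_def)
  have c: "1 \<le> \<pi> c" "\<pi> c \<le> k" using perms_range[OF assms(1), of c] assms(2) by auto
  have inj: "\<pi> x = \<pi> y \<longleftrightarrow> x = y" for x y using perms_eq_iff[OF assms(1)] .
  have rng: "1 \<le> \<pi> x \<and> \<pi> x \<le> k" if "1 \<le> x" "x \<le> k" for x
    using perms_range[OF assms(1), of x] that by auto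
  have "inj_on (up c t \<pi>) {1..k}"
  proof (rule inj_onI)
    fix x y assume "x \<in> {1..k}" "y \<in> {1..k}" and eq: "up c t \<pi> x = up c t \<pi> y"
    have "\<pi> x = \<pi> y"
      using eq inj[of x c] inj[of y c] by (auto simp: up_def split: if_splits)
    then show "x = y" by (simp add: inj)
  qed
  moreover have "up c t \<pi> ` {1..k} \<subseteq> {1..k}"
  proof
    fix y assume "y \<in> up c t \<pi> ` {1..k}"
    then obtain x where x: "1 \<le> x" "x \<le> k" "y = up c t \<pi> x" by auto
    show "y \<in> {1..k}"
      using c rng[OF x(1,2)] assms(3) by (auto simp: up_def x(3))
  qed
  ultimately have "bij_betw (up c t \<pi>) {1..k} {1..k}"
    by (simp add: bij_betw_def endo_inj_surj)
  moreover have "up c t \<pi> x = x" if "x \<notin> {1..k}" for x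
  proof -
    have "\<pi> x = x" using \<pi> that by (rule permutes_not_in)
    then show ?thesis using that c assms by (auto simp: up_def)
  qed
  ultimately show ?thesis unfolding perms_def by (intro CollectI bij_imp_permutes)
qed

text \<open>Lifting forgets nothing but the old position of \<open>c\<close>, hence is at most
  k-to-one.\<close>

lemma up_inj:
  assumes "\<pi> \<in> perms k" "\<pi>' \<in> perms k" "up c t \<pi> = up c t \<pi>'" "\<pi> c = \<pi>' c"
  shows "\<pi> = \<pi>'"
proof
  fix x
  have "\<pi> x = \<pi> c \<longleftrightarrow> x = c" "\<pi>' x = \<pi>' c \<longleftrightarrow> x = c"
    using perms_eq_iff assms by blast+
  then show "\<pi> x = \<pi>' x"
    using fun_cong[OF assms(3), of x] assms(4) by (auto simp: up_def split: if_splits)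
qed

lemma up_less_iff:
  assumes "\<pi> \<in> perms k" "x \<noteq> c" "y \<noteq> c"
  shows "up c t \<pi> x < up c t \<pi> y \<longleftrightarrow> \<pi> x < \<pi> y"
  using perms_eq_iff[OF assms(1), of x c] perms_eq_iff[OF assms(1), of y c] assms(2,3)
  by (auto simp: up_def)

text \<open>Consecutive lifts differ by one adjacent swap, with the alternative that stood at
  position \<open>t\<close> originally. Lifting is therefore a path of adjacent swaps whose vertices
  are the rankings \<open>up c s \<pi>\<close>.\<close>

lemma up_step:
  assumes "\<pi> \<in> perms k" "\<pi> e = t" "t < \<pi> c"
  shows "up c t \<pi> = up c (Suc t) \<pi> \<circ> tr c e" "up c (Suc t) \<pi> c = Suc (up c (Suc t) \<pi> e)"
proof -
  have inj: "\<pi> x = \<pi> y \<longleftrightarrow> x = y" for x y using perms_eq_iff[OF assms(1)] .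
  show "up c t \<pi> = up c (Suc t) \<pi> \<circ> tr c e"
  proof
    fix x
    consider "x = c" | "x = e" "x \<noteq> c" | "x \<noteq> c" "x \<noteq> e" by blast
    then show "up c t \<pi> x = (up c (Suc t) \<pi> \<circ> tr c e) x"
    proof cases
      case 3
      then have "\<pi> x \<noteq> \<pi> e" by (simp add: inj)
      then show ?thesis using 3 assms(2,3) by (simp add: up_def)
    qed (use assms(2,3) in \<open>auto simp: up_def\<close>)
  qed
  show "up c (Suc t) \<pi> c = Suc (up c (Suc t) \<pi> e)"
    using assms(2,3) inj[of e c] by (auto simp: up_def)
qed

lemma up_self: "up c (\<pi> c) \<pi> = \<pi>"
  by (auto simp: up_def)

lemma up_1:
  assumes "\<pi> \<in> perms k" "a \<in> {1..k}"
  shows "up a 1 \<pi> x = (if x = a then 1 else if x \<in> {1..k} then \<pi> x + of_bool (\<pi> x < \<pi> a) else x)"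
proof (cases "x \<in> {1..k}")
  case True
  then show ?thesis
    using assms perms_range[OF assms(1), of x] perms_range[OF assms(1), of a]
    by (auto simp: up_def)
next
  case False
  then have "\<pi> x = x"
    using assms(1) permutes_not_in[of \<pi> "{1..k}" x] by (simp add: perms_def)
  then show ?thesis
    using assms perms_range[OF assms(1), of a] False by (auto simp: up_def)
qed

text \<open>Apart from positions 1 and 2 the formula is symmetric in \<open>a\<close> and
  \<open>b\<close>: every other alternative is pushed down once for each of them that stood below
  it. The laws for swaps are read off from it.\<close>

lemma top2_eq:
  assumes "\<pi> \<in> perms k" "a \<noteq> b" "a \<in> {1..k}" "b \<in> {1..k}"
  shows "top2 a b \<pi> x = (if x = a then 1 else if x = b then 2
    else if x \<in> {1..k} then \<pi> x + of_bool (\<pi> x < \<pi> a) + of_bool (\<pi> x < \<pi> b) else x)"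
proof -
  have inj: "\<pi> u = \<pi> v \<longleftrightarrow> u = v" for u v using perms_eq_iff[OF assms(1)] .
  have rng: "1 \<le> \<pi> x" if "x \<in> {1..k}" for x
    using perms_range[OF assms(1), of x] that by auto
  let ?u = "up a 1 \<pi>"
  note u = up_1[OF assms(1,3)]
  have u0: "?u a = 1" "?u b = \<pi> b + of_bool (\<pi> b < \<pi> a)" using u[of a] u[of b] assms by auto
  have u1: "2 \<le> ?u b" using u0 inj[of a b] assms(2) rng[OF assms(3)] rng[OF assms(4)] by auto
  have "\<pi> b \<le> k" using perms_range[OF assms(1), of b] assms(4) by auto
  consider "x = a" | "x = b" | "x \<noteq> a" "x \<noteq> b" "x \<in> {1..k}" | "x \<noteq> a" "x \<noteq> b" "x \<notin> {1..k}" by blast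
  then show ?thesis
  proof cases
    case 1
    then show ?thesis using u0 u1 assms(2) by (simp add: top2_def up_def[of b])
  next
    case 2
    then show ?thesis using u0 u1 assms(2) by (simp add: top2_def up_def[of b])
  next
    case 3
    have ux: "?u x = \<pi> x + of_bool (\<pi> x < \<pi> a)" using u[of x] 3 by auto
    have ne: "\<pi> x \<noteq> \<pi> a" "\<pi> x \<noteq> \<pi> b" "\<pi> a \<noteq> \<pi> b" using 3 inj assms(2) by auto
    have "2 \<le> ?u x" using ux rng[OF 3(3)] rng[OF assms(3)] ne by auto
    moreover have "?u x < ?u b \<longleftrightarrow> \<pi> x < \<pi> b"
      by (rule up_less_iff[OF assms(1)]) (use 3 assms(2) in auto)
    ultimately show ?thesis using 3 u1 ux by (simp add: top2_def up_def[of b])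
  next
    case 4
    have "?u x = x" using u[of x] 4 by auto
    moreover have "?u b \<le> k"
      using u0 perms_range[OF assms(1), of a] assms(3) \<open>\<pi> b \<le> k\<close> by (cases "\<pi> b < \<pi> a") auto
    ultimately show ?thesis using 4 u1 by (auto simp: top2_def up_def[of b])
  qed
qed

lemma top2_perms: "\<pi> \<in> perms k \<Longrightarrow> a \<in> {1..k} \<Longrightarrow> b \<in> {1..k} \<Longrightarrow> top2 a b \<pi> \<in> perms k"
  unfolding top2_def by (intro up_perms) auto

lemma top2_commute:
  assumes "\<pi> \<in> perms k" "a \<noteq> b" "a \<in> {1..k}" "b \<in> {1..k}"
  shows "top2 b a \<pi> = top2 a b \<pi> \<circ> tr a b"
proof
  fix x
  consider "x = a" | "x = b" | "x \<noteq> a" "x \<noteq> b" by blast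
  then show "top2 b a \<pi> x = (top2 a b \<pi> \<circ> tr a b) x"
    using assms by cases (simp_all add: top2_eq[of \<pi> k])
qed

lemma top2_swap_top:
  assumes "\<pi> \<in> perms k" "a \<noteq> b" "a \<in> {1..k}" "b \<in> {1..k}"
  shows "top2 a b (\<pi> \<circ> tr a b) = top2 a b \<pi>"
proof
  fix x
  have "\<pi> \<circ> tr a b \<in> perms k" using assms by (intro perms_comp perms_transpose)
  moreover consider "x = a" | "x = b" | "x \<noteq> a" "x \<noteq> b" by blast
  ultimately show "top2 a b (\<pi> \<circ> tr a b) x = top2 a b \<pi> x"
    using assms by cases (simp_all add: top2_eq[of _ k])
qed

lemma top2_swap_below:
  assumes "\<pi> \<in> perms k" "a \<noteq> b" "a \<in> {1..k}" "b \<in> {1..k}" "c \<in> {1..k}" "d \<in> {1..k}"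
    and "\<pi> d = Suc (\<pi> c)" "c \<notin> {a, b}" "d \<notin> {a, b}"
  shows "top2 a b (\<pi> \<circ> tr c d) = top2 a b \<pi> \<circ> tr c d"
    and "top2 a b \<pi> d = Suc (top2 a b \<pi> c)"
proof -
  have p: "\<pi> \<circ> tr c d \<in> perms k" using assms by (intro perms_comp perms_transpose)
  have inj: "\<pi> u = \<pi> v \<longleftrightarrow> u = v" for u v using perms_eq_iff[OF assms(1)] .
  have ne: "\<pi> c \<noteq> \<pi> a" "\<pi> c \<noteq> \<pi> b" "\<pi> d \<noteq> \<pi> a" "\<pi> d \<noteq> \<pi> b" using assms(8,9) by (auto simp: inj)
  have lt: "\<pi> d < \<pi> a \<longleftrightarrow> \<pi> c < \<pi> a" "\<pi> d < \<pi> b \<longleftrightarrow> \<pi> c < \<pi> b" using ne assms(7) by auto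
  show "top2 a b \<pi> d = Suc (top2 a b \<pi> c)"
    using assms lt by (simp add: top2_eq[of \<pi> k])
  have [simp]: "tr c d a = a" "tr c d b = b" using assms(8,9) by auto
  show "top2 a b (\<pi> \<circ> tr c d) = top2 a b \<pi> \<circ> tr c d"
  proof
    fix x
    consider "x = c" | "x = d" | "x \<noteq> c" "x \<noteq> d" by blast
    then show "top2 a b (\<pi> \<circ> tr c d) x = (top2 a b \<pi> \<circ> tr c d) x"
      using assms(5-9) lt
      by cases (auto simp: top2_eq[OF p assms(2-4)] top2_eq[OF assms(1-4)])
  qed
qed

text \<open>\<open>top2 a b\<close> only sees the relative order of the alternatives other than
  \<open>a\<close> and \<open>b\<close>; moving \<open>a\<close> past a neighbour leaves that order
  intact.\<close>

lemma top2_swap_first: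
  assumes "\<pi> \<in> perms k" "a \<noteq> b" "a \<in> {1..k}" "b \<in> {1..k}" "e \<in> {1..k}" "e \<noteq> b"
    and "\<pi> e = Suc (\<pi> a) \<or> \<pi> a = Suc (\<pi> e)"
  shows "top2 a b (\<pi> \<circ> tr a e) = top2 a b \<pi>"
proof
  fix x
  have p: "\<pi> \<circ> tr a e \<in> perms k" using assms by (intro perms_comp perms_transpose)
  have inj: "\<pi> u = \<pi> v \<longleftrightarrow> u = v" for u v using perms_eq_iff[OF assms(1)] .
  have b: "tr a e b = b" using assms(2,6) by auto
  have ae: "a \<noteq> e" using assms(7) by auto
  have ne: "\<pi> b \<noteq> \<pi> a" "\<pi> b \<noteq> \<pi> e" using assms(2,6) by (auto simp: inj)
  consider "x = a" | "x = b" | "x = e" | "x \<noteq> a" "x \<noteq> b" "x \<noteq> e" by blast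
  then show "top2 a b (\<pi> \<circ> tr a e) x = top2 a b \<pi> x"
  proof cases
    case 3
    then show ?thesis
      using assms(2-7) ae b ne by (auto simp: top2_eq[OF p assms(2-4)] top2_eq[OF assms(1-4)])
  next
    case 4
    then have "\<pi> x \<noteq> \<pi> a" "\<pi> x \<noteq> \<pi> e" by (simp_all add: inj)
    then have "\<pi> x < \<pi> e \<longleftrightarrow> \<pi> x < \<pi> a" using assms(7) by auto
    then show ?thesis
      using 4 b by (simp add: top2_eq[OF p assms(2-4)] top2_eq[OF assms(1-4)])
  qed (use assms(2) in \<open>simp_all add: top2_eq[OF p assms(2-4)] top2_eq[OF assms(1-4)]\<close>)
qed

lemma top2_swap_mixed:
  assumes "\<pi> \<in> perms k" "a \<noteq> b" "a \<in> {1..k}" "b \<in> {1..k}" "c \<in> {1..k}" "d \<in> {1..k}"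
    and "\<pi> d = Suc (\<pi> c)" "c \<in> {a, b} \<or> d \<in> {a, b}"
  shows "top2 a b (\<pi> \<circ> tr c d) = top2 a b \<pi>"
proof -
  have first: "top2 u v (\<pi> \<circ> tr c d) = top2 u v \<pi>"
    if "u \<noteq> v" "u \<in> {1..k}" "v \<in> {1..k}" "c = u \<or> d = u" for u v
  proof (cases "{c, d} = {u, v}")
    case True
    then have "tr c d = tr u v" by (auto simp: doubleton_eq_iff transpose_commute)
    then show ?thesis using top2_swap_top[OF assms(1) that(1-3)] by simp
  next
    case False
    from that(4) show ?thesis
    proof
      assume c: "c = u"
      then have "d \<noteq> v" using False by auto
      then show ?thesis using top2_swap_first[OF assms(1) that(1-3) assms(6)] assms(7) c by auto
    next
      assume d: "d = u"
      then have "c \<noteq> v" using False by auto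
      then show ?thesis
        using top2_swap_first[OF assms(1) that(1-3) assms(5)] assms(7) d
        by (auto simp: transpose_commute)
    qed
  qed
  show ?thesis
  proof (cases "c = a \<or> d = a")
    case True
    then show ?thesis using first[of a b] assms(2-4) by simp
  next
    case False
    \<comment> \<open>Only \<open>b\<close> is involved here: the claim holds for
      \<open>top2 b a\<close>, and \<open>top2_commute\<close> carries it back.\<close>
    then have eq: "top2 b a (\<pi> \<circ> tr c d) = top2 b a \<pi>" using first[of b a] assms(2-4,8) by auto
    have "\<pi> \<circ> tr c d \<in> perms k" using assms by (intro perms_comp perms_transpose)
    then show ?thesis
      using top2_commute[of _ k b a] eq assms(1-4) by metis
  qed
qed

lemma up_up_inj:
  assumes "\<pi> \<in> perms k" "\<pi>' \<in> perms k" "a \<in> {1..k}" "b \<in> {1..k}" "1 \<le> s"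
    and "up b t (up a s \<pi>) = up b t (up a s \<pi>')" "\<pi> a = \<pi>' a" "\<pi> b = \<pi>' b"
  shows "\<pi> = \<pi>'"
proof -
  have "up a s \<pi> b = up a s \<pi>' b" using assms(7,8) by (simp add: up_def)
  then have "up a s \<pi> = up a s \<pi>'"
    using up_inj[OF up_perms[of \<pi> k a s] up_perms[of \<pi>' k a s]] assms by blast
  then show ?thesis using up_inj[of \<pi> k \<pi>' a s] assms by blast
qed

section \<open>Reverse hypercontractivity\<close>

lemma card_perms_relabel:
  assumes "g \<in> perms k"
  shows "card {\<pi> \<in> perms k. P (\<pi> \<circ> g)} = card {\<pi> \<in> perms k. P \<pi>}"
proof (rule bij_betw_same_card)
  have g: "inv g \<in> perms k" "\<And>\<pi>. \<pi> \<circ> inv g \<circ> g = \<pi>" "\<And>\<pi>. \<pi> \<circ> g \<circ> inv g = \<pi>"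
    using assms permutes_inv[of g "{1..k}"] permutes_inv_o[of g "{1..k}"]
    by (simp_all add: perms_def comp_assoc)
  then show "bij_betw (\<lambda>\<pi>. \<pi> \<circ> g) {\<pi> \<in> perms k. P (\<pi> \<circ> g)} {\<pi> \<in> perms k. P \<pi>}"
    using assms by (intro bij_betwI[where g = "\<lambda>\<pi>. \<pi> \<circ> inv g"]) (auto intro: perms_comp)
qed

definition chains :: "nat \<Rightarrow> nat \<Rightarrow> nat \<Rightarrow> nat \<Rightarrow> (nat \<Rightarrow> nat) set" where
  "chains k x y z = {\<pi> \<in> perms k. \<pi> x < \<pi> y \<and> \<pi> y < \<pi> z}"

text \<open>Relabelling permutes the six possible orders of three alternatives, so all six are
  equally frequent.\<close>

lemma card_perms_le_chains:
  assumes "x \<in> {1..k}" "y \<in> {1..k}" "z \<in> {1..k}" "x \<noteq> y" "y \<noteq> z" "x \<noteq> z"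
  shows "card (perms k) \<le> 6 * card (chains k x y z)"
proof -
  let ?C = "\<lambda>u v w. card (chains k u v w)"
  have L: "?C v u w = ?C u v w"
    if "u \<in> {1..k}" "v \<in> {1..k}" "w \<in> {1..k}" "w \<noteq> u" "w \<noteq> v" for u v w
    using card_perms_relabel[OF perms_transpose[OF that(1,2)], of "\<lambda>\<pi>. \<pi> u < \<pi> v \<and> \<pi> v < \<pi> w"] that
    by (simp add: chains_def)
  have R: "?C u w v = ?C u v w"
    if "u \<in> {1..k}" "v \<in> {1..k}" "w \<in> {1..k}" "u \<noteq> v" "u \<noteq> w" for u v w
    using card_perms_relabel[OF perms_transpose[OF that(2,3)], of "\<lambda>\<pi>. \<pi> u < \<pi> v \<and> \<pi> v < \<pi> w"] that
    by (simp add: chains_def)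
  have fin: "finite (chains k u v w)" for u v w by (simp add: chains_def finite_perms)
  let ?U = "[chains k x y z, chains k y x z, chains k x z y, chains k y z x, chains k z x y, chains k z y x]"
  have "perms k \<subseteq> \<Union>(set ?U)"
  proof
    fix \<pi> assume \<pi>: "\<pi> \<in> perms k"
    then have "\<pi> x \<noteq> \<pi> y" "\<pi> y \<noteq> \<pi> z" "\<pi> x \<noteq> \<pi> z" using assms perms_eq_iff by blast+
    then show "\<pi> \<in> \<Union>(set ?U)" using \<pi> by (simp add: chains_def) linarith
  qed
  then have "card (perms k) \<le> card (\<Union>(set ?U))" using fin by (intro card_mono) auto
  also have "\<dots> = card (\<Union>i<6. ?U ! i)"
    by (rule arg_cong[where f = card]) (auto simp: eval_nat_numeral lessThan_Suc)
  also have "\<dots> \<le> (\<Sum>i<6. card (?U ! i))" by (rule card_UN_le) simp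
  also have "\<dots> = ?C x y z + ?C y x z + ?C x z y + ?C y z x + ?C z x y + ?C z y x"
    by (simp add: eval_nat_numeral)
  also have "\<dots> = 6 * ?C x y z"
    using assms L[of x y z] R[of x y z] R[of y x z] L[of x z y] L[of y z x] by simp
  finally show ?thesis .
qed

text \<open>For pairs with a common alternative the event contains a chain, of share 1/6; for
  disjoint pairs the share is 1/4 by symmetry. The bound 1/8 lies below both and is what correlation
  at most 1/2 requires.\<close>

lemma card_perms_le_two_orders:
  assumes "a \<in> {1..k}" "b \<in> {1..k}" "c \<in> {1..k}" "d \<in> {1..k}" "a \<noteq> b" "c \<noteq> d" "{a, b} \<noteq> {c, d}"
  shows "card (perms k) \<le> 8 * card {\<pi> \<in> perms k. \<pi> a < \<pi> b \<and> \<pi> c < \<pi> d}"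
proof -
  let ?D = "{\<pi> \<in> perms k. \<pi> a < \<pi> b \<and> \<pi> c < \<pi> d}"
  have fin: "finite ?D" by (simp add: finite_perms)
  have chain: "card (perms k) \<le> 8 * card ?D"
    if "chains k x y z \<subseteq> ?D" "x \<in> {1..k}" "y \<in> {1..k}" "z \<in> {1..k}" "x \<noteq> y" "y \<noteq> z" "x \<noteq> z" for x y z
    using card_perms_le_chains[OF that(2-)] card_mono[OF fin that(1)] by linarith
  consider "a = c" "b \<noteq> d" | "a = d" "b \<noteq> c" | "b = c" "a \<noteq> d" | "b = d" "a \<noteq> c"
    | "a \<notin> {c, d}" "b \<notin> {c, d}" using assms(7) by blast
  then show ?thesis
  proof cases
    case 1
    then show ?thesis using assms by (intro chain[of a b d]) (auto simp: chains_def)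
  next
    case 2
    then show ?thesis using assms by (intro chain[of c a b]) (auto simp: chains_def)
  next
    case 3
    then show ?thesis using assms by (intro chain[of a b d]) (auto simp: chains_def)
  next
    case 4
    then show ?thesis using assms by (intro chain[of a c b]) (auto simp: chains_def)
  next
    case 5
    let ?E = "\<lambda>u v w z. {\<pi> \<in> perms k. \<pi> u < \<pi> v \<and> \<pi> w < \<pi> z}"
    have 1: "card (?E b a c d) = card (?E a b c d)"
      using card_perms_relabel[OF perms_transpose[OF assms(1,2)], of "\<lambda>\<pi>. \<pi> a < \<pi> b \<and> \<pi> c < \<pi> d"] 5
      by auto
    have 2: "card (?E a b d c) = card (?E a b c d)"
      using card_perms_relabel[OF perms_transpose[OF assms(3,4)], of "\<lambda>\<pi>. \<pi> a < \<pi> b \<and> \<pi> c < \<pi> d"] 5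
      by auto
    have 3: "card (?E b a d c) = card (?E a b d c)"
      using card_perms_relabel[OF perms_transpose[OF assms(1,2)], of "\<lambda>\<pi>. \<pi> a < \<pi> b \<and> \<pi> d < \<pi> c"] 5
      by auto
    have "perms k \<subseteq> (?E a b c d \<union> ?E b a c d) \<union> (?E a b d c \<union> ?E b a d c)"
    proof
      fix \<pi> assume \<pi>: "\<pi> \<in> perms k"
      then have "\<pi> a \<noteq> \<pi> b" "\<pi> c \<noteq> \<pi> d" using assms perms_eq_iff by blast+
      then show "\<pi> \<in> (?E a b c d \<union> ?E b a c d) \<union> (?E a b d c \<union> ?E b a d c)" using \<pi> by auto
    qed
    then have "card (perms k) \<le> card ((?E a b c d \<union> ?E b a c d) \<union> (?E a b d c \<union> ?E b a d c))"
      by (intro card_mono) (auto simp: finite_perms)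
    also have "\<dots> \<le> card (?E a b c d \<union> ?E b a c d) + card (?E a b d c \<union> ?E b a d c)"
      by (rule card_Un_le)
    also have "\<dots> \<le> (card (?E a b c d) + card (?E b a c d)) + (card (?E a b d c) + card (?E b a d c))"
      by (intro add_mono card_Un_le)
    finally show ?thesis using 1 2 3 by simp
  qed
qed

lemma sum_perms_by_two_orders:
  fixes h :: "bool \<Rightarrow> bool \<Rightarrow> real"
  shows "(\<Sum>\<pi>\<in>perms k. h (\<pi> a < \<pi> b) (\<pi> c < \<pi> d)) =
    (\<Sum>p\<in>UNIV. \<Sum>q\<in>UNIV. real (card {\<pi> \<in> perms k. (\<pi> a < \<pi> b) = p \<and> (\<pi> c < \<pi> d) = q}) * h p q)"
proof -
  have "(\<Sum>\<pi>\<in>perms k. h (\<pi> a < \<pi> b) (\<pi> c < \<pi> d)) =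
    (\<Sum>\<pi>\<in>perms k. \<Sum>p\<in>UNIV. \<Sum>q\<in>UNIV. of_bool ((\<pi> a < \<pi> b) = p \<and> (\<pi> c < \<pi> d) = q) * h p q)"
  proof (intro sum.cong refl)
    fix \<pi> :: "nat \<Rightarrow> nat"
    show "h (\<pi> a < \<pi> b) (\<pi> c < \<pi> d) =
        (\<Sum>p\<in>UNIV. \<Sum>q\<in>UNIV. of_bool ((\<pi> a < \<pi> b) = p \<and> (\<pi> c < \<pi> d) = q) * h p q)"
      by (cases "\<pi> a < \<pi> b"; cases "\<pi> c < \<pi> d") (simp_all add: UNIV_bool del: sum_of_bool_mult_eq)
  qed
  also have "\<dots> = (\<Sum>p\<in>UNIV. \<Sum>q\<in>UNIV. \<Sum>\<pi>\<in>perms k. of_bool ((\<pi> a < \<pi> b) = p \<and> (\<pi> c < \<pi> d) = q) * h p q)"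
    by (subst sum.swap, intro sum.cong refl, rule sum.swap)
  also have "\<dots> = (\<Sum>p\<in>UNIV. \<Sum>q\<in>UNIV. real (card {\<pi> \<in> perms k. (\<pi> a < \<pi> b) = p \<and> (\<pi> c < \<pi> d) = q}) * h p q)"
    by (intro sum.cong refl) (simp add: sum_distrib_right[symmetric] finite_perms Int_def)
  finally show ?thesis .
qed

text \<open>Borell's condition for exponents 1/2: p / N is the probability that both bits are true,
  and the range from 1/8 to 3/8 means correlation at most 1/2 in absolute value. The right side
  exceeds the left by N (X^2 + Y^2) + N Z^2 + r X Y, and |r| \<le> 2 N makes this
  nonnegative.\<close>

lemma two_point_inequality:
  fixes N p u u' s s' :: real
  assumes "N / 8 \<le> p" "p \<le> 3 * N / 8"
  shows "N * ((u + u')\<^sup>2 * (s + s')\<^sup>2) \<le>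
    16 * (p * (u\<^sup>2 * s\<^sup>2 + u'\<^sup>2 * s'\<^sup>2) + (N / 2 - p) * (u\<^sup>2 * s'\<^sup>2 + u'\<^sup>2 * s\<^sup>2))"
proof -
  define X where "X = (u + u') * (s - s')"
  define Y where "Y = (u - u') * (s + s')"
  define Z where "Z = (u - u') * (s - s')"
  define r where "r = (p - N / 4) * 16"
  have r: "\<bar>r\<bar> \<le> 2 * N" using assms by (auto simp: r_def abs_le_iff)
  have "2 * \<bar>X * Y\<bar> \<le> X\<^sup>2 + Y\<^sup>2"
    using sum_squares_bound[of "\<bar>X\<bar>" "\<bar>Y\<bar>"] by (simp add: abs_mult)
  moreover have "N \<ge> 0" using assms by linarith
  ultimately have "2 * N * \<bar>X * Y\<bar> \<le> N * (X\<^sup>2 + Y\<^sup>2)"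
    by (metis mult.assoc mult.left_commute mult_left_mono)
  moreover have "\<bar>r * (X * Y)\<bar> \<le> 2 * N * \<bar>X * Y\<bar>"
    using r by (simp add: abs_mult mult_right_mono)
  moreover have "0 \<le> N * Z\<^sup>2" using \<open>N \<ge> 0\<close> by simp
  moreover have "16 * (p * (u\<^sup>2 * s\<^sup>2 + u'\<^sup>2 * s'\<^sup>2) + (N / 2 - p) * (u\<^sup>2 * s'\<^sup>2 + u'\<^sup>2 * s\<^sup>2))
    = N * ((u + u')\<^sup>2 * (s + s')\<^sup>2) + N * (X\<^sup>2 + Y\<^sup>2) + N * Z\<^sup>2 + r * (X * Y)"
    unfolding X_def Y_def Z_def r_def by (simp add: power2_eq_square field_simps)
  ultimately show ?thesis by linarith
qed

text \<open>Both bits are unbiased, so one cell count determines the other three. The lower bound N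
  / 8 for the cell (True, False) is the upper bound 3 N / 8 for (True, True).\<close>

lemma two_orders_inequality:
  fixes u s :: "bool \<Rightarrow> real"
  assumes "a \<in> {1..k}" "b \<in> {1..k}" "c \<in> {1..k}" "d \<in> {1..k}" "a \<noteq> b" "c \<noteq> d" "{a, b} \<noteq> {c, d}"
  shows "card (perms k) * ((u True + u False)\<^sup>2 * (s True + s False)\<^sup>2) \<le>
    16 * (\<Sum>\<pi>\<in>perms k. (u (\<pi> a < \<pi> b))\<^sup>2 * (s (\<pi> c < \<pi> d))\<^sup>2)"
proof -
  let ?n = "\<lambda>p q. card {\<pi> \<in> perms k. (\<pi> a < \<pi> b) = p \<and> (\<pi> c < \<pi> d) = q}"
  have flip: "card {\<pi> \<in> perms k. \<pi> x < \<pi> y} = card {\<pi> \<in> perms k. \<not> \<pi> x < \<pi> y}"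
    if "x \<in> {1..k}" "y \<in> {1..k}" "x \<noteq> y" for x y
  proof -
    have "{\<pi> \<in> perms k. \<not> \<pi> x < \<pi> y} = {\<pi> \<in> perms k. \<pi> y < \<pi> x}"
      using perms_eq_iff that(3) by (metis (lifting) linorder_neqE_nat order_less_asym)
    then show ?thesis
      using card_perms_relabel[OF perms_transpose[OF that(1,2)], of "\<lambda>\<pi>. \<pi> x < \<pi> y"] by simp
  qed
  have split: "card {\<pi> \<in> perms k. P \<pi>} = card {\<pi> \<in> perms k. P \<pi> \<and> Q \<pi>} + card {\<pi> \<in> perms k. P \<pi> \<and> \<not> Q \<pi>}"
    for P Q
    by (subst card_Un_disjoint[symmetric]) (auto simp: finite_perms intro: arg_cong[where f = card])
  have "card (perms k) = card {\<pi> \<in> perms k. \<pi> a < \<pi> b} + card {\<pi> \<in> perms k. \<not> \<pi> a < \<pi> b}"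
    using split[of "\<lambda>_. True" "\<lambda>\<pi>. \<pi> a < \<pi> b"] by simp
  moreover have "card {\<pi> \<in> perms k. \<pi> a < \<pi> b} = ?n True True + ?n True False"
    using split[of "\<lambda>\<pi>. \<pi> a < \<pi> b" "\<lambda>\<pi>. \<pi> c < \<pi> d"] by simp
  moreover have "card {\<pi> \<in> perms k. \<not> \<pi> a < \<pi> b} = ?n False True + ?n False False"
    using split[of "\<lambda>\<pi>. \<not> \<pi> a < \<pi> b" "\<lambda>\<pi>. \<pi> c < \<pi> d"] by simp
  moreover have "card {\<pi> \<in> perms k. \<pi> c < \<pi> d} = ?n True True + ?n False True"
    using split[of "\<lambda>\<pi>. \<pi> c < \<pi> d" "\<lambda>\<pi>. \<pi> a < \<pi> b"] by (simp add: conj_commute)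
  moreover have "card {\<pi> \<in> perms k. \<not> \<pi> c < \<pi> d} = ?n True False + ?n False False"
    using split[of "\<lambda>\<pi>. \<not> \<pi> c < \<pi> d" "\<lambda>\<pi>. \<pi> a < \<pi> b"] by (simp add: conj_commute)
  ultimately have n: "?n False False = ?n True True" "?n True False = ?n False True"
    "card (perms k) = 2 * ?n True True + 2 * ?n True False"
    using flip[of a b] flip[of c d] assms by linarith+
  have tt: "card (perms k) \<le> 8 * ?n True True"
    using card_perms_le_two_orders[OF assms] by simp
  have "{\<pi> \<in> perms k. (\<pi> a < \<pi> b) = True \<and> (\<pi> c < \<pi> d) = False} = {\<pi> \<in> perms k. \<pi> a < \<pi> b \<and> \<pi> d < \<pi> c}"
    using perms_eq_iff assms(6) by (auto; metis linorder_neqE_nat)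
  then have tf: "card (perms k) \<le> 8 * ?n True False"
    using card_perms_le_two_orders[of a k b d c] assms by (simp add: insert_commute)
  define N where "N = real (card (perms k))"
  define p where "p = real (?n True True)"
  have p: "N / 8 \<le> p" "p \<le> 3 * N / 8" "real (?n True False) = N / 2 - p" "real (?n False True) = N / 2 - p"
      "real (?n False False) = p"
    using n tt tf unfolding N_def p_def by linarith+
  have sum_bool: "(\<Sum>p\<in>UNIV. \<Sum>q\<in>UNIV. H p q) = H True True + H True False + H False True + H False False"
    for H :: "bool \<Rightarrow> bool \<Rightarrow> real"
    by (simp add: UNIV_bool)
  have "(\<Sum>\<pi>\<in>perms k. (u (\<pi> a < \<pi> b))\<^sup>2 * (s (\<pi> c < \<pi> d))\<^sup>2) =
    p * ((u True)\<^sup>2 * (s True)\<^sup>2 + (u False)\<^sup>2 * (s False)\<^sup>2) +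
    (N / 2 - p) * ((u True)\<^sup>2 * (s False)\<^sup>2 + (u False)\<^sup>2 * (s True)\<^sup>2)"
    unfolding sum_perms_by_two_orders[of "\<lambda>p q. (u p)\<^sup>2 * (s q)\<^sup>2"] sum_bool p(3-5) p_def[symmetric]
    by (simp add: algebra_simps)
  then show ?thesis
    using two_point_inequality[OF p(1,2), of "u True" "u False" "s True" "s False"]
    unfolding N_def[symmetric] by simp
qed

lemma sum_Pow_insert:
  fixes h :: "'a set \<Rightarrow> real"
  assumes "finite J" "l \<notin> J"
  shows "sum h (Pow (insert l J)) = (\<Sum>T\<in>Pow J. h (insert l T)) + sum h (Pow J)"
proof -
  have "inj_on (insert l) (Pow J)" using assms by (auto simp: inj_on_def)
  then have "sum h (insert l ` Pow J) = (\<Sum>T\<in>Pow J. h (insert l T))" by (simp add: sum.reindex)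
  moreover have "sum h (Pow (insert l J)) = sum h (Pow J) + sum h (insert l ` Pow J)"
    unfolding Pow_insert using assms by (intro sum.union_disjoint) auto
  ultimately show ?thesis by simp
qed

lemma sum_PiE_insert:
  fixes h :: "('a \<Rightarrow> 'b) \<Rightarrow> real"
  assumes "l \<notin> J"
  shows "sum h (insert l J \<rightarrow>\<^sub>E A) = (\<Sum>v\<in>A. \<Sum>x\<in>J \<rightarrow>\<^sub>E A. h (x(l := v)))"
  unfolding PiE_insert_eq sum.cartesian_product
  by (subst sum.reindex[OF inj_combinator[OF assms]]) (simp add: o_def case_prod_unfold)

text \<open>Borell's reverse hypercontractivity; the exponents \<open>1/2\<close> suffice here and make the
  two-point inequality polynomial.\<close>

lemma reverse_hypercontractivity:
  fixes u s :: "nat set \<Rightarrow> real"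
  assumes "finite J"
    and "a \<in> {1..k}" "b \<in> {1..k}" "c \<in> {1..k}" "d \<in> {1..k}" "a \<noteq> b" "c \<noteq> d" "{a, b} \<noteq> {c, d}"
  shows "card (perms k) ^ card J * ((sum u (Pow J))\<^sup>2 * (sum s (Pow J))\<^sup>2) \<le>
    16 ^ card J * (\<Sum>x\<in>J \<rightarrow>\<^sub>E perms k. (u {l \<in> J. x l a < x l b})\<^sup>2 * (s {l \<in> J. x l c < x l d})\<^sup>2)"
  using assms(1)
proof (induction J arbitrary: u s rule: finite_induct)
  case empty
  then show ?case by simp
next
  case (insert l J)
  let ?N = "real (card (perms k))"
  \<comment> \<open>The slices of \<open>u\<close> and \<open>s\<close> with the bit of the new
    voter fixed. The induction hypothesis handles each pair of slices; the inequality for one voter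
    is applied to the sums of the slices.\<close>
  define U where "U p = (\<lambda>T. u (if p then insert l T else T))" for p
  define S where "S p = (\<lambda>T. s (if p then insert l T else T))" for p
  define G where "G p q = (\<Sum>x\<in>J \<rightarrow>\<^sub>E perms k. (U p {l \<in> J. x l a < x l b})\<^sup>2 * (S q {l \<in> J. x l c < x l d})\<^sup>2)"
    for p q
  have bits: "{m \<in> insert l J. (x(l := v)) m y < (x(l := v)) m z} =
      (if v y < v z then insert l {m \<in> J. x m y < x m z} else {m \<in> J. x m y < x m z})"
    for x :: "nat \<Rightarrow> nat \<Rightarrow> nat" and v y z
    using insert.hyps by auto
  have sum_G: "(\<Sum>x\<in>insert l J \<rightarrow>\<^sub>E perms k. (u {m \<in> insert l J. x m a < x m b})\<^sup>2 * (s {m \<in> insert l J. x m c < x m d})\<^sup>2)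
      = (\<Sum>v\<in>perms k. G (v a < v b) (v c < v d))"
    unfolding sum_PiE_insert[OF insert.hyps(2)] bits G_def U_def S_def ..
  have IH: "?N ^ card J * ((sum (U p) (Pow J))\<^sup>2 * (sum (S q) (Pow J))\<^sup>2) \<le> 16 ^ card J * G p q" for p q
    using insert.IH[of "U p" "S q"] unfolding G_def by simp
  have sum_u: "sum u (Pow (insert l J)) = sum (U True) (Pow J) + sum (U False) (Pow J)"
    and sum_s: "sum s (Pow (insert l J)) = sum (S True) (Pow J) + sum (S False) (Pow J)"
    using insert.hyps by (simp_all add: sum_Pow_insert U_def S_def)
  have "?N ^ card (insert l J) * ((sum u (Pow (insert l J)))\<^sup>2 * (sum s (Pow (insert l J)))\<^sup>2)
     = ?N ^ card J * (?N * ((sum (U True) (Pow J) + sum (U False) (Pow J))\<^sup>2 *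
         (sum (S True) (Pow J) + sum (S False) (Pow J))\<^sup>2))"
    using insert.hyps by (simp add: sum_u sum_s)
  also have "\<dots> \<le> ?N ^ card J * (16 * (\<Sum>v\<in>perms k. (sum (U (v a < v b)) (Pow J))\<^sup>2 * (sum (S (v c < v d)) (Pow J))\<^sup>2))"
    by (intro mult_left_mono two_orders_inequality[OF assms(2-), of "\<lambda>p. sum (U p) (Pow J)" "\<lambda>p. sum (S p) (Pow J)"]) simp
  also have "\<dots> = 16 * (\<Sum>v\<in>perms k. ?N ^ card J * ((sum (U (v a < v b)) (Pow J))\<^sup>2 * (sum (S (v c < v d)) (Pow J))\<^sup>2))"
    by (simp add: sum_distrib_left mult_ac)
  also have "\<dots> \<le> 16 * (\<Sum>v\<in>perms k. 16 ^ card J * G (v a < v b) (v c < v d))"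
    by (intro mult_left_mono sum_mono IH) simp
  also have "\<dots> = 16 ^ card (insert l J) * (\<Sum>v\<in>perms k. G (v a < v b) (v c < v d))"
    using insert.hyps by (simp add: sum_distrib_left mult_ac)
  finally show ?case unfolding sum_G of_nat_power .
qed

section \<open>Pivotal voters and manipulation points\<close>

text \<open>No alternative lies strictly between two neighbours, so only the swap of
  \<open>a\<close> and \<open>b\<close> themselves can change their order.\<close>

lemma adjacent_swap_order:
  assumes "\<pi> \<in> perms k" "\<pi> d = Suc (\<pi> c)" "{c, d} \<noteq> {a, b}"
  shows "\<pi> (tr c d a) < \<pi> (tr c d b) \<longleftrightarrow> \<pi> a < \<pi> b"
proof -
  have inj: "\<pi> u = \<pi> v \<longleftrightarrow> u = v" for u v using perms_eq_iff[OF assms(1)] .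
  have side: "\<pi> d < \<pi> u \<longleftrightarrow> \<pi> c < \<pi> u" "\<pi> u < \<pi> d \<longleftrightarrow> \<pi> u < \<pi> c" if "u \<noteq> c" "u \<noteq> d" for u
    using that inj[of u c] inj[of u d] assms(2) by auto
  consider "a = b" | "a \<notin> {c, d}" "b \<notin> {c, d}" | "a \<in> {c, d}" "b \<notin> {c, d}" | "a \<notin> {c, d}" "b \<in> {c, d}"
    using assms(3) by blast
  then show ?thesis
  proof cases
    case 3
    then show ?thesis using side[of b] by auto
  next
    case 4
    then show ?thesis using side[of a] by auto
  qed simp_all
qed

lemma tr_conj: "tr c d \<circ> tr a b = tr a b \<circ> tr (tr a b c) (tr a b d)"
  by (auto simp: fun_eq_iff Transposition.transpose_def)

text \<open>\<open>edge\<close> is all that the counting argument knows about manipulation; the set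
  of 4-manipulation points is substituted for \<open>M\<close> only in the final transfer.\<close>

locale scf = profile_space I k for I k +
  fixes F :: "(nat \<Rightarrow> nat \<Rightarrow> nat) \<Rightarrow> nat" and M :: "(nat \<Rightarrow> nat \<Rightarrow> nat) set"
  assumes M_subset: "M \<subseteq> \<Omega>"
    and F_range: "x \<in> \<Omega> \<Longrightarrow> F x \<in> {1..k}"
    and edge: "\<lbrakk>x \<in> \<Omega>; l \<in> I; a \<in> {1..k}; b \<in> {1..k}; x l b = Suc (x l a);
      x \<notin> M; swap_at l a b x \<notin> M; F x \<noteq> F (swap_at l a b x)\<rbrakk>
      \<Longrightarrow> F x = a \<and> F (swap_at l a b x) = b"
begin

section \<open>Lifting a winner, and counting the profiles where this fails\<close>

lemma edge_cases:
  assumes "x \<in> \<Omega>" "l \<in> I" "a \<in> {1..k}" "b \<in> {1..k}" "x l b = Suc (x l a)"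
    and "x \<notin> M" "swap_at l a b x \<notin> M"
  shows "F (swap_at l a b x) = F x \<or> F x = a \<and> F (swap_at l a b x) = b"
  using edge[OF assms] by argo

lemma finite_M: "finite M"
  using M_subset finite_\<Omega> by (rule finite_subset)

lemma card_pullback_le:
  assumes "finite K" "\<kappa> ` perms k \<subseteq> K" "inj_on (\<lambda>\<pi>. (\<phi> \<pi>, \<kappa> \<pi>)) (perms k)" "i \<in> I" "finite R"
  shows "card {x \<in> \<Omega>. x(i := \<phi> (x i)) \<in> R} \<le> card K * card R"
proof (rule card_fibres_le[OF assms(5,1), where \<phi> = "\<lambda>x. x(i := \<phi> (x i))" and \<kappa> = "\<lambda>x. \<kappa> (x i)"])
  show "inj_on (\<lambda>x. (x(i := \<phi> (x i)), \<kappa> (x i))) {x \<in> \<Omega>. x(i := \<phi> (x i)) \<in> R}"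
  proof (rule inj_onI)
    fix x y
    assume x: "x \<in> {x \<in> \<Omega>. x(i := \<phi> (x i)) \<in> R}" and y: "y \<in> {x \<in> \<Omega>. x(i := \<phi> (x i)) \<in> R}"
      and eq: "(x(i := \<phi> (x i)), \<kappa> (x i)) = (y(i := \<phi> (y i)), \<kappa> (y i))"
    have upd: "x(i := \<phi> (x i)) = y(i := \<phi> (y i))" using eq by simp
    have "\<phi> (x i) = \<phi> (y i)" using fun_cong[OF upd, of i] by simp
    then have "x i = y i"
      using inj_onD[OF assms(3), of "x i" "y i"] eq x y \<Omega>_perms assms(4) by simp
    then show "x = y" using upd by (metis fun_upd_triv fun_upd_upd)
  qed
qed (use assms \<Omega>_perms in auto)

lemma card_up_preimage:
  assumes "i \<in> I" "a \<in> {1..k}" "finite R"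
  shows "card {x \<in> \<Omega>. x(i := up a s (x i)) \<in> R} \<le> k * card R"
proof -
  have "(\<lambda>\<pi>. \<pi> a) ` perms k \<subseteq> {1..k}" using perms_range assms(2) by blast
  moreover have "inj_on (\<lambda>\<pi>. (up a s \<pi>, \<pi> a)) (perms k)"
    by (rule inj_onI) (metis Pair_inject up_inj)
  ultimately show ?thesis using card_pullback_le[of "{1..k}" "\<lambda>\<pi>. \<pi> a" "up a s" i R] assms by simp
qed

text \<open>The path that lifts \<open>a\<close> step by step to the top meets \<open>M\<close>. For
  \<open>s\<close> at or beyond the position of \<open>a\<close> the lift is \<open>x\<close>
  itself, so quantifying over all positions covers the path without naming its start.\<close>

definition bad1 :: "nat \<Rightarrow> nat \<Rightarrow> (nat \<Rightarrow> nat \<Rightarrow> nat) set" where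
  "bad1 i a = {x \<in> \<Omega>. \<exists>s\<in>{1..k}. x(i := up a s (x i)) \<in> M}"

definition bad2 :: "nat \<Rightarrow> nat \<Rightarrow> nat \<Rightarrow> (nat \<Rightarrow> nat \<Rightarrow> nat) set" where
  "bad2 i a b = {x \<in> \<Omega>. \<exists>s\<in>{1..k}. x(i := up b s (up a 1 (x i))) \<in> M}"

lemma card_bad1:
  assumes "i \<in> I" "a \<in> {1..k}"
  shows "card (bad1 i a) \<le> k ^ 2 * card M"
proof -
  have "bad1 i a = (\<Union>s\<in>{1..k}. {x \<in> \<Omega>. x(i := up a s (x i)) \<in> M})"
    by (auto simp: bad1_def)
  then have "card (bad1 i a) \<le> (\<Sum>s\<in>{1..k}. card {x \<in> \<Omega>. x(i := up a s (x i)) \<in> M})"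
    using card_UN_le[of "{1..k}"] by simp
  also have "\<dots> \<le> (\<Sum>s\<in>{1..k}. k * card M)"
    using assms finite_M by (intro sum_mono card_up_preimage)
  finally show ?thesis by (simp add: power2_eq_square)
qed

lemma up_up_inj_on:
  assumes "a \<in> {1..k}" "b \<in> {1..k}"
  shows "inj_on (\<lambda>\<pi>. (up b s (up a 1 \<pi>), \<pi> a, \<pi> b)) (perms k)"
    "(\<lambda>\<pi>. (\<pi> a, \<pi> b)) ` perms k \<subseteq> {1..k} \<times> {1..k}"
proof -
  show "inj_on (\<lambda>\<pi>. (up b s (up a 1 \<pi>), \<pi> a, \<pi> b)) (perms k)"
  proof (rule inj_onI)
    fix \<pi> \<pi>' assume "\<pi> \<in> perms k" "\<pi>' \<in> perms k"
      "(up b s (up a 1 \<pi>), \<pi> a, \<pi> b) = (up b s (up a 1 \<pi>'), \<pi>' a, \<pi>' b)"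
    then show "\<pi> = \<pi>'" using up_up_inj[of \<pi> k \<pi>' a b 1 s] assms by simp
  qed
  show "(\<lambda>\<pi>. (\<pi> a, \<pi> b)) ` perms k \<subseteq> {1..k} \<times> {1..k}" using perms_range assms by blast
qed

text \<open>There are k choices of \<open>s\<close>, and for each of them k^2 possible old positions
  of \<open>a\<close> and \<open>b\<close>.\<close>

lemma card_bad2:
  assumes "i \<in> I" "a \<in> {1..k}" "b \<in> {1..k}"
  shows "card (bad2 i a b) \<le> k ^ 3 * card M"
proof -
  have "bad2 i a b = (\<Union>s\<in>{1..k}. {x \<in> \<Omega>. x(i := up b s (up a 1 (x i))) \<in> M})"
    by (auto simp: bad2_def)
  then have "card (bad2 i a b) \<le> (\<Sum>s\<in>{1..k}. card {x \<in> \<Omega>. x(i := up b s (up a 1 (x i))) \<in> M})"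
    using card_UN_le[of "{1..k}"] by simp
  also have "\<dots> \<le> (\<Sum>s\<in>{1..k}. card ({1..k} \<times> {1..k}) * card M)"
    using up_up_inj_on[OF assms(2,3)] assms(1)
    finite_M by (intro sum_mono card_pullback_le[where \<kappa> = "\<lambda>\<pi>. (\<pi> a, \<pi> b)"]) auto
  finally show ?thesis by (simp add: power3_eq_cube mult_ac)
qed

lemma up_upd_step:
  assumes "\<pi> \<in> perms k" "1 \<le> s" "s < \<pi> c" "c \<in> {1..k}"
  obtains e where "e \<in> {1..k}" "e \<noteq> c" "\<pi> e = s" "up c (Suc s) \<pi> c = Suc (up c (Suc s) \<pi> e)"
    "x(i := up c s \<pi>) = swap_at i e c (x(i := up c (Suc s) \<pi>))"
proof -
  define e where "e = inv \<pi> s"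
  have p: "\<pi> permutes {1..k}" using assms by (simp add: perms_def)
  have e: "\<pi> e = s" using permutes_inverses(1)[OF p] by (simp add: e_def)
  have "s \<in> {1..k}" using assms perms_range[OF assms(1), of c] by auto
  then have "e \<in> {1..k}" using e permutes_in_image[OF p, of e] by auto
  moreover have "x(i := up c s \<pi>) = swap_at i e c (x(i := up c (Suc s) \<pi>))"
    using up_step(1)[OF assms(1) e assms(3)] by (simp add: swap_at_def transpose_commute)
  ultimately show ?thesis using that[of e] e assms(3) up_step(2)[OF assms(1) e assms(3)] by auto
qed

text \<open>Each step lifts \<open>c\<close> past its upper neighbour \<open>e\<close>, and an edge
  outside \<open>M\<close> could only change the outcome from \<open>e\<close> to \<open>c\<close>;
  so \<open>c\<close>, once winning, stays winning.\<close>

lemma up_keeps_winner: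
  assumes "x \<in> \<Omega>" "i \<in> I" "c \<in> {1..k}" "F x = c" "x \<notin> bad1 i c"
  shows "F (x(i := up c 1 (x i))) = c"
proof -
  have \<pi>: "x i \<in> perms k" using assms \<Omega>_perms by blast
  have pos: "1 \<le> x i c" "x i c \<le> k" using perms_range[OF \<pi>, of c] assms(3) by auto
  have nM: "x(i := up c s (x i)) \<notin> M" if "1 \<le> s" "s \<le> k" for s
    using assms(1,5) that by (auto simp: bad1_def)
  \<comment> \<open>The guard \<open>1 \<le> s\<close> excludes position 0, to which the downward
    induction would otherwise extend.\<close>
  have "1 \<le> s \<longrightarrow> F (x(i := up c s (x i))) = c" if "s \<le> x i c" for s
    using that
  proof (induction rule: inc_induct)
    case base
    then show ?case using assms(4) by (simp add: up_self)
  next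
    case (step s)
    show ?case
    proof
      assume s: "1 \<le> s"
      obtain e where e: "e \<in> {1..k}" "e \<noteq> c" "x i e = s"
          "up c (Suc s) (x i) c = Suc (up c (Suc s) (x i) e)"
        and sw: "x(i := up c s (x i)) = swap_at i e c (x(i := up c (Suc s) (x i)))"
        using up_upd_step[OF \<pi> s step.hyps(2) assms(3), of x i] by blast
      let ?y = "x(i := up c (Suc s) (x i))"
      have "?y \<in> \<Omega>" using assms \<pi> by (intro \<Omega>_upd up_perms) auto
      moreover have "?y \<notin> M" "swap_at i e c ?y \<notin> M"
        using nM[of "Suc s"] nM[of s] s step.hyps pos sw by auto
      moreover have "F ?y = c" by (rule mp[OF step.IH]) simp
      ultimately show "F (x(i := up c s (x i))) = c"
        using edge_cases[of ?y i e c] e assms(2,3) sw by auto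
    qed
  qed
  then show ?thesis using pos by blast
qed

text \<open>With \<open>a\<close> fixed at the top and the lifting stopped at position 2, every step
  swaps \<open>b\<close> with some e \<noteq> a, so the outcome \<open>a\<close> is neither lost nor
  gained.\<close>

lemma up_below_winner:
  assumes "x \<in> \<Omega>" "i \<in> I" "a \<in> {1..k}" "b \<in> {1..k}" "a \<noteq> b" "x i a = 1"
    and nM: "\<And>s. s \<in> {1..k} \<Longrightarrow> x(i := up b s (x i)) \<notin> M"
  shows "F (x(i := up b 2 (x i))) = a \<longleftrightarrow> F x = a"
proof -
  have \<pi>: "x i \<in> perms k" using assms \<Omega>_perms by blast
  have "x i b \<noteq> x i a" using assms(5) by (simp add: perms_eq_iff[OF \<pi>])
  then have pos: "2 \<le> x i b" "x i b \<le> k" using perms_range[OF \<pi>, of b] assms(4,6) by auto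
  have "2 \<le> s \<longrightarrow> (F (x(i := up b s (x i))) = a \<longleftrightarrow> F x = a)" if "s \<le> x i b" for s
    using that
  proof (induction rule: inc_induct)
    case base
    then show ?case by (simp add: up_self)
  next
    case (step s)
    show ?case
    proof
      assume s: "2 \<le> s"
      then obtain e where e: "e \<in> {1..k}" "e \<noteq> b" "x i e = s"
          "up b (Suc s) (x i) b = Suc (up b (Suc s) (x i) e)"
        and sw: "x(i := up b s (x i)) = swap_at i e b (x(i := up b (Suc s) (x i)))"
        using up_upd_step[OF \<pi> _ step.hyps(2) assms(4), of x i] by auto
      have "e \<noteq> a" using e(3) s assms(6) by auto
      let ?y = "x(i := up b (Suc s) (x i))"
      have "?y \<in> \<Omega>" using assms \<pi> by (intro \<Omega>_upd up_perms) auto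
      moreover have "?y \<notin> M" "swap_at i e b ?y \<notin> M"
        using nM[of "Suc s"] nM[of s] s step.hyps pos sw by auto
      moreover have "F ?y = a \<longleftrightarrow> F x = a" by (rule mp[OF step.IH]) (use s in simp)
      ultimately show "F (x(i := up b s (x i))) = a \<longleftrightarrow> F x = a"
        using edge_cases[of ?y i e b] e assms(2,4,5) sw \<open>e \<noteq> a\<close> by auto
    qed
  qed
  then show ?thesis using pos by blast
qed

lemma F_top2_iff:
  assumes "x \<in> \<Omega>" "i \<in> I" "a \<in> {1..k}" "b \<in> {1..k}" "a \<noteq> b" "x \<notin> bad2 i a b"
  shows "F (x(i := top2 a b (x i))) = a \<longleftrightarrow> F (x(i := up a 1 (x i))) = a"
proof -
  have \<pi>: "x i \<in> perms k" using assms \<Omega>_perms by blast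
  let ?y = "x(i := up a 1 (x i))"
  have "?y \<in> \<Omega>" using assms \<pi> by (intro \<Omega>_upd up_perms) auto
  moreover have "?y i a = 1" using up_1[OF \<pi> assms(3), of a] by simp
  moreover have "?y(i := up b s (?y i)) \<notin> M" if "s \<in> {1..k}" for s
    using assms(1,6) that by (auto simp: bad2_def)
  ultimately show ?thesis
    using up_below_winner[of ?y i a b] assms by (simp add: top2_def)
qed

section \<open>Pivotality and its version stable under swaps\<close>

definition piv :: "nat \<Rightarrow> nat \<Rightarrow> nat \<Rightarrow> (nat \<Rightarrow> nat \<Rightarrow> nat) set" where
  "piv l a b = {x \<in> \<Omega>. x l b = Suc (x l a) \<and> F x = a \<and> F (swap_at l a b x) = b}"

text \<open>A profile lies in \<open>top_piv i a b\<close> when, after lifting \<open>{a, b}\<close> to the top of ranking \<open>i\<close>,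
  voter \<open>i\<close> decides between \<open>a\<close> and \<open>b\<close>. Lifting a winner does not change the outcome unless a
  manipulation point is met, so this event inherits the mass of \<open>piv\<close>. Unlike \<open>piv\<close> it is stable
  under every adjacent swap other than that of \<open>a\<close> and \<open>b\<close>.\<close>

definition top_piv :: "nat \<Rightarrow> nat \<Rightarrow> nat \<Rightarrow> (nat \<Rightarrow> nat \<Rightarrow> nat) set" where
  "top_piv i a b = {x \<in> \<Omega>. F (x(i := top2 a b (x i))) = a \<and>
     F (x(i := top2 a b (x i) \<circ> tr a b)) = b}"

text \<open>Lifting in \<open>x\<close> keeps the winner \<open>a\<close>, and lifting in the
  swapped profile keeps the winner \<open>b\<close>. There \<open>top2 b a\<close> of the swapped
  ranking is \<open>top2 a b\<close> of the old one with \<open>a\<close> and \<open>b\<close>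
  exchanged, so the two lifts are exactly the two profiles tested by \<open>top_piv\<close>.\<close>

lemma piv_subset:
  assumes "i \<in> I" "a \<in> {1..k}" "b \<in> {1..k}" "a \<noteq> b"
  shows "piv i a b \<subseteq> top_piv i a b \<union> (bad1 i a \<union> bad2 i a b \<union>
    {x \<in> \<Omega>. swap_at i a b x \<in> bad1 i b \<union> bad2 i b a})"
proof
  fix x assume x: "x \<in> piv i a b"
  then have x\<Omega>: "x \<in> \<Omega>" "x i \<in> perms k" and Fx: "F x = a" "F (swap_at i a b x) = b"
    using assms \<Omega>_perms by (auto simp: piv_def)
  let ?x' = "swap_at i a b x"
  have x': "?x' \<in> \<Omega>" using x\<Omega> assms by (intro swap_at_\<Omega>)
  show "x \<in> top_piv i a b \<union> (bad1 i a \<union> bad2 i a b \<union> {x \<in> \<Omega>. swap_at i a b x \<in> bad1 i b \<union> bad2 i b a})"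
  proof (rule ccontr)
    assume n: "\<not> ?thesis"
    have "F (x(i := top2 a b (x i))) = a"
      using F_top2_iff[OF x\<Omega>(1) assms] up_keeps_winner[OF x\<Omega>(1) assms(1,2) Fx(1)] n by blast
    moreover have "F (?x'(i := top2 b a (?x' i))) = b"
      using F_top2_iff[OF x' assms(1,3,2)] up_keeps_winner[OF x' assms(1,3) Fx(2)] n x\<Omega>(1) assms(4)
      by blast
    moreover have "?x'(i := top2 b a (?x' i)) = x(i := top2 a b (x i) \<circ> tr a b)"
    proof -
      have "x i \<circ> tr a b \<in> perms k" using x\<Omega> assms by (intro perms_comp perms_transpose)
      then have "top2 b a (x i \<circ> tr a b) = top2 a b (x i) \<circ> tr a b"
        using top2_commute[of "x i \<circ> tr a b" k a b] top2_swap_top[OF x\<Omega>(2), of a b] assms by simp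
      then show ?thesis by (simp add: swap_at_def)
    qed
    ultimately show False using n x\<Omega>(1) by (simp add: top_piv_def)
  qed
qed

lemma card_swap_preimage:
  assumes "l \<in> I" "a \<in> {1..k}" "b \<in> {1..k}" "finite R"
  shows "card {x \<in> \<Omega>. swap_at l a b x \<in> R} \<le> card R"
  using assms by (intro card_inj_on_le[where f = "swap_at l a b"])
    (auto intro: inj_on_inverseI[where g = "swap_at l a b"] simp: swap_at_swap_at)

text \<open>Four exceptional sets, two for each end of the pivotal edge, each of size at most k^3
  times that of \<open>M\<close>.\<close>

lemma card_piv_le:
  assumes "i \<in> I" "a \<in> {1..k}" "b \<in> {1..k}" "a \<noteq> b"
  shows "card (piv i a b) \<le> card (top_piv i a b) + 4 * k ^ 3 * card M"
proof -
  let ?B = "\<lambda>a b. bad1 i a \<union> bad2 i a b"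
  have fin: "finite (top_piv i a b)" "finite (?B a b)" "finite (?B b a)"
    using finite_\<Omega> by (auto simp: top_piv_def bad1_def bad2_def)
  have B: "card (?B u v) \<le> 2 * k ^ 3 * card M" if "u \<in> {1..k}" "v \<in> {1..k}" for u v
  proof -
    have "k ^ 2 \<le> k ^ 3" using that by (intro power_increasing) auto
    then have "k ^ 2 * card M \<le> k ^ 3 * card M" by (rule mult_le_mono1)
    then show ?thesis
      using card_Un_le[of "bad1 i u" "bad2 i u v"] card_bad1[OF assms(1) that(1)]
        card_bad2[OF assms(1) that] by linarith
  qed
  have "card (piv i a b) \<le> card (top_piv i a b \<union> (?B a b \<union> {x \<in> \<Omega>. swap_at i a b x \<in> ?B b a}))"
    using piv_subset[OF assms] fin finite_\<Omega> by (intro card_mono) auto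
  also have "\<dots> \<le> card (top_piv i a b) + (card (?B a b) + card {x \<in> \<Omega>. swap_at i a b x \<in> ?B b a})"
    by (meson add_left_mono card_Un_le order_trans)
  also have "\<dots> \<le> card (top_piv i a b) + (2 * k ^ 3 * card M + 2 * k ^ 3 * card M)"
    using B[OF assms(2,3)] B[OF assms(3,2)] card_swap_preimage[OF assms(1-3) fin(3)] by linarith
  finally show ?thesis by (simp add: ac_simps)
qed

text \<open>These are the two profiles at which \<open>top_piv i a b\<close> evaluates
  \<open>F\<close>; outside \<open>near\<close> both are free of manipulation.\<close>

definition near :: "nat \<Rightarrow> nat \<Rightarrow> nat \<Rightarrow> (nat \<Rightarrow> nat \<Rightarrow> nat) set" where
  "near i a b = {w \<in> \<Omega>. w(i := top2 a b (w i)) \<in> M \<or> w(i := top2 a b (w i) \<circ> tr a b) \<in> M}"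

text \<open>The exchanged lift is \<open>top2 b a\<close>, and each of the two lifts forgets just
  two positions.\<close>

lemma card_near:
  assumes "i \<in> I" "a \<in> {1..k}" "b \<in> {1..k}" "a \<noteq> b"
  shows "card (near i a b) \<le> 2 * k ^ 2 * card M"
proof -
  have le: "card {w \<in> \<Omega>. w(i := top2 u v (w i)) \<in> M} \<le> k ^ 2 * card M"
    if "u \<in> {1..k}" "v \<in> {1..k}" for u v
    using card_pullback_le[OF _ up_up_inj_on(2)[OF that], of "top2 u v" i M] up_up_inj_on(1)[OF that, of 2]
      assms(1) finite_M by (simp add: top2_def power2_eq_square)
  have "near i a b \<subseteq> {w \<in> \<Omega>. w(i := top2 a b (w i)) \<in> M} \<union> {w \<in> \<Omega>. w(i := top2 b a (w i)) \<in> M}"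
    using top2_commute[OF _ assms(4,2,3)] \<Omega>_perms assms(1) by (auto simp: near_def)
  then have "card (near i a b) \<le> card ({w \<in> \<Omega>. w(i := top2 a b (w i)) \<in> M} \<union> {w \<in> \<Omega>. w(i := top2 b a (w i)) \<in> M})"
    using finite_\<Omega> by (intro card_mono) auto
  also have "\<dots> \<le> k ^ 2 * card M + k ^ 2 * card M"
    using card_Un_le le[OF assms(2,3)] le[OF assms(3,2)] by (meson add_mono order_trans)
  finally show ?thesis by simp
qed

text \<open>For l = i the lifted rankings either do not change or undergo a swap below the top two
  positions, which involves neither outcome. For l \<noteq> i the swap can change \<open>a\<close>
  to \<open>d\<close> only if c = a, and \<open>b\<close> to \<open>d\<close> only if c = b. Voter
  \<open>i\<close> still has \<open>a\<close> directly above \<open>b\<close>, so the new outcomes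
  are equal or are \<open>a\<close> and \<open>b\<close>; equality would force {c, d} = {a,
  b}.\<close>

lemma top_piv_swap_imp:
  assumes "i \<in> I" "a \<in> {1..k}" "b \<in> {1..k}" "a \<noteq> b"
    and "l \<in> I" "c \<in> {1..k}" "d \<in> {1..k}" "w l d = Suc (w l c)" "{c, d} \<noteq> {a, b}"
    and "w \<notin> near i a b" "swap_at l c d w \<notin> near i a b"
    and "w \<in> top_piv i a b"
  shows "swap_at l c d w \<in> top_piv i a b"
proof -
  have w: "w \<in> \<Omega>" using assms(12) by (simp add: top_piv_def)
  let ?w' = "swap_at l c d w"
  have w': "?w' \<in> \<Omega>" using w assms by (intro swap_at_\<Omega>)
  have \<pi>: "w i \<in> perms k" and \<pi>l: "w l \<in> perms k" using w assms \<Omega>_perms by auto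
  define p where "p = top2 a b (w i)"
  have pk: "p \<in> perms k" using \<pi> assms unfolding p_def by (intro top2_perms)
  have pb: "p b = Suc (p a)" using assms(4) by (simp add: p_def top2_eq[OF \<pi> assms(4,2,3)])
  have F: "F (w(i := p)) = a" "F (w(i := p \<circ> tr a b)) = b"
    using assms(12) by (auto simp: top_piv_def p_def)
  have cd: "c \<noteq> d" using assms(8) by auto
  have nM: "w(i := p) \<notin> M" "w(i := p \<circ> tr a b) \<notin> M"
    "?w'(i := top2 a b (?w' i)) \<notin> M" "?w'(i := top2 a b (?w' i) \<circ> tr a b) \<notin> M"
    using assms(10,11) w w' by (auto simp: near_def p_def)
  have in\<Omega>: "w(i := p) \<in> \<Omega>" "w(i := p \<circ> tr a b) \<in> \<Omega>"
    using w assms pk by (auto intro!: \<Omega>_upd perms_comp perms_transpose)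
  show ?thesis
  proof (cases "l = i")
    case True
    show ?thesis
    proof (cases "c \<in> {a, b} \<or> d \<in> {a, b}")
      case mixed: True
      then have "top2 a b (?w' i) = p"
        using top2_swap_mixed[OF \<pi> assms(4,2,3,6,7)] assms(8) True by (simp add: swap_at_def p_def)
      then show ?thesis using F w' True by (simp add: top_piv_def swap_at_def)
    next
      case False
      then have p': "top2 a b (?w' i) = p \<circ> tr c d" and pd: "p d = Suc (p c)"
        using top2_swap_below[OF \<pi> assms(4,2,3,6,7)] assms(8) True by (simp_all add: swap_at_def p_def)
      have comm: "p \<circ> tr c d \<circ> tr a b = p \<circ> tr a b \<circ> tr c d"
        using False cd by (auto simp: fun_eq_iff Transposition.transpose_def)
      have eq: "?w'(i := top2 a b (?w' i)) = swap_at i c d (w(i := p))"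
        "?w'(i := top2 a b (?w' i) \<circ> tr a b) = swap_at i c d (w(i := p \<circ> tr a b))"
        unfolding p' comm using True by (simp_all add: swap_at_def)
      have "F (swap_at i c d (w(i := p))) = a"
        using edge_cases[OF in\<Omega>(1) assms(1,6,7)] pd nM(1,3) F(1) False unfolding eq by auto
      moreover have "(p \<circ> tr a b) d = Suc ((p \<circ> tr a b) c)" using pd False by auto
      then have "F (swap_at i c d (w(i := p \<circ> tr a b))) = b"
        using edge_cases[OF in\<Omega>(2) assms(1,6,7)] nM(2,4) F(2) False unfolding eq by auto
      ultimately show ?thesis using w' unfolding top_piv_def mem_Collect_eq eq by simp
    qed
  next
    case False
    let ?x = "w(i := p)" and ?y = "w(i := p \<circ> tr a b)"
    have eq: "?w'(i := top2 a b (?w' i)) = swap_at l c d ?x"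
      "?w'(i := top2 a b (?w' i) \<circ> tr a b) = swap_at l c d ?y"
      using False by (auto simp: swap_at_def p_def fun_upd_twist)
    have xy: "swap_at l c d ?y = swap_at i a b (swap_at l c d ?x)"
      using False by (auto simp: swap_at_def fun_upd_twist)
    have x'\<Omega>: "swap_at l c d ?x \<in> \<Omega>" using in\<Omega> assms by (intro swap_at_\<Omega>)
    have 1: "F (swap_at l c d ?x) = a \<or> (c = a \<and> F (swap_at l c d ?x) = d)"
      using edge_cases[OF in\<Omega>(1) assms(5,6,7)] nM(1,3) F(1) assms(8) False unfolding eq by auto
    have 2: "F (swap_at l c d ?y) = b \<or> (c = b \<and> F (swap_at l c d ?y) = d)"
      using edge_cases[OF in\<Omega>(2) assms(5,6,7)] nM(2,4) F(2) assms(8) False unfolding eq by auto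
    have "swap_at l c d ?x i b = Suc (swap_at l c d ?x i a)"
      using pb False by (simp add: swap_at_def)
    then have 3: "F (swap_at l c d ?x) = F (swap_at l c d ?y) \<or>
        F (swap_at l c d ?x) = a \<and> F (swap_at l c d ?y) = b"
      using edge_cases[OF x'\<Omega> assms(1-3)] nM(3,4) unfolding eq xy by auto
    have "F (swap_at l c d ?x) = a \<and> F (swap_at l c d ?y) = b"
      using 1 2 3 cd assms(4,9) by auto
    then show ?thesis using w' unfolding top_piv_def mem_Collect_eq eq by simp
  qed
qed

lemma top_piv_swap_iff:
  assumes "i \<in> I" "a \<in> {1..k}" "b \<in> {1..k}" "a \<noteq> b"
    and "l \<in> I" "c \<in> {1..k}" "d \<in> {1..k}" "w l d = Suc (w l c)" "{c, d} \<noteq> {a, b}"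
    and "w \<notin> near i a b" "swap_at l c d w \<notin> near i a b"
  shows "swap_at l c d w \<in> top_piv i a b \<longleftrightarrow> w \<in> top_piv i a b"
proof
  assume "swap_at l c d w \<in> top_piv i a b"
  moreover have undo: "swap_at l d c (swap_at l c d w) = w"
    using swap_at_swap_at[of l c d w] by (simp only: swap_at_def transpose_commute)
  moreover have "swap_at l c d w l c = Suc (swap_at l c d w l d)"
    using assms(8) by (simp add: swap_at_def)
  moreover have "{d, c} \<noteq> {a, b}" using assms(9) by (simp add: insert_commute)
  ultimately show "w \<in> top_piv i a b"
    using top_piv_swap_imp[OF assms(1-5,7,6), of "swap_at l c d w"] assms(10,11) by simp
qed (rule top_piv_swap_imp[OF assms])

section \<open>Fibres\<close>

definition bits :: "nat \<Rightarrow> nat \<Rightarrow> (nat \<Rightarrow> nat \<Rightarrow> nat) \<Rightarrow> nat set" where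
  "bits a b x = {l \<in> I. x l a < x l b}"

text \<open>The fibre over \<open>T \<subseteq> I\<close> consists of the profiles in which exactly the voters in \<open>T\<close> rank \<open>a\<close>
  above \<open>b\<close>. Exchanging the labels \<open>a\<close> and \<open>b\<close> where necessary maps \<open>\<Omega>\<close> onto it uniformly and turns an
  adjacent swap into an adjacent swap of the fibre, or into the identity for the pair \<open>a\<close>, \<open>b\<close>; thus
  isoperimetry is inherited by the fibres.\<close>

definition fold_to :: "nat \<Rightarrow> nat \<Rightarrow> nat set \<Rightarrow> (nat \<Rightarrow> nat \<Rightarrow> nat) \<Rightarrow> nat \<Rightarrow> nat \<Rightarrow> nat" where
  "fold_to a b T x = (\<lambda>l\<in>I. if (l \<in> T) = (x l a < x l b) then x l else x l \<circ> tr a b)"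

lemma fold_to_\<Omega>:
  assumes "x \<in> \<Omega>" "a \<in> {1..k}" "b \<in> {1..k}"
  shows "fold_to a b T x \<in> \<Omega>"
  unfolding \<Omega>_def fold_to_def
  using assms \<Omega>_perms by (auto intro!: perms_comp perms_transpose)

lemma flip_less_iff:
  assumes "\<pi> \<in> perms k" "a \<noteq> b"
  shows "(\<pi> \<circ> tr a b) a < (\<pi> \<circ> tr a b) b \<longleftrightarrow> \<not> \<pi> a < \<pi> b"
  using perms_eq_iff[OF assms(1), of a b] assms(2) by auto

lemma bits_fold_to:
  assumes "x \<in> \<Omega>" "a \<noteq> b" "T \<subseteq> I"
  shows "bits a b (fold_to a b T x) = T"
  using assms flip_less_iff[OF \<Omega>_perms[OF assms(1)] assms(2)]
  by (auto simp: bits_def fold_to_def)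

text \<open>The pair (T, x) carries the same information as (set of relabelled voters, folded
  profile), which gives a bijection of \<open>Pow I \<times> \<Omega>\<close> onto itself. A uniform
  \<open>T\<close> and a uniform profile thus fold to a uniform profile.\<close>

lemma sum_card_fold_to:
  assumes "a \<in> {1..k}" "b \<in> {1..k}" "a \<noteq> b" "R \<subseteq> \<Omega>"
  shows "(\<Sum>T\<in>Pow I. card {x \<in> \<Omega>. fold_to a b T x \<in> R}) = 2 ^ card I * card R"
proof -
  define f where "f = (\<lambda>(T, x). ({l \<in> I. (l \<in> T) \<noteq> (x l a < x l b)}, fold_to a b T x))"
  define g where "g = (\<lambda>(D, y). (bits a b y, (\<lambda>l\<in>I. if l \<in> D then y l \<circ> tr a b else y l)))"
  have flip: "(\<lambda>l\<in>I. if l \<in> D then y l \<circ> tr a b else y l) \<in> \<Omega>" if "y \<in> \<Omega>" for D y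
    unfolding \<Omega>_def using that \<Omega>_perms assms(1,2) by (auto intro!: perms_comp perms_transpose)
  have fg: "f (g (D, y)) = (D, y)" if "D \<subseteq> I" "y \<in> \<Omega>" for D y
  proof -
    have "y l = undefined" if "l \<notin> I" for l using \<open>y \<in> \<Omega>\<close> that by (auto simp: \<Omega>_def PiE_iff extensional_def)
    then show ?thesis
      using that flip_less_iff[OF \<Omega>_perms[OF that(2)] assms(3)]
      by (auto simp: f_def g_def bits_def fold_to_def fun_eq_iff comp_assoc)
  qed
  have gf: "g (f (T, x)) = (T, x)" if "T \<subseteq> I" "x \<in> \<Omega>" for T x
  proof -
    have "x l = undefined" if "l \<notin> I" for l using \<open>x \<in> \<Omega>\<close> that by (auto simp: \<Omega>_def PiE_iff extensional_def)
    then show ?thesis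
      using that flip_less_iff[OF \<Omega>_perms[OF that(2)] assms(3)] bits_fold_to[OF that(2) assms(3) that(1)]
      by (auto simp: f_def g_def fold_to_def fun_eq_iff comp_assoc)
  qed
  let ?X = "SIGMA T:Pow I. {x \<in> \<Omega>. fold_to a b T x \<in> R}"
  have "bij_betw f ?X (Pow I \<times> R)"
  proof (rule bij_betw_byWitness[where f' = g])
    show "\<forall>p\<in>?X. g (f p) = p" using gf by auto
    show "\<forall>p\<in>Pow I \<times> R. f (g p) = p" using fg assms(4) by auto
    show "f ` ?X \<subseteq> Pow I \<times> R" by (auto simp: f_def)
    show "g ` (Pow I \<times> R) \<subseteq> ?X"
    proof
      fix p assume "p \<in> g ` (Pow I \<times> R)"
      then obtain D y where p: "p = g (D, y)" "D \<subseteq> I" "y \<in> R" by auto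
      have "fold_to a b (fst p) (snd p) = y"
        using fg[of D y] p assms(4) by (auto simp: f_def case_prod_unfold)
      moreover have "snd p \<in> \<Omega>" "fst p \<subseteq> I"
        using flip[of y D] p assms(4) by (auto simp: g_def bits_def)
      ultimately show "p \<in> ?X" using p(3) by (auto simp: mem_Sigma_iff[of "fst p" "snd p", simplified])
    qed
  qed
  then have "card ?X = card (Pow I \<times> R)" by (rule bij_betw_same_card)
  then show ?thesis
    using finite_I finite_\<Omega> by (simp add: card_cartesian_product card_Pow)
qed

definition neighbourhood :: "nat \<Rightarrow> nat \<Rightarrow> nat \<Rightarrow> nat \<Rightarrow> (nat \<Rightarrow> nat \<Rightarrow> nat) set" where
  "neighbourhood i a b l = near i a b \<union>
     (\<Union>(c, d)\<in>{1..k} \<times> {1..k}. {w \<in> \<Omega>. swap_at l c d w \<in> near i a b})"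

lemma card_neighbourhood:
  assumes "i \<in> I" "a \<in> {1..k}" "b \<in> {1..k}" "a \<noteq> b" "l \<in> I"
  shows "card (neighbourhood i a b l) \<le> 4 * k ^ 4 * card M"
proof -
  have fin: "finite (near i a b)" using finite_\<Omega> by (simp add: near_def)
  have "card (neighbourhood i a b l) \<le> card (near i a b) +
      card (\<Union>(c, d)\<in>{1..k} \<times> {1..k}. {w \<in> \<Omega>. swap_at l c d w \<in> near i a b})"
    unfolding neighbourhood_def by (rule card_Un_le)
  also have "card (\<Union>(c, d)\<in>{1..k} \<times> {1..k}. {w \<in> \<Omega>. swap_at l c d w \<in> near i a b})
      \<le> (\<Sum>(c, d)\<in>{1..k} \<times> {1..k}. card {w \<in> \<Omega>. swap_at l c d w \<in> near i a b})"
    unfolding case_prod_unfold by (rule card_UN_le) simp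
  also have "\<dots> \<le> (\<Sum>(c, d)\<in>{1..k} \<times> {1..k}. card (near i a b))"
    using card_swap_preimage[OF assms(5) _ _ fin] by (intro sum_mono) auto
  also have "card (near i a b) + \<dots> = (1 + k ^ 2) * card (near i a b)"
    by (simp add: power2_eq_square)
  also have "\<dots> \<le> (2 * k ^ 2) * (2 * k ^ 2 * card M)"
    using card_near[OF assms(1-4)] assms(2) by (intro mult_mono) (auto simp: Suc_le_eq)
  finally show ?thesis by (simp add: power2_eq_square power4_eq_xxxx mult_ac)
qed

text \<open>After folding, a swap is trivial or exchanges a pair other than {a, b}, and such a swap
  changes \<open>top_piv\<close> only if one of its ends lies in \<open>near\<close>.\<close>

lemma boundary_fold_to_subset:
  assumes "i \<in> I" "a \<in> {1..k}" "b \<in> {1..k}" "a \<noteq> b" "l \<in> I"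
  shows "boundary (\<lambda>x. fold_to a b T x \<in> top_piv i a b) l
    \<subseteq> {x \<in> \<Omega>. fold_to a b T x \<in> neighbourhood i a b l}"
proof
  fix x assume "x \<in> boundary (\<lambda>x. fold_to a b T x \<in> top_piv i a b) l"
  then obtain c d where x: "x \<in> \<Omega>" and cd: "c \<in> {1..k}" "d \<in> {1..k}" "x l d = Suc (x l c)"
    and neq: "(fold_to a b T x \<in> top_piv i a b) \<noteq> (fold_to a b T (swap_at l c d x) \<in> top_piv i a b)"
    unfolding boundary_def by blast
  have \<pi>: "x l \<in> perms k" using \<Omega>_perms x assms by blast
  let ?w = "fold_to a b T x" and ?w' = "fold_to a b T (swap_at l c d x)"
  have w: "?w \<in> \<Omega>" using fold_to_\<Omega> x assms by blast
  obtain c' d' where cd': "c' \<in> {1..k}" "d' \<in> {1..k}" "?w l d' = Suc (?w l c')" "{c', d'} \<noteq> {a, b}"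
    and w': "?w' = swap_at l c' d' ?w"
  proof (cases "{c, d} = {a, b}")
    case True
    then have "tr c d = tr a b" by (auto simp: doubleton_eq_iff transpose_commute)
    \<comment> \<open>Swapping \<open>a\<close> and \<open>b\<close> reverses their order, so
      folding makes the opposite decision and returns the same ranking.\<close>
    then have "?w' = ?w"
      using flip_less_iff[OF \<pi> assms(4)] assms(5)
      by (auto simp: fold_to_def swap_at_def fun_eq_iff)
    then show ?thesis using neq by simp
  next
    case False
    have ord: "(x l \<circ> tr c d) a < (x l \<circ> tr c d) b \<longleftrightarrow> x l a < x l b"
      using adjacent_swap_order[OF \<pi> cd(3) False] by simp
    show ?thesis
    proof (cases "(l \<in> T) = (x l a < x l b)")
      case unflipped: True
      have "?w' = swap_at l c d ?w"
        using unflipped ord assms(5) by (auto simp: fold_to_def swap_at_def fun_eq_iff)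
      then show ?thesis using that[of c d] cd False unflipped assms(5) by (simp add: fold_to_def)
    next
      case flipped: False
      \<comment> \<open>Folding relabels ranking \<open>l\<close>; conjugation turns the swap of
        \<open>c\<close> and \<open>d\<close> into a swap of their relabelled images.\<close>
      have "x l \<circ> tr c d \<circ> tr a b = x l \<circ> tr a b \<circ> tr (tr a b c) (tr a b d)"
        using tr_conj[of c d a b] by (simp add: comp_assoc)
      then have "?w' = swap_at l (tr a b c) (tr a b d) ?w"
        using flipped ord assms(5) by (auto simp: fold_to_def swap_at_def fun_eq_iff)
      moreover have "{tr a b c, tr a b d} \<noteq> {a, b}"
      proof
        assume "{tr a b c, tr a b d} = {a, b}"
        then have "tr a b ` {tr a b c, tr a b d} = tr a b ` {a, b}" by simp
        then show False using False by (simp add: insert_commute)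
      qed
      moreover have "tr a b c \<in> {1..k}" "tr a b d \<in> {1..k}"
        using cd assms(2,3) by (auto simp: Transposition.transpose_def)
      moreover have "?w l (tr a b d) = Suc (?w l (tr a b c))"
        using flipped cd(3) assms(5) by (simp add: fold_to_def)
      ultimately show ?thesis using that by blast
    qed
  qed
  have "?w \<in> near i a b \<or> ?w' \<in> near i a b"
    using top_piv_swap_iff[OF assms cd'(1,2), of ?w] cd'(3,4) neq unfolding w' by blast
  then show "x \<in> {x \<in> \<Omega>. fold_to a b T x \<in> neighbourhood i a b l}"
    using x w w' cd' by (auto simp: neighbourhood_def)
qed

section \<open>Fibres in which pivotality has density close to 1\<close>

lemma card_disagree_set:
  assumes "B \<subseteq> \<Omega>"
  shows "2 * (real (card B) * (real (card \<Omega>) - real (card B))) \<le> real (card {(x, y) \<in> \<Omega> \<times> \<Omega>. (x \<in> B) \<noteq> (y \<in> B)})"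
proof -
  have fin: "finite B" using assms finite_\<Omega> by (rule finite_subset)
  have "{(x, y) \<in> \<Omega> \<times> \<Omega>. (x \<in> B) \<noteq> (y \<in> B)} = B \<times> (\<Omega> - B) \<union> (\<Omega> - B) \<times> B" using assms by auto
  moreover have "card (B \<times> (\<Omega> - B) \<union> (\<Omega> - B) \<times> B) = card (B \<times> (\<Omega> - B)) + card ((\<Omega> - B) \<times> B)"
    using fin finite_\<Omega> by (intro card_Un_disjoint) auto
  ultimately have eq: "real (card {(x, y) \<in> \<Omega> \<times> \<Omega>. (x \<in> B) \<noteq> (y \<in> B)}) = 2 * (card B * real (card (\<Omega> - B)))"
    by (simp only: card_cartesian_product of_nat_add of_nat_mult mult_2 mult.commute)
  have "real (card (\<Omega> - B)) = real (card \<Omega>) - real (card B)"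
    using assms finite_\<Omega> by (simp add: card_Diff_subset fin card_mono of_nat_diff)
  then show ?thesis unfolding eq by simp
qed

text \<open>Every fibre is parametrised by the whole of \<open>\<Omega>\<close> through
  \<open>fold_to\<close>, so densities in different fibres share the denominator
  \<open>card \<Omega>\<close>.\<close>

definition large :: "nat \<Rightarrow> nat \<Rightarrow> nat \<Rightarrow> real \<Rightarrow> nat set set" where
  "large i a b \<gamma> = {T \<in> Pow I. (1 - \<gamma>) * card \<Omega> \<le> card {x \<in> \<Omega>. fold_to a b T x \<in> top_piv i a b}}"

text \<open>Suppose fewer fibres are large. Then mass at least \<omega> / 2 of
  \<open>top_piv\<close> lies in fibres where its complement has share at least \<gamma>.
  Isoperimetry forces a boundary there, but averaged over all fibres the boundary lies in the sets
  \<open>neighbourhood\<close>, which are too few by \<open>small\<close>.\<close>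

lemma many_large_fibres:
  fixes \<gamma> \<omega> :: real
  assumes "i \<in> I" "a \<in> {1..k}" "b \<in> {1..k}" "a \<noteq> b" "0 \<le> \<gamma>"
    and "\<omega> * card \<Omega> \<le> card (top_piv i a b)"
    and small: "4 * k ^ 6 * card I * card M < \<gamma> * \<omega> * card \<Omega>"
  shows "\<omega> / 2 * 2 ^ card I \<le> card (large i a b \<gamma>)"
proof (rule ccontr)
  assume neg: "\<not> ?thesis"
  let ?N = "real (card \<Omega>)" and ?Z = "2 ^ card I :: real"
  define \<alpha> where "\<alpha> T = real (card {x \<in> \<Omega>. fold_to a b T x \<in> top_piv i a b})" for T
  have finU: "finite (large i a b \<gamma>)" "large i a b \<gamma> \<subseteq> Pow I" using finite_I by (auto simp: large_def)
  have \<alpha>: "0 \<le> \<alpha> T" "\<alpha> T \<le> ?N" for T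
    unfolding \<alpha>_def using finite_\<Omega> by (auto intro: card_mono)
  have N: "?N > 0" using card_\<Omega>_pos by simp
  have "top_piv i a b \<subseteq> \<Omega>" by (auto simp: top_piv_def)
  then have "(\<Sum>T\<in>Pow I. \<alpha> T) = ?Z * card (top_piv i a b)"
    using sum_card_fold_to[OF assms(2-4), of "top_piv i a b"] unfolding \<alpha>_def
    by (metis (mono_tags, lifting) of_nat_mult of_nat_numeral of_nat_power of_nat_sum sum.cong)
  then have tot: "\<omega> * ?N * ?Z \<le> (\<Sum>T\<in>Pow I. \<alpha> T)" using assms(6) by (simp add: mult.commute)
  have "(\<Sum>T\<in>large i a b \<gamma>. \<alpha> T) \<le> card (large i a b \<gamma>) * ?N"
    using \<alpha>(2) by (intro sum_bounded_above[of _ \<alpha> ?N, simplified]) auto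
  also have "\<dots> \<le> \<omega> / 2 * ?Z * ?N" using neg N by (intro mult_right_mono) auto
  finally have rest: "\<omega> / 2 * ?Z * ?N \<le> (\<Sum>T\<in>Pow I - large i a b \<gamma>. \<alpha> T)"
    using tot sum.subset_diff[OF finU(2), of \<alpha>] finite_I by (simp add: algebra_simps)
  have "\<gamma> * ?N * (\<omega> / 2 * ?Z * ?N) \<le> \<gamma> * ?N * (\<Sum>T\<in>Pow I - large i a b \<gamma>. \<alpha> T)"
    using rest assms(5) N by (intro mult_left_mono) auto
  also have "\<dots> \<le> (\<Sum>T\<in>Pow I - large i a b \<gamma>. \<alpha> T * (?N - \<alpha> T))"
    unfolding sum_distrib_left
  proof (rule sum_mono)
    fix T assume "T \<in> Pow I - large i a b \<gamma>"
    then have "\<gamma> * ?N \<le> ?N - \<alpha> T" by (auto simp: large_def \<alpha>_def algebra_simps)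
    then show "\<gamma> * ?N * \<alpha> T \<le> \<alpha> T * (?N - \<alpha> T)"
      using \<alpha>(1) by (metis mult.commute mult_left_mono)
  qed
  also have "\<dots> \<le> (\<Sum>T\<in>Pow I. \<alpha> T * (?N - \<alpha> T))"
    using finite_I \<alpha> by (intro sum_mono2) auto
  finally have half: "\<gamma> * ?N * (\<omega> / 2 * ?Z * ?N) \<le> (\<Sum>T\<in>Pow I. \<alpha> T * (?N - \<alpha> T))" .
  have "\<gamma> * \<omega> * ?N * ?N * ?Z = 2 * (\<gamma> * ?N * (\<omega> / 2 * ?Z * ?N))" by simp
  also have "\<dots> \<le> 2 * (\<Sum>T\<in>Pow I. \<alpha> T * (?N - \<alpha> T))" by (intro mult_left_mono half) simp
  finally have low: "\<gamma> * \<omega> * ?N * ?N * ?Z \<le> 2 * (\<Sum>T\<in>Pow I. \<alpha> T * (?N - \<alpha> T))" .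
  have up: "2 * (\<alpha> T * (?N - \<alpha> T)) \<le> k\<^sup>2 * ?N * (\<Sum>l\<in>I. real (card {x \<in> \<Omega>. fold_to a b T x \<in> neighbourhood i a b l}))" for T
  proof -
    let ?g = "\<lambda>x. fold_to a b T x \<in> top_piv i a b"
    let ?B = "{x \<in> \<Omega>. ?g x}"
    have "{(x, y) \<in> \<Omega> \<times> \<Omega>. (x \<in> ?B) \<noteq> (y \<in> ?B)} = {(x, y) \<in> \<Omega> \<times> \<Omega>. ?g x \<noteq> ?g y}"
      by blast
    moreover have "?B \<subseteq> \<Omega>" by blast
    ultimately have "2 * (\<alpha> T * (?N - \<alpha> T)) \<le> card {(x, y) \<in> \<Omega> \<times> \<Omega>. ?g x \<noteq> ?g y}"
      using card_disagree_set[of ?B] unfolding \<alpha>_def by metis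
    also have "\<dots> \<le> real (k\<^sup>2 * card \<Omega> * (\<Sum>l\<in>I. card (boundary ?g l)))"
      by (intro of_nat_mono isoperimetry)
    also have "\<dots> \<le> real (k\<^sup>2 * card \<Omega> * (\<Sum>l\<in>I. card {x \<in> \<Omega>. fold_to a b T x \<in> neighbourhood i a b l}))"
      using finite_\<Omega> boundary_fold_to_subset[OF assms(1-4)]
      by (intro of_nat_mono mult_left_mono sum_mono card_mono) auto
    finally show ?thesis by simp
  qed
  have nb: "neighbourhood i a b l \<subseteq> \<Omega>" for l by (auto simp: neighbourhood_def near_def)
  note low
  also have "2 * (\<Sum>T\<in>Pow I. \<alpha> T * (?N - \<alpha> T)) = (\<Sum>T\<in>Pow I. 2 * (\<alpha> T * (?N - \<alpha> T)))"
    by (rule sum_distrib_left)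
  also have "\<dots> \<le>
    (\<Sum>T\<in>Pow I. k\<^sup>2 * ?N * (\<Sum>l\<in>I. real (card {x \<in> \<Omega>. fold_to a b T x \<in> neighbourhood i a b l})))"
    by (intro sum_mono up)
  \<comment> \<open>Interchanging the sums lets \<open>sum_card_fold_to\<close> average the
    neighbourhoods over all fibres.\<close>
  also have "\<dots> = k\<^sup>2 * ?N * (\<Sum>l\<in>I. real (\<Sum>T\<in>Pow I. card {x \<in> \<Omega>. fold_to a b T x \<in> neighbourhood i a b l}))"
    unfolding sum_distrib_left[symmetric] of_nat_sum by (subst sum.swap) simp
  also have "\<dots> = k\<^sup>2 * ?N * (\<Sum>l\<in>I. ?Z * card (neighbourhood i a b l))"
    by (simp add: sum_card_fold_to[OF assms(2-4) nb])
  also have "\<dots> \<le> k\<^sup>2 * ?N * (\<Sum>l\<in>I. ?Z * real (4 * k ^ 4 * card M))"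
    using card_neighbourhood[OF assms(1-4)] by (intro mult_left_mono sum_mono of_nat_mono) auto
  also have "\<dots> = (4 * k ^ 6 * card I * card M) * ?N * ?Z"
    by (simp add: power2_eq_square eval_nat_numeral)
  finally have "(\<gamma> * \<omega> * ?N) * (?N * ?Z) \<le> (4 * k ^ 6 * card I * card M) * (?N * ?Z)"
    by (simp add: mult_ac)
  then have "\<gamma> * \<omega> * ?N \<le> 4 * k ^ 6 * card I * card M"
    using N by (simp add: mult_le_cancel_right)
  then show False using small by linarith
qed

text \<open>A large fibre has an exceptional share of at most \<gamma>, and any other fibre
  contributes nothing; average over the fibres.\<close>

lemma card_large_not_top_piv:
  fixes \<gamma> :: real
  assumes "a \<in> {1..k}" "b \<in> {1..k}" "a \<noteq> b" "0 \<le> \<gamma>"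
  shows "card {x \<in> \<Omega>. bits a b x \<in> large i a b \<gamma> \<and> x \<notin> top_piv i a b} \<le> \<gamma> * card \<Omega>"
proof -
  let ?R = "{x \<in> \<Omega>. bits a b x \<in> large i a b \<gamma> \<and> x \<notin> top_piv i a b}"
  have "2 ^ card I * real (card ?R) = real (\<Sum>T\<in>Pow I. card {x \<in> \<Omega>. fold_to a b T x \<in> ?R})"
  proof -
    have "?R \<subseteq> \<Omega>" by auto
    from sum_card_fold_to[OF assms(1-3) this] show ?thesis
      by (simp only: of_nat_mult of_nat_power of_nat_numeral)
  qed
  also have "\<dots> \<le> (\<Sum>T\<in>Pow I. \<gamma> * card \<Omega>)"
    unfolding of_nat_sum
  proof (rule sum_mono)
    fix T assume T: "T \<in> Pow I"
    show "real (card {x \<in> \<Omega>. fold_to a b T x \<in> ?R}) \<le> \<gamma> * card \<Omega>"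
    proof (cases "T \<in> large i a b \<gamma>")
      case True
      let ?P = "{x \<in> \<Omega>. fold_to a b T x \<in> top_piv i a b}"
      have "card {x \<in> \<Omega>. fold_to a b T x \<in> ?R} \<le> card (\<Omega> - ?P)"
        using finite_\<Omega> by (intro card_mono) auto
      moreover have "card (\<Omega> - ?P) = card \<Omega> - card ?P" "card ?P \<le> card \<Omega>"
        using finite_\<Omega> by (auto intro: card_Diff_subset card_mono)
      ultimately have "real (card {x \<in> \<Omega>. fold_to a b T x \<in> ?R}) \<le> real (card \<Omega>) - card ?P"
        by linarith
      then show ?thesis using True by (simp add: large_def algebra_simps)
    next
      case False
      then have empty: "{x \<in> \<Omega>. fold_to a b T x \<in> ?R} = {}"
        using bits_fold_to[OF _ assms(3)] T by auto
      show ?thesis unfolding empty using assms(4) by simp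
    qed
  qed
  also have "\<dots> = 2 ^ card I * (\<gamma> * card \<Omega>)" using finite_I by (simp add: card_Pow)
  finally show ?thesis by simp
qed

text \<open>In a large fibre of \<open>(i, a, b)\<close> voter \<open>i\<close> obtains \<open>a\<close> by ranking it first, in a large fibre of
  \<open>(j, c, d)\<close> voter \<open>j\<close> obtains \<open>c\<close>. As \<open>a \<notin> {c, d}\<close> and \<open>c \<notin> {a, b}\<close>, these lifts change neither
  fibre, so the two events are almost disjoint.\<close>

lemma card_two_large:
  fixes \<gamma> \<omega> :: real
  assumes "i \<in> I" "j \<in> I" "i \<noteq> j" "a \<in> {1..k}" "b \<in> {1..k}" "c \<in> {1..k}" "d \<in> {1..k}" "a \<noteq> b" "c \<noteq> d"
    and "a \<notin> {c, d}" "c \<notin> {a, b}" "0 \<le> \<gamma>" "0 \<le> \<omega>"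
    and "\<omega> / 2 * 2 ^ card I \<le> card (large i a b \<gamma>)" "\<omega> / 2 * 2 ^ card I \<le> card (large j c d \<gamma>)"
  shows "(\<omega> / 2) ^ 4 * card \<Omega> \<le> 2 * (k * \<gamma> * card \<Omega> + k ^ 4 * card M)"
proof -
  let ?U = "large i a b \<gamma>" and ?V = "large j c d \<gamma>" and ?Z = "2 ^ card I :: real"
  let ?W = "{x \<in> \<Omega>. bits a b x \<in> ?U \<and> bits c d x \<in> ?V}"
  have UV: "?U \<subseteq> Pow I" "?V \<subseteq> Pow I" by (auto simp: large_def)
  have card_\<Omega>: "card \<Omega> = card (perms k) ^ card I" by (simp add: \<Omega>_def card_PiE finite_I)
  have ind: "(\<Sum>T\<in>Pow I. of_bool (T \<in> X) :: real) = card X" if "X \<subseteq> Pow I" for X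
    using that finite_I by (simp add: Int_absorb1)
  \<comment> \<open>16^n = (2^n)^4 normalises the two squared sums over \<open>Pow I\<close> to
    densities. An indicator equals its square, so each density enters squared.\<close>
  have "(\<omega> / 2) ^ 4 * 16 ^ card I = (\<omega> / 2 * ?Z)\<^sup>2 * (\<omega> / 2 * ?Z)\<^sup>2"
  proof -
    have "?Z ^ 4 = (2 ^ 4) ^ card I" by (metis power_mult mult.commute)
    then show ?thesis by (simp add: power2_eq_square power4_eq_xxxx mult_ac)
  qed
  also have "\<dots> \<le> (real (card ?U))\<^sup>2 * (real (card ?V))\<^sup>2"
    using assms(13-) by (intro mult_mono power_mono) auto
  finally have "(\<omega> / 2) ^ 4 * 16 ^ card I * card \<Omega> \<le>
      (real (card ?U))\<^sup>2 * (real (card ?V))\<^sup>2 * card \<Omega>"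
    by (intro mult_right_mono) auto
  also have "\<dots> = card (perms k) ^ card I * ((\<Sum>T\<in>Pow I. of_bool (T \<in> ?U) :: real)\<^sup>2 * (\<Sum>T\<in>Pow I. of_bool (T \<in> ?V) :: real)\<^sup>2)"
    unfolding ind[OF UV(1)] ind[OF UV(2)] card_\<Omega> by simp
  also have "\<dots> \<le> 16 ^ card I * (\<Sum>x\<in>\<Omega>. (of_bool (bits a b x \<in> ?U) :: real)\<^sup>2 * (of_bool (bits c d x \<in> ?V))\<^sup>2)"
    unfolding \<Omega>_def bits_def using assms
    by (intro reverse_hypercontractivity[OF finite_I]) auto
  also have "(\<Sum>x\<in>\<Omega>. (of_bool (bits a b x \<in> ?U) :: real)\<^sup>2 * (of_bool (bits c d x \<in> ?V))\<^sup>2) = real (card ?W)"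
    using finite_\<Omega> by (simp add: power2_eq_square of_bool_conj[symmetric] Int_def)
  finally have W: "(\<omega> / 2) ^ 4 * card \<Omega> \<le> card ?W" by (simp add: mult_ac)
  \<comment> \<open>Outside \<open>E i a b\<close>, a large fibre guarantees the outcome
    \<open>a\<close> once voter \<open>i\<close> ranks \<open>a\<close> first.\<close>
  define E where "E i a b = {x \<in> \<Omega>. bits a b x \<in> large i a b \<gamma> \<and> x \<notin> top_piv i a b} \<union> bad2 i a b" for i a b
  have finE: "finite (E i a b)" for i a b using finite_\<Omega> by (simp add: E_def bad2_def)
  have cardE: "card (E i a b) \<le> \<gamma> * card \<Omega> + k ^ 3 * card M"
    if "i \<in> I" "a \<in> {1..k}" "b \<in> {1..k}" "a \<noteq> b" for i a b
  proof -
    have "card (E i a b) \<le> card {x \<in> \<Omega>. bits a b x \<in> large i a b \<gamma> \<and> x \<notin> top_piv i a b} + card (bad2 i a b)"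
      unfolding E_def by (rule card_Un_le)
    moreover have "real (card (bad2 i a b)) \<le> k ^ 3 * card M"
      using card_bad2[OF that(1-3)] by (metis of_nat_le_iff)
    ultimately show ?thesis using card_large_not_top_piv[OF that(2-4) assms(12), of i] by linarith
  qed
  let ?up = "\<lambda>i a x. x(i := up a 1 (x i))"
  have "?W \<subseteq> {x \<in> \<Omega>. ?up j c x \<in> E i a b} \<union> {x \<in> \<Omega>. ?up i a x \<in> E j c d}"
  proof
    fix x assume x: "x \<in> ?W"
    then have px: "x l \<in> perms k" if "l \<in> I" for l using that \<Omega>_perms by auto
    have key: "?up j c x \<in> E i a b \<or> F (?up i a (?up j c x)) = a"
      if "i \<in> I" "j \<in> I" "a \<in> {1..k}" "b \<in> {1..k}" "c \<in> {1..k}" "a \<noteq> b" "c \<notin> {a, b}"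
        "bits a b x \<in> large i a b \<gamma>" for i j a b c
    proof -
      let ?y = "?up j c x"
      have y: "?y \<in> \<Omega>" using x px that by (auto intro!: \<Omega>_upd up_perms)
      have "bits a b ?y = bits a b x"
        using up_less_iff[OF px[OF that(2)], of a c b 1] that(7) by (auto simp: bits_def)
      then have "bits a b ?y \<in> large i a b \<gamma>" using that(8) by metis
      then have "?y \<in> E i a b \<or> ?y \<in> top_piv i a b \<and> ?y \<notin> bad2 i a b"
        using y unfolding E_def Un_iff mem_Collect_eq by argo
      moreover have "F (?y(i := top2 a b (?y i))) = a" if "?y \<in> top_piv i a b"
        using that unfolding top_piv_def by blast
      ultimately show ?thesis using F_top2_iff[OF y that(1,3,4,6)] by blast
    qed
    have comm: "?up i a (?up j c x) = ?up j c (?up i a x)"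
      using assms(3) by (auto simp: fun_upd_twist)
    have "a \<noteq> c" using assms(10) by auto
    moreover have "?up j c x \<in> E i a b \<or> F (?up i a (?up j c x)) = a"
      using key[of i j a b c] assms x by blast
    moreover have "?up i a x \<in> E j c d \<or> F (?up j c (?up i a x)) = c"
      using key[of j i c d a] assms x by blast
    ultimately show "x \<in> {x \<in> \<Omega>. ?up j c x \<in> E i a b} \<union> {x \<in> \<Omega>. ?up i a x \<in> E j c d}"
      using x unfolding comm by auto
  qed
  then have "card ?W \<le> card ({x \<in> \<Omega>. ?up j c x \<in> E i a b} \<union> {x \<in> \<Omega>. ?up i a x \<in> E j c d})"
    using finite_\<Omega> by (intro card_mono) auto
  also have "\<dots> \<le> card {x \<in> \<Omega>. ?up j c x \<in> E i a b} + card {x \<in> \<Omega>. ?up i a x \<in> E j c d}"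
    by (rule card_Un_le)
  also have "\<dots> \<le> k * card (E i a b) + k * card (E j c d)"
    using assms finE by (intro add_mono card_up_preimage) auto
  finally have "real (card ?W) \<le> real (k * card (E i a b) + k * card (E j c d))"
    by (rule of_nat_mono)
  also have "\<dots> = k * real (card (E i a b)) + k * real (card (E j c d))" by simp
  also have "\<dots> \<le> k * (\<gamma> * card \<Omega> + k ^ 3 * card M) + k * (\<gamma> * card \<Omega> + k ^ 3 * card M)"
    using cardE assms by (intro add_mono mult_left_mono) auto
  also have "\<dots> = 2 * (k * \<gamma> * card \<Omega> + k ^ 4 * card M)"
    by (simp add: power3_eq_cube power4_eq_xxxx algebra_simps)
  finally show ?thesis using W by linarith
qed

section \<open>The counting argument\<close>

text \<open>\<open>h\<close> serves as the identity or as a map that merges two outcomes. A boundary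
  point lies in \<open>M\<close>, is one swap away from \<open>M\<close>, or is pivotal for two
  outcomes that \<open>h\<close> separates.\<close>

lemma card_boundary_le:
  fixes t :: real and h :: "nat \<Rightarrow> nat"
  assumes "l \<in> I" "k \<ge> 1" "0 \<le> t"
    and "\<And>a b. \<lbrakk>a \<in> {1..k}; b \<in> {1..k}; h a \<noteq> h b\<rbrakk> \<Longrightarrow> card (piv l a b) \<le> t"
  shows "card (boundary (h \<circ> F) l) \<le> 2 * k\<^sup>2 * card M + k\<^sup>2 * t"
proof -
  let ?P = "{1..k} \<times> {1..k}"
  let ?A = "\<lambda>(a, b). {x \<in> \<Omega>. swap_at l a b x \<in> M}"
  let ?B = "\<lambda>(a, b). if h a \<noteq> h b then piv l a b else {}"
  have finpiv: "finite (piv l a b)" for a b using finite_\<Omega> by (simp add: piv_def)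
  have "boundary (h \<circ> F) l \<subseteq> M \<union> (\<Union>p\<in>?P. ?A p) \<union> (\<Union>p\<in>?P. ?B p)"
  proof
    fix x assume "x \<in> boundary (h \<circ> F) l"
    then obtain a b where x: "x \<in> \<Omega>" and ab: "a \<in> {1..k}" "b \<in> {1..k}" "x l b = Suc (x l a)"
      and neq: "h (F x) \<noteq> h (F (swap_at l a b x))"
      unfolding boundary_def by auto
    show "x \<in> M \<union> (\<Union>p\<in>?P. ?A p) \<union> (\<Union>p\<in>?P. ?B p)"
    proof (cases "x \<in> M \<or> swap_at l a b x \<in> M")
      case True
      then show ?thesis using x ab by auto
    next
      case False
      then have F: "F x = a" "F (swap_at l a b x) = b"
        using edge_cases[OF x assms(1) ab] neq by auto
      then have "x \<in> ?B (a, b)" using x ab neq by (simp add: piv_def)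
      then show ?thesis using ab by blast
    qed
  qed
  then have "card (boundary (h \<circ> F) l) \<le> card (M \<union> (\<Union>p\<in>?P. ?A p) \<union> (\<Union>p\<in>?P. ?B p))"
    using finite_M finite_\<Omega> finpiv by (intro card_mono) auto
  also have "\<dots> \<le> card M + card (\<Union>p\<in>?P. ?A p) + card (\<Union>p\<in>?P. ?B p)"
    by (intro order.trans[OF card_Un_le] add_mono card_Un_le order.refl)
  also have "\<dots> \<le> card M + (\<Sum>p\<in>?P. card (?A p)) + (\<Sum>p\<in>?P. card (?B p))"
    by (intro add_mono card_UN_le) auto
  finally have "real (card (boundary (h \<circ> F) l)) \<le>
      real (card M + (\<Sum>p\<in>?P. card (?A p)) + (\<Sum>p\<in>?P. card (?B p)))"
    by (rule of_nat_mono)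
  also have "\<dots> = real (card M) + (\<Sum>p\<in>?P. real (card (?A p))) + (\<Sum>p\<in>?P. real (card (?B p)))"
    by simp
  also have "\<dots> \<le> card M + (\<Sum>p\<in>?P. real (card M)) + (\<Sum>p\<in>?P. t)"
    using assms card_swap_preimage[OF assms(1) _ _ finite_M]
    by (intro add_mono sum_mono) auto
  also have "\<dots> = (1 + k\<^sup>2) * card M + k\<^sup>2 * t"
    by (simp add: power2_eq_square algebra_simps)
  also have "\<dots> \<le> (2 * k\<^sup>2) * card M + k\<^sup>2 * t"
  proof -
    have "1 + (real k)\<^sup>2 \<le> 2 * (real k)\<^sup>2" using assms(2) one_le_power[of "real k" 2] by simp
    then have "(1 + (real k)\<^sup>2) * card M \<le> (2 * (real k)\<^sup>2) * card M" by (intro mult_right_mono) auto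
    then show ?thesis by (simp add: algebra_simps)
  qed
  finally show ?thesis .
qed

lemma upd_eqD:
  assumes "x(i := \<sigma>) = x'(i := \<sigma>')" "x i = x' i"
  shows "\<sigma> = \<sigma>' \<and> x = x'"
  using assms by (metis fun_upd_eqD fun_upd_triv fun_upd_upd)

lemma sum_boundary_le:
  fixes t :: real
  assumes "J \<subseteq> I" "\<And>l. l \<in> J \<Longrightarrow> card (boundary g l) \<le> t" "0 \<le> t"
  shows "(\<Sum>l\<in>J. real (card (boundary g l))) \<le> card I * t"
proof -
  have "(\<Sum>l\<in>J. real (card (boundary g l))) \<le> card J * t"
    using assms(2) by (rule sum_bounded_above)
  also have "\<dots> \<le> card I * t"
    using assms finite_I by (intro mult_right_mono) (auto intro: card_mono)
  finally show ?thesis .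
qed

text \<open>For a random \<open>y\<close>, the function
  \<open>\<lambda>\<tau>. F (y(i := \<tau>))\<close> of one ballot disagrees with \<open>F\<close>
  often. For fixed \<tau> this disagreement is controlled by isoperimetry in the directions l
  \<noteq> i alone, which makes some other voter pivotal.\<close>

lemma exists_pivotal_other_voter:
  fixes \<epsilon> t :: real
  assumes "i \<in> I" "k \<ge> 1" "0 \<le> t"
    and far: "\<And>\<phi>. (\<And>\<tau>. \<tau> \<in> perms k \<Longrightarrow> \<phi> \<tau> \<in> {1..k}) \<Longrightarrow> \<epsilon> * card \<Omega> \<le> card {x \<in> \<Omega>. F x \<noteq> \<phi> (x i)}"
    and small: "k\<^sup>2 * card I * (2 * k\<^sup>2 * card M + k\<^sup>2 * t) < \<epsilon> * card \<Omega>"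
  shows "\<exists>l\<in>I - {i}. \<exists>a\<in>{1..k}. \<exists>b\<in>{1..k}. a \<noteq> b \<and> t < card (piv l a b)"
proof (rule ccontr)
  assume "\<not> ?thesis"
  then have le: "real (card (piv l a b)) \<le> t"
    if "l \<in> I - {i}" "a \<in> {1..k}" "b \<in> {1..k}" "a \<noteq> b" for l a b
    using that by (meson not_less)
  let ?N = "real (card \<Omega>)" and ?P = "real (card (perms k))"
  have bd: "(\<Sum>l\<in>I - {i}. real (card (boundary F l))) \<le> card I * (2 * k\<^sup>2 * card M + k\<^sup>2 * t)"
  proof (rule sum_boundary_le)
    fix l assume l: "l \<in> I - {i}"
    show "real (card (boundary F l)) \<le> 2 * k\<^sup>2 * card M + k\<^sup>2 * t"
      using card_boundary_le[of l t "\<lambda>v. v"] le[OF l] l assms(2,3) by (simp add: o_def)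
  qed (use assms(3) in auto)
  define g where "g \<tau> x = F (x(i := \<tau>))" for \<tau> x
  let ?D = "{(x, y) \<in> \<Omega> \<times> \<Omega>. F x \<noteq> F (y(i := x i))}"
  have finD: "finite ?D" using finite_\<Omega> by (rule finite_subset[of _ "\<Omega> \<times> \<Omega>", rotated, OF finite_cartesian_product]) (auto simp: finite_\<Omega>)
  have "\<epsilon> * ?N * ?N = (\<Sum>y\<in>\<Omega>. \<epsilon> * ?N)" by simp
  also have "\<dots> \<le> (\<Sum>y\<in>\<Omega>. real (card {x \<in> \<Omega>. F x \<noteq> F (y(i := x i))}))"
    using F_range \<Omega>_upd assms(1) by (intro sum_mono far) blast
  also have "\<dots> = real (card (SIGMA y:\<Omega>. {x \<in> \<Omega>. F x \<noteq> F (y(i := x i))}))"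
    using finite_\<Omega> by simp
  also have "card (SIGMA y:\<Omega>. {x \<in> \<Omega>. F x \<noteq> F (y(i := x i))}) \<le> card ?D"
    using finD by (intro card_inj_on_le[where f = prod.swap]) (auto simp: inj_on_def)
  finally have low: "\<epsilon> * ?N * ?N \<le> card ?D" by simp
  \<comment> \<open>The ranking of voter \<open>i\<close> in \<open>x\<close> becomes the parameter
    \<open>\<tau>\<close>, and an independent \<open>\<sigma>\<close> takes its place. Isoperimetry
    then applies to \<open>g \<tau>\<close> on all of \<open>\<Omega>\<close>, with no separate
    profile space for the other voters.\<close>
  have "card (perms k \<times> ?D) \<le> card (SIGMA \<tau>:perms k. {(x, y) \<in> \<Omega> \<times> \<Omega>. g \<tau> x \<noteq> g \<tau> y})"
  proof (rule card_inj_on_le)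
    let ?f = "\<lambda>(\<sigma>, x, y). (x i, x(i := \<sigma>), y)"
    show "inj_on ?f (perms k \<times> ?D)"
      by (rule inj_onI) (auto dest: upd_eqD)
    show "?f ` (perms k \<times> ?D) \<subseteq> (SIGMA \<tau>:perms k. {(x, y) \<in> \<Omega> \<times> \<Omega>. g \<tau> x \<noteq> g \<tau> y})"
      using \<Omega>_upd \<Omega>_perms assms(1) by (auto simp: g_def)
    have "finite {(x, y) \<in> \<Omega> \<times> \<Omega>. g \<tau> x \<noteq> g \<tau> y}" for \<tau>
      by (rule finite_subset[of _ "\<Omega> \<times> \<Omega>"]) (auto simp: finite_\<Omega>)
    then show "finite (SIGMA \<tau>:perms k. {(x, y) \<in> \<Omega> \<times> \<Omega>. g \<tau> x \<noteq> g \<tau> y})"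
      using finite_perms by blast
  qed
  also have "\<dots> = (\<Sum>\<tau>\<in>perms k. card {(x, y) \<in> \<Omega> \<times> \<Omega>. g \<tau> x \<noteq> g \<tau> y})"
    by (rule card_SigmaI[OF finite_perms], rule ballI, rule finite_subset[of _ "\<Omega> \<times> \<Omega>"]) (auto simp: finite_\<Omega>)
  also have "\<dots> \<le> (\<Sum>\<tau>\<in>perms k. k\<^sup>2 * card \<Omega> * (\<Sum>l\<in>I. card (boundary (g \<tau>) l)))"
    by (intro sum_mono isoperimetry)
  also have "\<dots> = k\<^sup>2 * card \<Omega> * (\<Sum>l\<in>I. \<Sum>\<tau>\<in>perms k. card (boundary (g \<tau>) l))"
    unfolding sum_distrib_left[symmetric] by (subst sum.swap) (rule refl)
  also have "\<dots> \<le> k\<^sup>2 * card \<Omega> * (\<Sum>l\<in>I - {i}. card (perms k) * card (boundary F l))"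
  proof (rule mult_left_mono)
    have "boundary (g \<tau>) i = {}" for \<tau> by (simp add: boundary_def g_def swap_at_def)
    then have "(\<Sum>l\<in>I. \<Sum>\<tau>\<in>perms k. card (boundary (g \<tau>) l)) = (\<Sum>l\<in>I - {i}. \<Sum>\<tau>\<in>perms k. card (boundary (g \<tau>) l))"
      using finite_I assms(1) by (simp add: sum.remove)
    also have "\<dots> \<le> (\<Sum>l\<in>I - {i}. card (perms k) * card (boundary F l))"
    proof (rule sum_mono)
      fix l assume l: "l \<in> I - {i}"
      have "(\<Sum>\<tau>\<in>perms k. card (boundary (g \<tau>) l)) = card (SIGMA \<tau>:perms k. boundary (g \<tau>) l)"
        by (rule card_SigmaI[symmetric]) (auto intro: finite_perms finite_boundary)
      \<comment> \<open>The same exchange of \<open>x i\<close> and \<open>\<tau>\<close> turns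
        boundary points of all the \<open>g \<tau>\<close> into boundary points of
        \<open>F\<close>.\<close>
      also have "\<dots> \<le> card (perms k \<times> boundary F l)"
      proof (rule card_inj_on_le[where f = "\<lambda>(\<tau>, x). (x i, x(i := \<tau>))"])
        show "inj_on (\<lambda>(\<tau>, x). (x i, x(i := \<tau>))) (SIGMA \<tau>:perms k. boundary (g \<tau>) l)"
          by (rule inj_onI) (auto dest: upd_eqD)
        show "(\<lambda>(\<tau>, x). (x i, x(i := \<tau>))) ` (SIGMA \<tau>:perms k. boundary (g \<tau>) l) \<subseteq> perms k \<times> boundary F l"
        proof clarify
          fix \<tau> x assume \<tau>: "\<tau> \<in> perms k" and "x \<in> boundary (g \<tau>) l"
          then obtain a b where x: "x \<in> \<Omega>" and ab: "a \<in> {1..k}" "b \<in> {1..k}" "x l b = Suc (x l a)"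
            and neq: "g \<tau> x \<noteq> g \<tau> (swap_at l a b x)"
            unfolding boundary_def by auto
          have "(swap_at l a b x)(i := \<tau>) = swap_at l a b (x(i := \<tau>))"
            using l by (auto simp: swap_at_def fun_upd_twist)
          then have "x(i := \<tau>) \<in> boundary F l"
            unfolding boundary_def mem_Collect_eq
            using \<Omega>_upd[OF x assms(1) \<tau>] ab neq l
            by (intro conjI bexI[of _ a] bexI[of _ b]) (auto simp: g_def)
          then show "x i \<in> perms k \<and> x(i := \<tau>) \<in> boundary F l"
            using \<Omega>_perms[OF x assms(1)] by simp
        qed
        show "finite (perms k \<times> boundary F l)"
          by (rule finite_cartesian_product[OF finite_perms finite_boundary])
      qed
      finally show "(\<Sum>\<tau>\<in>perms k. card (boundary (g \<tau>) l)) \<le> card (perms k) * card (boundary F l)"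
        by (simp add: card_cartesian_product)
    qed
    finally show "(\<Sum>l\<in>I. \<Sum>\<tau>\<in>perms k. card (boundary (g \<tau>) l)) \<le> (\<Sum>l\<in>I - {i}. card (perms k) * card (boundary F l))" .
  qed simp
  finally have "card (perms k) * card ?D \<le> card (perms k) * (k\<^sup>2 * card \<Omega> * (\<Sum>l\<in>I - {i}. card (boundary F l)))"
    by (simp add: card_cartesian_product sum_distrib_left mult_ac)
  moreover have "0 < card (perms k)" by (simp add: card_perms)
  ultimately have "card ?D \<le> k\<^sup>2 * card \<Omega> * (\<Sum>l\<in>I - {i}. card (boundary F l))" by (simp only: mult_le_cancel1)
  then have "real (card ?D) \<le> real (k\<^sup>2 * card \<Omega> * (\<Sum>l\<in>I - {i}. card (boundary F l)))" by (rule of_nat_mono)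
  also have "\<dots> = k\<^sup>2 * ?N * (\<Sum>l\<in>I - {i}. real (card (boundary F l)))" by simp
  also have "\<dots> \<le> k\<^sup>2 * ?N * (card I * (2 * k\<^sup>2 * card M + k\<^sup>2 * t))"
    by (intro mult_left_mono bd) simp
  finally have "(\<epsilon> * ?N) * ?N \<le> (k\<^sup>2 * card I * (2 * k\<^sup>2 * card M + k\<^sup>2 * t)) * ?N"
    using low by (simp add: mult_ac)
  then have "\<epsilon> * ?N \<le> k\<^sup>2 * card I * (2 * k\<^sup>2 * card M + k\<^sup>2 * t)"
    using card_\<Omega>_pos by (simp only: mult_le_cancel_right_pos of_nat_0_less_iff)
  then show False using small by linarith
qed

text \<open>Merge the outcomes \<open>a\<close> and \<open>b\<close>. With too little boundary the
  merged function would be almost constant, so \<open>F\<close> would be close to a function with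
  values in {a, b} or to a constant; \<open>far\<close> excludes both.\<close>

lemma exists_pivotal_other_pair:
  fixes \<epsilon> t :: real
  assumes "k \<ge> 1" "0 \<le> t" "a \<in> {1..k}" "b \<in> {1..k}"
    and far: "\<And>c d g. \<lbrakk>c \<in> {1..k}; d \<in> {1..k}; \<And>x. g x \<in> {c, d}\<rbrakk> \<Longrightarrow> \<epsilon> * card \<Omega> \<le> card {x \<in> \<Omega>. F x \<noteq> g x}"
    and small: "k\<^sup>2 * card I * (2 * k\<^sup>2 * card M + k\<^sup>2 * t) < \<epsilon> * card \<Omega>"
  shows "\<exists>l\<in>I. \<exists>c\<in>{1..k}. \<exists>d\<in>{1..k}. c \<noteq> d \<and> {c, d} \<noteq> {a, b} \<and> t < card (piv l c d)"
proof (rule ccontr)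
  assume "\<not> ?thesis"
  then have le: "real (card (piv l c d)) \<le> t"
    if "l \<in> I" "c \<in> {1..k}" "d \<in> {1..k}" "c \<noteq> d" "{c, d} \<noteq> {a, b}" for l c d
    using that by (meson not_less)
  let ?N = "real (card \<Omega>)"
  define h where "h v = (if v \<in> {a, b} then a else v)" for v
  let ?g = "h \<circ> F"
  have "(\<Sum>l\<in>I. real (card (boundary ?g l))) \<le> card I * (2 * k\<^sup>2 * card M + k\<^sup>2 * t)"
  proof (rule sum_boundary_le)
    fix l assume l: "l \<in> I"
    show "real (card (boundary ?g l)) \<le> 2 * k\<^sup>2 * card M + k\<^sup>2 * t"
    proof (rule card_boundary_le[OF l assms(1,2)])
      fix c d assume cd: "c \<in> {1..k}" "d \<in> {1..k}" "h c \<noteq> h d"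
      then have "c \<noteq> d" "{c, d} \<noteq> {a, b}" by (auto simp: h_def doubleton_eq_iff split: if_splits)
      then show "real (card (piv l c d)) \<le> t" using le l cd by blast
    qed
  qed (use assms(2) in auto)
  then have bd: "k\<^sup>2 * ?N * (\<Sum>l\<in>I. real (card (boundary ?g l))) \<le> k\<^sup>2 * ?N * (card I * (2 * k\<^sup>2 * card M + k\<^sup>2 * t))"
    by (intro mult_left_mono) auto
  have far': "\<epsilon> * ?N \<le> card {x \<in> \<Omega>. ?g y \<noteq> ?g x}" if "y \<in> \<Omega>" for y
  proof (cases "F y \<in> {a, b}")
    case True
    let ?s = "\<lambda>x. if F x \<in> {a, b} then F x else a"
    have "{x \<in> \<Omega>. F x \<noteq> ?s x} = {x \<in> \<Omega>. ?g y \<noteq> ?g x}"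
      using True by (auto simp: h_def)
    moreover have "\<epsilon> * ?N \<le> card {x \<in> \<Omega>. F x \<noteq> ?s x}"
      by (rule far[OF assms(3,4)]) auto
    ultimately show ?thesis by simp
  next
    case False
    have "{x \<in> \<Omega>. F x \<noteq> F y} = {x \<in> \<Omega>. ?g y \<noteq> ?g x}"
      using False by (auto simp: h_def)
    moreover have "\<epsilon> * ?N \<le> card {x \<in> \<Omega>. F x \<noteq> F y}"
      by (rule far[OF F_range[OF that] F_range[OF that]]) auto
    ultimately show ?thesis by simp
  qed
  have "\<epsilon> * ?N * ?N = (\<Sum>y\<in>\<Omega>. \<epsilon> * ?N)" by simp
  also have "\<dots> \<le> (\<Sum>y\<in>\<Omega>. real (card {x \<in> \<Omega>. ?g y \<noteq> ?g x}))" by (intro sum_mono far')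
  also have "\<dots> = real (card (SIGMA y:\<Omega>. {x \<in> \<Omega>. ?g y \<noteq> ?g x}))" using finite_\<Omega> by simp
  also have "(SIGMA y:\<Omega>. {x \<in> \<Omega>. ?g y \<noteq> ?g x}) = {(y, x) \<in> \<Omega> \<times> \<Omega>. ?g y \<noteq> ?g x}" by auto
  also have "real (card {(y, x) \<in> \<Omega> \<times> \<Omega>. ?g y \<noteq> ?g x}) \<le> real (k\<^sup>2 * card \<Omega> * (\<Sum>l\<in>I. card (boundary ?g l)))"
    by (intro of_nat_mono isoperimetry)
  also have "\<dots> = k\<^sup>2 * ?N * (\<Sum>l\<in>I. real (card (boundary ?g l)))" by simp
  also note bd
  finally have "(\<epsilon> * ?N) * ?N \<le> (k\<^sup>2 * card I * (2 * k\<^sup>2 * card M + k\<^sup>2 * t)) * ?N"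
    by (simp add: mult_ac)
  then have "\<epsilon> * ?N \<le> k\<^sup>2 * card I * (2 * k\<^sup>2 * card M + k\<^sup>2 * t)"
    using card_\<Omega>_pos by (simp only: mult_le_cancel_right_pos of_nat_0_less_iff)
  then show False using small by linarith
qed

lemma swap_at_commute: "swap_at l b a x = swap_at l a b x"
  by (simp add: swap_at_def transpose_commute[of b a])

lemma swap_at_piv:
  assumes "l \<in> I" "a \<in> {1..k}" "b \<in> {1..k}" "x \<in> piv l a b"
  shows "swap_at l a b x \<in> piv l b a"
proof -
  have "swap_at l a b x \<in> \<Omega>" using assms by (intro swap_at_\<Omega>) (auto simp: piv_def)
  moreover have "swap_at l a b x l a = Suc (swap_at l a b x l b)"
    using assms(4) by (simp add: piv_def) (simp add: swap_at_def)
  moreover have "F (swap_at l b a (swap_at l a b x)) = a"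
    unfolding swap_at_commute[of l b a] swap_at_swap_at using assms(4) by (simp add: piv_def)
  ultimately show ?thesis using assms(4) by (simp add: piv_def)
qed

text \<open>The swap itself exchanges the two sets, so pivotal pairs may be oriented at
  will.\<close>

lemma card_piv_commute:
  assumes "l \<in> I" "a \<in> {1..k}" "b \<in> {1..k}"
  shows "card (piv l a b) = card (piv l b a)"
proof (rule bij_betw_same_card)
  show "bij_betw (swap_at l a b) (piv l a b) (piv l b a)"
    using swap_at_piv[OF assms] swap_at_piv[OF assms(1,3,2)] swap_at_commute[of l b a]
    by (intro bij_betwI[where g = "swap_at l a b"]) (simp_all add: swap_at_swap_at)
qed

text \<open>Two different voters have pivotal pairs. If these pairs coincide, some voter has a
  pivotal pair different from it; that voter differs from at least one of the two, which supplies
  the partner.\<close>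

lemma exists_two_pivotal:
  fixes \<epsilon> t :: real
  assumes "k \<ge> 1" "0 \<le> t" "I \<noteq> {}"
    and far1: "\<And>i \<phi>. \<lbrakk>i \<in> I; \<And>\<tau>. \<tau> \<in> perms k \<Longrightarrow> \<phi> \<tau> \<in> {1..k}\<rbrakk> \<Longrightarrow> \<epsilon> * card \<Omega> \<le> card {x \<in> \<Omega>. F x \<noteq> \<phi> (x i)}"
    and far2: "\<And>c d g. \<lbrakk>c \<in> {1..k}; d \<in> {1..k}; \<And>x. g x \<in> {c, d}\<rbrakk> \<Longrightarrow> \<epsilon> * card \<Omega> \<le> card {x \<in> \<Omega>. F x \<noteq> g x}"
    and small: "k\<^sup>2 * card I * (2 * k\<^sup>2 * card M + k\<^sup>2 * t) < \<epsilon> * card \<Omega>"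
  shows "\<exists>i\<in>I. \<exists>j\<in>I. \<exists>a\<in>{1..k}. \<exists>b\<in>{1..k}. \<exists>c\<in>{1..k}. \<exists>d\<in>{1..k}.
    i \<noteq> j \<and> a \<noteq> b \<and> c \<noteq> d \<and> a \<notin> {c, d} \<and> c \<notin> {a, b} \<and> t < card (piv i a b) \<and> t < card (piv j c d)"
proof -
  define big where "big l a b \<longleftrightarrow> l \<in> I \<and> a \<in> {1..k} \<and> b \<in> {1..k} \<and> a \<noteq> b \<and> t < card (piv l a b)" for l a b
  have sym: "big l b a" if "big l a b" for l a b
    using that card_piv_commute[of l a b] by (auto simp: big_def)
  have other: "\<exists>l a b. l \<noteq> i \<and> big l a b" if "i \<in> I" for i
    using exists_pivotal_other_voter[OF that assms(1,2) far1[OF that] small] unfolding big_def by blast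
  have pair: "\<exists>l c d. {c, d} \<noteq> {a, b} \<and> big l c d" if "a \<in> {1..k}" "b \<in> {1..k}" for a b
  proof -
    have "\<exists>l\<in>I. \<exists>c\<in>{1..k}. \<exists>d\<in>{1..k}. c \<noteq> d \<and> {c, d} \<noteq> {a, b} \<and> t < card (piv l c d)"
      by (rule exists_pivotal_other_pair[OF assms(1,2) that _ small]) (rule far2)
    then show ?thesis unfolding big_def by blast
  qed
  obtain i0 where "i0 \<in> I" using assms(3) by blast
  obtain i a b where 1: "big i a b" using other[OF \<open>i0 \<in> I\<close>] by blast
  then obtain j c d where 2: "j \<noteq> i" "big j c d" using other[of i] by (auto simp: big_def)
  have "\<exists>i j a b c d. i \<noteq> j \<and> big i a b \<and> big j c d \<and> {a, b} \<noteq> {c, d}"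
  proof (cases "{c, d} = {a, b}")
    case True
    obtain l u v where 3: "{u, v} \<noteq> {a, b}" "big l u v" using pair[of a b] 1 by (auto simp: big_def)
    show ?thesis
    proof (cases "l = i")
      case True
      then show ?thesis using 2 3 \<open>{c, d} = {a, b}\<close> by metis
    next
      case False
      then show ?thesis using 1 3 by metis
    qed
  next
    case False
    then show ?thesis using 1 2 by metis
  qed
  then obtain i j a b c d where ij: "i \<noteq> j" "big i a b" "big j c d" "{a, b} \<noteq> {c, d}" by blast
  \<comment> \<open>As the pairs differ, each has an element outside the other; \<open>sym\<close>
    allows it to come first.\<close>
  obtain a' b' where a': "big i a' b'" "a' \<notin> {c, d}" "{a', b'} = {a, b}"
  proof (cases "a \<in> {c, d}")
    case True
    then have "b \<notin> {c, d}" using ij by (auto simp: big_def)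
    then show ?thesis using that[of b a] sym[OF ij(2)] by (simp add: insert_commute)
  qed (use that[of a b] ij in blast)
  obtain c' d' where c': "big j c' d'" "c' \<notin> {a', b'}" "{c', d'} = {c, d}"
  proof (cases "c \<in> {a', b'}")
    case True
    then have "d \<notin> {a', b'}" using ij a' by (auto simp: big_def)
    then show ?thesis using that[of d c] sym[OF ij(3)] by (simp add: insert_commute)
  qed (use that[of c d] ij in blast)
  have "a' \<notin> {c', d'}" using a'(2) c'(3) by simp
  then show ?thesis using a' c' ij(1) unfolding big_def by blast
qed

lemma many_manipulations:
  fixes \<epsilon> :: real
  assumes "k \<ge> 1" "I \<noteq> {}" "0 < \<epsilon>" "\<epsilon> \<le> 1"
    and far1: "\<And>i \<phi>. \<lbrakk>i \<in> I; \<And>\<tau>. \<tau> \<in> perms k \<Longrightarrow> \<phi> \<tau> \<in> {1..k}\<rbrakk> \<Longrightarrow> \<epsilon> * card \<Omega> \<le> card {x \<in> \<Omega>. F x \<noteq> \<phi> (x i)}"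
    and far2: "\<And>c d g. \<lbrakk>c \<in> {1..k}; d \<in> {1..k}; \<And>x. g x \<in> {c, d}\<rbrakk> \<Longrightarrow> \<epsilon> * card \<Omega> \<le> card {x \<in> \<Omega>. F x \<noteq> g x}"
  shows "\<epsilon> ^ 5 * card \<Omega> \<le> 10 ^ 9 * card I ^ 7 * k ^ 46 * card M"
proof (rule ccontr)
  define n where "n = real (card I)"
  define K where "K = real k"
  define N where "N = real (card \<Omega>)"
  define m where "m = real (card M)"
  assume "\<not> ?thesis"
  then have neg: "10 ^ 9 * n ^ 7 * K ^ 46 * m < \<epsilon> ^ 5 * N"
    by (simp add: n_def K_def N_def m_def)
  have n1: "1 \<le> n" using assms(2) finite_I by (simp add: n_def Suc_le_eq card_gt_0_iff)
  have K1: "1 \<le> K" using assms(1) by (simp add: K_def)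
  have N0: "0 < N" using card_\<Omega>_pos by (simp add: N_def)
  have m0: "0 \<le> m" by (simp add: m_def)
  \<comment> \<open>Each of the four thresholds below is an instance of this shape; it follows from
    \<open>neg\<close> because \<open>n\<close> and \<open>K\<close> are at least 1 and \<epsilon>
    is at most 1.\<close>
  have small: "C * n ^ p * K ^ q * m < \<epsilon> ^ r * N"
    if "C \<le> 10 ^ 9" "0 \<le> C" "p \<le> 7" "q \<le> 46" "r \<le> 5" for C p q r
  proof -
    have "C * n ^ p * K ^ q * m \<le> 10 ^ 9 * n ^ 7 * K ^ 46 * m"
      using that n1 K1 m0 by (intro mult_mono power_increasing) auto
    also have "\<dots> < \<epsilon> ^ 5 * N" by (rule neg)
    also have "\<dots> \<le> \<epsilon> ^ r * N"
      using that assms(3,4) N0 by (intro mult_right_mono power_decreasing) auto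
    finally show ?thesis .
  qed
  \<comment> \<open>Chosen so that \<open>K^2 * n * K^2 * t\<close> is half of
    \<open>\<epsilon> * N\<close>; the other half absorbs the term with \<open>m\<close>.\<close>
  define t where "t = \<epsilon> * N / (2 * n * K ^ 4)"
  have t0: "0 \<le> t" using assms(3) N0 n1 K1 by (simp add: t_def)
  have t: "2 * n * K ^ 4 * t = \<epsilon> * N" using n1 K1 by (simp add: t_def)
  have "4 * n ^ 1 * K ^ 4 * m < \<epsilon> ^ 1 * N" by (rule small) auto
  then have "K\<^sup>2 * n * (2 * K\<^sup>2 * m + K\<^sup>2 * t) < \<epsilon> * N"
    using t by (simp add: power2_eq_square power4_eq_xxxx algebra_simps)
  then have "k\<^sup>2 * card I * (2 * k\<^sup>2 * card M + k\<^sup>2 * t) < \<epsilon> * card \<Omega>"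
    by (simp add: n_def K_def N_def m_def)
  then have "\<exists>i\<in>I. \<exists>j\<in>I. \<exists>a\<in>{1..k}. \<exists>b\<in>{1..k}. \<exists>c\<in>{1..k}. \<exists>d\<in>{1..k}.
    i \<noteq> j \<and> a \<noteq> b \<and> c \<noteq> d \<and> a \<notin> {c, d} \<and> c \<notin> {a, b} \<and> t < card (piv i a b) \<and> t < card (piv j c d)"
    by (intro exists_two_pivotal[OF assms(1) t0 assms(2) _ _]) (rule far1, assumption+, rule far2, assumption+)
  then obtain i j a b c d where ij: "i \<in> I" "j \<in> I" "i \<noteq> j" and
    ab: "a \<in> {1..k}" "b \<in> {1..k}" "c \<in> {1..k}" "d \<in> {1..k}" "a \<noteq> b" "c \<noteq> d" "a \<notin> {c, d}" "c \<notin> {a, b}"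
    and piv: "t < card (piv i a b)" "t < card (piv j c d)"
    by blast
  \<comment> \<open>\<open>\<omega> * N\<close> is t / 2: the passage from \<open>piv\<close> to
    \<open>top_piv\<close> costs at most 4 K^3 m, which is below t / 2.\<close>
  define \<omega> where "\<omega> = \<epsilon> / (4 * n * K ^ 4)"
  \<comment> \<open>With this value the term 2 K \<gamma> N in the bound of
    \<open>card_two_large\<close> is a quarter of the left side, leaving three quarters to be paid
    by \<open>M\<close>.\<close>
  define \<gamma> where "\<gamma> = (\<omega> / 2) ^ 4 / (8 * K)"
  have \<omega>0: "0 < \<omega>" and \<gamma>0: "0 \<le> \<gamma>" using assms(3) n1 K1 by (simp_all add: \<omega>_def \<gamma>_def)
  have \<omega>\<epsilon>: "4 * n * K ^ 4 * \<omega> = \<epsilon>" using n1 K1 by (simp add: \<omega>_def)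
  have \<omega>: "\<omega> * N = t / 2" by (simp add: \<omega>_def t_def)
  have "16 * n ^ 1 * K ^ 7 * m < \<epsilon> ^ 1 * N" by (rule small) auto
  also have "\<epsilon> ^ 1 * N = 2 * n * K ^ 4 * t" using t by simp
  finally have "(2 * n * K ^ 4) * (8 * K ^ 3 * m) < (2 * n * K ^ 4) * t"
    by (simp add: mult_ac flip: power_add)
  moreover have "0 < 2 * n * K ^ 4" using n1 K1 by simp
  ultimately have mt: "8 * K ^ 3 * m < t" by (simp only: mult_less_cancel_left_pos)
  have top: "\<omega> * card \<Omega> \<le> card (top_piv u v w)"
    if "u \<in> I" "v \<in> {1..k}" "w \<in> {1..k}" "v \<noteq> w" "t < card (piv u v w)" for u v w
  proof -
    have "real (card (piv u v w)) \<le> real (card (top_piv u v w) + 4 * k ^ 3 * card M)"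
      by (intro of_nat_mono card_piv_le that)
    also have "\<dots> = card (top_piv u v w) + 4 * K ^ 3 * m" by (simp add: K_def m_def)
    finally have "t < card (top_piv u v w) + 4 * K ^ 3 * m" using that(5) by linarith
    then show ?thesis using mt \<omega> unfolding N_def by linarith
  qed
  \<comment> \<open>\<gamma> \<omega> = \<omega>^5 / (128 K) and \<omega>^5 = \<epsilon>^5 / (1024
    n^5 K^20), whence 131072 = 128 * 1024 and 524288 = 4 * 131072.\<close>
  have "524288 * n ^ 6 * K ^ 27 * m < \<epsilon> ^ 5 * N" by (rule small) auto
  moreover have "524288 * n ^ 6 * K ^ 27 * m = (131072 * n ^ 5 * K ^ 21) * (4 * K ^ 6 * n * m)"
  proof -
    have "n ^ 6 = n ^ 5 * n" "K ^ 27 = K ^ 21 * K ^ 6" by (simp_all flip: power_add power_Suc2)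
    then show ?thesis by simp
  qed
  moreover have "(131072 * n ^ 5 * K ^ 21) * (\<gamma> * \<omega> * N) = \<epsilon> ^ 5 * N"
  proof -
    have cancel: "131072 * P * K * (X / (128 * K) * N) = 1024 * (P * X) * N" for P X
      using K1 by simp
    have "\<gamma> * \<omega> = \<omega> ^ 5 / (128 * K)"
      by (simp add: \<gamma>_def power_divide power4_eq_xxxx eval_nat_numeral)
    then have "131072 * (n ^ 5 * K ^ 20) * K * (\<gamma> * \<omega> * N) = 1024 * ((n ^ 5 * K ^ 20) * \<omega> ^ 5) * N"
      using cancel by metis
    moreover have "K ^ 21 = K ^ 20 * K" by (simp flip: power_Suc2)
    moreover have "\<epsilon> ^ 5 = 1024 * ((n ^ 5 * K ^ 20) * \<omega> ^ 5)"
      unfolding \<omega>\<epsilon>[symmetric] power_mult_distrib power_mult[symmetric] by simp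
    ultimately show ?thesis by (simp add: mult.assoc)
  qed
  ultimately have "(131072 * n ^ 5 * K ^ 21) * (4 * K ^ 6 * n * m) < (131072 * n ^ 5 * K ^ 21) * (\<gamma> * \<omega> * N)"
    by argo
  moreover have "0 < 131072 * n ^ 5 * K ^ 21" using n1 K1 by simp
  ultimately have "4 * K ^ 6 * n * m < \<gamma> * \<omega> * N" by (simp only: mult_less_cancel_left_pos)
  then have sm: "4 * k ^ 6 * card I * card M < \<gamma> * \<omega> * card \<Omega>"
    by (simp add: n_def K_def N_def m_def)
  have "(\<omega> / 2) ^ 4 * card \<Omega> \<le> 2 * (k * \<gamma> * card \<Omega> + k ^ 4 * card M)"
    using ij ab \<gamma>0 \<omega>0 many_large_fibres[OF ij(1) ab(1,2,5) \<gamma>0 top[OF ij(1) ab(1,2,5) piv(1)] sm]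
      many_large_fibres[OF ij(2) ab(3,4,6) \<gamma>0 top[OF ij(2) ab(3,4,6) piv(2)] sm]
    by (intro card_two_large[of i j a b c d \<gamma> \<omega>]) auto
  then have "(\<omega> / 2) ^ 4 * N \<le> 2 * (K * \<gamma> * N + K ^ 4 * m)"
    by (simp add: n_def K_def N_def m_def)
  moreover have "K * \<gamma> * N = (\<omega> / 2) ^ 4 * N / 8" using K1 by (simp add: \<gamma>_def)
  moreover have "3 * X \<le> 8 * Y" if "X \<le> 2 * (X / 8 + Y)" for X Y :: real
    using that by (simp add: algebra_simps)
  ultimately have "3 * ((\<omega> / 2) ^ 4 * N) \<le> 8 * K ^ 4 * m" by (metis mult.assoc)
  \<comment> \<open>The factor is (8 n K^4)^4, which turns (\<omega> / 2)^4 into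
    \<epsilon>^4.\<close>
  then have "(4096 * n ^ 4 * K ^ 16) * (3 * ((\<omega> / 2) ^ 4 * N)) \<le> (4096 * n ^ 4 * K ^ 16) * (8 * K ^ 4 * m)"
    using n1 K1 by (intro mult_left_mono) auto
  moreover have "(4096 * n ^ 4 * K ^ 16) * (3 * ((\<omega> / 2) ^ 4 * N)) = 3 * (\<epsilon> ^ 4 * N)"
    unfolding \<omega>\<epsilon>[symmetric] power_mult_distrib power_divide power_mult[symmetric] by simp
  moreover have "(4096 * n ^ 4 * K ^ 16) * (8 * K ^ 4 * m) = 32768 * n ^ 4 * K ^ 20 * m"
    by (simp flip: power_add)
  moreover have "32768 * n ^ 4 * K ^ 20 * m < \<epsilon> ^ 4 * N" by (rule small) auto
  moreover have "0 \<le> \<epsilon> ^ 4 * N" using assms(3) N0 by simp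
  ultimately show False by linarith
qed

end

section \<open>Transfer to social choice functions\<close>

text \<open>Position 1 is the best, whereas a ranking lists the better alternative second; hence
  \<open>\<pi> a \<le> \<pi> b\<close> for the pair (b, a).\<close>

definition rel_of :: "nat \<Rightarrow> (nat \<Rightarrow> nat) \<Rightarrow> nat rel" where
  "rel_of k \<pi> = {(b, a). a \<in> {1..k} \<and> b \<in> {1..k} \<and> \<pi> a \<le> \<pi> b}"

lemma rel_of_rankings:
  assumes "\<pi> \<in> perms k"
  shows "rel_of k \<pi> \<in> rankings k"
proof -
  have "a = b" if "\<pi> a \<le> \<pi> b" "\<pi> b \<le> \<pi> a" for a b
    using that perms_eq_iff[OF assms] by (metis le_antisym)
  then show ?thesis
    by (auto simp: rel_of_def rankings_def order_on_defs refl_on_def total_on_def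
      intro!: transI antisymI)
qed

lemma ranks_above_rel_of: "ranks_above (rel_of k \<pi>) a b \<longleftrightarrow> a \<in> {1..k} \<and> b \<in> {1..k} \<and> \<pi> a \<le> \<pi> b \<and> a \<noteq> b"
  by (auto simp: ranks_above_def rel_of_def)

lemma position_rel_of:
  assumes "\<pi> \<in> perms k" "a \<in> {1..k}"
  shows "position (rel_of k \<pi>) a = \<pi> a"
proof -
  have above: "above (rel_of k \<pi>) a = {b \<in> {1..k}. \<pi> b \<le> \<pi> a}"
    using assms(2) by (auto simp: above_def rel_of_def)
  have le: "\<pi> a \<le> k" using perms_range[OF assms(1), of a] assms(2) by simp
  have "\<pi> ` {b \<in> {1..k}. \<pi> b \<le> \<pi> a} = {1..\<pi> a}"
  proof (intro subset_antisym subsetI)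
    fix s assume "s \<in> \<pi> ` {b \<in> {1..k}. \<pi> b \<le> \<pi> a}"
    then obtain b where b: "b \<in> {1..k}" "\<pi> b \<le> \<pi> a" "s = \<pi> b" by blast
    then show "s \<in> {1..\<pi> a}" using perms_range[OF assms(1), of b] by simp
  next
    fix s assume s: "s \<in> {1..\<pi> a}"
    have "\<pi> ` {1..k} = {1..k}" using assms(1) by (simp only: perms_def mem_Collect_eq permutes_image)
    moreover have "s \<in> {1..k}" using s le by simp
    ultimately obtain b where "b \<in> {1..k}" "s = \<pi> b" by blast
    then show "s \<in> \<pi> ` {b \<in> {1..k}. \<pi> b \<le> \<pi> a}" using s by auto
  qed
  moreover have "card (\<pi> ` {b \<in> {1..k}. \<pi> b \<le> \<pi> a}) = card {b \<in> {1..k}. \<pi> b \<le> \<pi> a}"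
    by (rule card_image[OF inj_on_subset[OF perms_inj[OF assms(1)] subset_UNIV]])
  ultimately show ?thesis by (simp add: position_def above)
qed

lemma bij_rel_of: "bij_betw (rel_of k) (perms k) (rankings k)"
proof (rule bij_betw_imageI)
  show "inj_on (rel_of k) (perms k)"
  proof (rule inj_onI)
    fix \<pi> \<pi>' assume p: "\<pi> \<in> perms k" "\<pi>' \<in> perms k" and eq: "rel_of k \<pi> = rel_of k \<pi>'"
    show "\<pi> = \<pi>'"
    proof
      fix x
      show "\<pi> x = \<pi>' x"
      proof (cases "x \<in> {1..k}")
        case True
        then show ?thesis using position_rel_of p eq by metis
      next
        case False
        then show ?thesis using p permutes_not_in unfolding perms_def mem_Collect_eq by metis
      qed
    qed
  qed
  show "rel_of k ` perms k = rankings k"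
  proof
    show "rel_of k ` perms k \<subseteq> rankings k" using rel_of_rankings by blast
    show "rankings k \<subseteq> rel_of k ` perms k"
    proof
      fix r assume r: "r \<in> rankings k"
      then have sub: "r \<subseteq> {1..k} \<times> {1..k}"
        by (auto simp: rankings_def order_on_defs)
      have refl: "(x, x) \<in> r" if "x \<in> {1..k}" for x
        using r that by (simp add: rankings_def order_on_defs refl_on_def)
      have trans: "(x, z) \<in> r" if "(x, y) \<in> r" "(y, z) \<in> r" for x y z
        using r transD[OF _ that] by (simp add: rankings_def order_on_defs)
      have antisym: "x = y" if "(x, y) \<in> r" "(y, x) \<in> r" for x y
        using r antisymD[OF _ that] by (simp add: rankings_def order_on_defs)
      have total: "(x, y) \<in> r \<or> (y, x) \<in> r" if "x \<in> {1..k}" "y \<in> {1..k}" for x y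
        using r refl that by (cases "x = y") (auto simp: rankings_def order_on_defs total_on_def)
      \<comment> \<open>The position of \<open>x\<close>, extended by the identity outside {1..k} as
        \<open>permutes\<close> demands.\<close>
      define \<pi> where "\<pi> x = (if x \<in> {1..k} then card (above r x) else x)" for x
      have ab: "above r x \<subseteq> {1..k}" for x using sub by (auto simp: above_def)
      have fin: "finite (above r x)" for x using ab by (rule finite_subset) simp
      have less: "\<pi> y < \<pi> x" if "(x, y) \<in> r" "x \<noteq> y" for x y
      proof -
        have xy: "x \<in> {1..k}" "y \<in> {1..k}" using that sub by auto
        have "above r y \<subset> above r x"
          using trans[OF that(1)] antisym[OF that(1)] that(2) refl[OF xy(1)] by (auto simp: above_def)
        then show ?thesis using xy fin by (simp add: \<pi>_def psubset_card_mono)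
      qed
      have iff: "\<pi> y \<le> \<pi> x \<longleftrightarrow> (x, y) \<in> r" if "x \<in> {1..k}" "y \<in> {1..k}" for x y
        using less[of x y] less[of y x] total[OF that] refl[OF that(1)] by (cases "x = y") auto
      have "inj_on \<pi> {1..k}"
        using iff antisym by (intro inj_onI) (metis order_refl)
      moreover have "\<pi> ` {1..k} \<subseteq> {1..k}"
      proof
        fix z assume "z \<in> \<pi> ` {1..k}"
        then obtain x where x: "x \<in> {1..k}" "z = card (above r x)" by (auto simp: \<pi>_def)
        have "card (above r x) \<le> card {1..k}" using ab by (intro card_mono) auto
        moreover have "x \<in> above r x" using refl x by (simp add: above_def)
        then have "card (above r x) > 0" using fin by (auto simp: card_gt_0_iff)
        ultimately show "z \<in> {1..k}" using x by simp
      qed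
      ultimately have "bij_betw \<pi> {1..k} {1..k}" by (simp add: bij_betw_def endo_inj_surj)
      then have "\<pi> permutes {1..k}" by (rule bij_imp_permutes) (auto simp: \<pi>_def)
      moreover have "r = rel_of k \<pi>" using iff sub by (auto simp: rel_of_def)
      ultimately show "r \<in> rel_of k ` perms k" by (auto simp: perms_def)
    qed
  qed
qed

text \<open>The block {a, b} occupies the same interval of positions before and after the swap, and
  the transposition is its own inverse; so both directions hold.\<close>

lemma adjacent_permutation_swap:
  assumes "\<pi> \<in> perms k" "a \<in> {1..k}" "b \<in> {1..k}" "\<pi> b = Suc (\<pi> a)" "2 \<le> r"
  shows "adjacent_permutation k r (rel_of k \<pi>) (rel_of k (\<pi> \<circ> tr a b))"
    and "adjacent_permutation k r (rel_of k (\<pi> \<circ> tr a b)) (rel_of k \<pi>)"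
proof -
  have rel: "rel_of k (\<rho> \<circ> tr a b) = map_prod (tr a b) (tr a b) ` rel_of k \<rho>" for \<rho>
  proof (rule set_eqI)
    fix p :: "nat \<times> nat"
    have tr: "tr a b x \<in> {1..k} \<longleftrightarrow> x \<in> {1..k}" for x
      using permutes_in_image[OF permutes_swap_id[OF assms(2,3)]] .
    obtain u v where p: "p = (u, v)" by (cases p)
    have "(u, v) \<in> map_prod (tr a b) (tr a b) ` rel_of k \<rho> \<longleftrightarrow> (tr a b u, tr a b v) \<in> rel_of k \<rho>"
    proof
      assume "(u, v) \<in> map_prod (tr a b) (tr a b) ` rel_of k \<rho>"
      then obtain x y where "(x, y) \<in> rel_of k \<rho>" "u = tr a b x" "v = tr a b y" by auto
      then show "(tr a b u, tr a b v) \<in> rel_of k \<rho>" by simp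
    next
      assume "(tr a b u, tr a b v) \<in> rel_of k \<rho>"
      then show "(u, v) \<in> map_prod (tr a b) (tr a b) ` rel_of k \<rho>"
        by (rule rev_image_eqI) simp
    qed
    then show "p \<in> rel_of k (\<rho> \<circ> tr a b) \<longleftrightarrow> p \<in> map_prod (tr a b) (tr a b) ` rel_of k \<rho>"
      unfolding p using tr by (simp add: rel_of_def del: atLeastAtMost_iff)
  qed
  have \<pi>': "\<pi> \<circ> tr a b \<in> perms k" using assms by (intro perms_comp perms_transpose)
  have swap: "tr a b permutes {a, b}" by (rule permutes_swap_id) auto
  have "a \<noteq> b" using assms(4) by auto
  then have card: "card {a, b} \<le> r" using assms(5) by simp
  have "position (rel_of k \<pi>) ` {a, b} = {\<pi> a..\<pi> b}"
    "position (rel_of k (\<pi> \<circ> tr a b)) ` {a, b} = {\<pi> a..\<pi> b}"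
    using position_rel_of[OF assms(1)] position_rel_of[OF \<pi>'] assms(2-4) by auto
  note pos = this
  have rel': "rel_of k \<pi> = map_prod (tr a b) (tr a b) ` rel_of k (\<pi> \<circ> tr a b)"
    using rel[of "\<pi> \<circ> tr a b"] by (simp add: comp_assoc)
  have sub: "{a, b} \<subseteq> {1..k}" using assms(2,3) by blast
  show "adjacent_permutation k r (rel_of k \<pi>) (rel_of k (\<pi> \<circ> tr a b))"
    unfolding adjacent_permutation_def
    by (intro exI conjI) (rule sub card pos(1) swap rel)+
  show "adjacent_permutation k r (rel_of k (\<pi> \<circ> tr a b)) (rel_of k \<pi>)"
    unfolding adjacent_permutation_def
    by (intro exI conjI) (rule sub card pos(2) swap rel')+
qed

theorem theorem7p1:
  fixes n k :: nat and \<epsilon> :: real and f :: "(nat \<Rightarrow> nat rel) \<Rightarrow> nat"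
  assumes "n \<ge> 2" and "k \<ge> 3" and "\<epsilon> > 0"
    and "f \<in> scfs n k"
    and "scf_set_dist n k f (nonmanip_bar n k) \<ge> \<epsilon>"
  shows "measure_pmf.prob (profile_pmf n k) (manipulation_points n k f)
           \<ge> measure_pmf.prob (profile_pmf n k) (r_manipulation_points 4 n k f) \<and>
         measure_pmf.prob (profile_pmf n k) (r_manipulation_points 4 n k f)
           \<ge> \<epsilon> ^ 5 / (10 ^ 9 * real n ^ 7 * real k ^ 46)"
proof
  show "measure_pmf.prob (profile_pmf n k) (manipulation_points n k f)
           \<ge> measure_pmf.prob (profile_pmf n k) (r_manipulation_points 4 n k f)"
    by (rule measure_pmf.finite_measure_mono)
      (auto simp: manipulation_points_def r_manipulation_points_def)
  interpret profile_space "{1..n}" k by unfold_locales simp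
  define \<Phi> where "\<Phi> x = (\<lambda>l\<in>{1..n}. rel_of k (x l))" for x :: "nat \<Rightarrow> nat \<Rightarrow> nat"
  have bij: "bij_betw \<Phi> \<Omega> (profiles n k)"
  proof (rule bij_betwI[where g = "\<lambda>\<sigma>. \<lambda>l\<in>{1..n}. inv_into (perms k) (rel_of k) (\<sigma> l)"])
    have inv: "inv_into (perms k) (rel_of k) r \<in> perms k" "rel_of k (inv_into (perms k) (rel_of k) r) = r"
      if "r \<in> rankings k" for r
      using that bij_rel_of[of k] by (auto simp: bij_betw_def inv_into_into f_inv_into_f)
    have inv': "inv_into (perms k) (rel_of k) (rel_of k \<pi>) = \<pi>" if "\<pi> \<in> perms k" for \<pi>
      using that bij_rel_of[of k] by (simp add: bij_betw_def)
    show "\<Phi> \<in> \<Omega> \<rightarrow> profiles n k" using rel_of_rankings unfolding \<Phi>_def profiles_def \<Omega>_def by (auto simp: PiE_iff)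
    show "(\<lambda>\<sigma>. \<lambda>l\<in>{1..n}. inv_into (perms k) (rel_of k) (\<sigma> l)) \<in> profiles n k \<rightarrow> \<Omega>"
      unfolding \<Omega>_def profiles_def using inv(1) by (auto simp: PiE_iff)
    show "(\<lambda>l\<in>{1..n}. inv_into (perms k) (rel_of k) (\<Phi> x l)) = x" if "x \<in> \<Omega>" for x
    proof -
      have "x \<in> extensional {1..n}" using that unfolding \<Omega>_def by (simp add: PiE_iff)
      then show ?thesis
        by (rule extensionalityI[of _ "{1..n}", rotated]) (use inv' \<Omega>_perms[OF that] in \<open>auto simp: \<Phi>_def\<close>)
    qed
    show "\<Phi> (\<lambda>l\<in>{1..n}. inv_into (perms k) (rel_of k) (\<sigma> l)) = \<sigma>" if "\<sigma> \<in> profiles n k" for \<sigma>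
    proof -
      have "\<sigma> \<in> extensional {1..n}" using that by (simp add: profiles_def PiE_iff)
      then show ?thesis
        by (rule extensionalityI[of _ "{1..n}", rotated])
          (use inv(2) that in \<open>auto simp: \<Phi>_def profiles_def PiE_iff\<close>)
    qed
  qed
  have \<Phi>_profiles: "\<Phi> x \<in> profiles n k" if "x \<in> \<Omega>" for x using bij that by (auto simp: bij_betw_def)
  have card_\<Phi>: "card {\<sigma> \<in> profiles n k. P \<sigma>} = card {x \<in> \<Omega>. P (\<Phi> x)}" for P
  proof -
    have "bij_betw \<Phi> {x \<in> \<Omega>. P (\<Phi> x)} {\<sigma> \<in> profiles n k. P \<sigma>}"
      using bij by (auto simp: bij_betw_def inj_on_def)
    then show ?thesis by (rule bij_betw_same_card[symmetric])
  qed
  have card_profiles: "card (profiles n k) = card \<Omega>" using bij by (rule bij_betw_same_card[symmetric])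
  have prob: "measure_pmf.prob (profile_pmf n k) A = card {x \<in> \<Omega>. \<Phi> x \<in> A} / card \<Omega>" for A
    using measure_pmf_of_set[OF profiles_nonempty finite_profiles, of n k A]
      card_\<Phi>[of "\<lambda>\<sigma>. \<sigma> \<in> A"] card_profiles by (simp add: profile_pmf_def Int_def)
  have N: "0 < real (card \<Omega>)" using card_\<Omega>_pos by simp
  define F where "F x = f (\<Phi> x)" for x
  define M where "M = {x \<in> \<Omega>. \<Phi> x \<in> r_manipulation_points 4 n k f}"
  have F_range: "F x \<in> {1..k}" if "x \<in> \<Omega>" for x
    using \<Phi>_profiles[OF that] assms(4) by (auto simp: F_def scfs_def)
  have manip: "x \<in> M"
    if "x \<in> \<Omega>" "y \<in> \<Omega>" "l \<in> {1..n}" "\<And>j. j \<noteq> l \<Longrightarrow> y j = x j" "x l (F y) < x l (F x)"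
      "adjacent_permutation k 4 (rel_of k (x l)) (rel_of k (y l))" for x y l
  proof -
    have \<Phi>l: "\<Phi> z l = rel_of k (z l)" for z using that(3) by (simp add: \<Phi>_def)
    have "ranks_above (\<Phi> x l) (f (\<Phi> y)) (f (\<Phi> x))"
      unfolding \<Phi>l ranks_above_rel_of F_def[symmetric]
      using that(5) F_range[OF that(1)] F_range[OF that(2)] by auto
    moreover have "\<Phi> y j = \<Phi> x j" if "j \<in> {1..n} - {l}" for j using that \<open>\<And>j. j \<noteq> l \<Longrightarrow> y j = x j\<close> by (simp add: \<Phi>_def)
    moreover have "adjacent_permutation k 4 (\<Phi> x l) (\<Phi> y l)" unfolding \<Phi>l by (rule that(6))
    ultimately show ?thesis
      using that \<Phi>_profiles unfolding M_def r_manipulation_points_def by blast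
  qed
  interpret scf "{1..n}" k F M
  proof
    show "M \<subseteq> \<Omega>" by (auto simp: M_def)
    show "F x \<in> {1..k}" if "x \<in> \<Omega>" for x using F_range[OF that] .
    fix x l a b
    assume x: "x \<in> \<Omega>" and l: "l \<in> {1..n}" and ab: "a \<in> {1..k}" "b \<in> {1..k}" "x l b = Suc (x l a)"
      and nM: "x \<notin> M" "swap_at l a b x \<notin> M" and neq: "F x \<noteq> F (swap_at l a b x)"
    let ?y = "swap_at l a b x"
    have \<pi>: "x l \<in> perms k" using \<Omega>_perms x l by blast
    have y: "?y \<in> \<Omega>" using x l ab by (intro swap_at_\<Omega>)
    have yl: "?y l = x l \<circ> tr a b" "\<And>j. j \<noteq> l \<Longrightarrow> ?y j = x j" by (auto simp: swap_at_def)
    note adj = adjacent_permutation_swap[OF \<pi> ab, of 4]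
    \<comment> \<open>No gain at either end: \<open>F x\<close> beats \<open>F ?y\<close> in
      \<open>x l\<close>, and \<open>F ?y\<close> beats \<open>F x\<close> in \<open>?y l\<close>.
      Only \<open>a\<close> and \<open>b\<close> are ordered differently by the two
      rankings.\<close>
    have 1: "\<not> x l (F ?y) < x l (F x)" using manip[OF x y l] nM(1) adj(1) yl by auto
    have 2: "\<not> ?y l (F x) < ?y l (F ?y)" using manip[OF y x l] nM(2) adj(2) yl by auto
    have inj: "x l u = x l v \<longleftrightarrow> u = v" for u v using perms_eq_iff[OF \<pi>] .
    show "F x = a \<and> F ?y = b"
      using 1 2 neq ab(3) inj[of "F x" "F ?y"] inj[of "F x" a] inj[of "F x" b] inj[of "F ?y" a] inj[of "F ?y" b]
      unfolding yl(1) by (auto simp: Transposition.transpose_def split: if_splits)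
  qed
  have far: "\<epsilon> * card \<Omega> \<le> card {x \<in> \<Omega>. F x \<noteq> g (\<Phi> x)}" if "g \<in> nonmanip_bar n k" for g
  proof -
    have "\<epsilon> \<le> scf_dist n k f g"
      using assms(5) that finite_nonmanip_bar[of n k] unfolding scf_set_dist_def
      by (meson Min_le finite_imageI image_eqI order_trans)
    also have "\<dots> = card {x \<in> \<Omega>. F x \<noteq> g (\<Phi> x)} / card \<Omega>"
      unfolding scf_dist_def prob F_def by simp
    finally show ?thesis using N by (simp add: pos_le_divide_eq)
  qed
  have far1: "\<epsilon> * card \<Omega> \<le> card {x \<in> \<Omega>. F x \<noteq> \<phi> (x i)}"
    if "i \<in> {1..n}" "\<And>\<tau>. \<tau> \<in> perms k \<Longrightarrow> \<phi> \<tau> \<in> {1..k}" for i \<phi>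
  proof -
    define g where "g = (\<lambda>\<sigma>\<in>profiles n k. \<phi> (inv_into (perms k) (rel_of k) (\<sigma> i)))"
    have inv: "inv_into (perms k) (rel_of k) (\<sigma> i) \<in> perms k" if "\<sigma> \<in> profiles n k" for \<sigma>
      using that \<open>i \<in> {1..n}\<close> bij_rel_of[of k] by (auto simp: profiles_def bij_betw_def intro!: inv_into_into)
    have "g \<in> scfs n k" using inv that by (auto simp: scfs_def g_def)
    moreover have "depends_on_one_coordinate n k g"
      unfolding depends_on_one_coordinate_def using that(1) by (intro bexI[of _ i]) (auto simp: g_def)
    ultimately have "g \<in> nonmanip_bar n k" by (simp add: nonmanip_bar_def)
    moreover have "g (\<Phi> x) = \<phi> (x i)" if "x \<in> \<Omega>" for x
      using \<Phi>_profiles[OF that] \<open>i \<in> {1..n}\<close> \<Omega>_perms[OF that] bij_rel_of[of k] by (simp add: g_def) (simp add: \<Phi>_def bij_betw_def)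
    then have "{x \<in> \<Omega>. F x \<noteq> g (\<Phi> x)} = {x \<in> \<Omega>. F x \<noteq> \<phi> (x i)}" by (metis (lifting))
    ultimately show ?thesis using far[of g] by simp
  qed
  have far2: "\<epsilon> * card \<Omega> \<le> card {x \<in> \<Omega>. F x \<noteq> h x}"
    if "c \<in> {1..k}" "d \<in> {1..k}" "\<And>x. h x \<in> {c, d}" for c d h
  proof -
    define g where "g = (\<lambda>\<sigma>\<in>profiles n k. h (inv_into \<Omega> \<Phi> \<sigma>))"
    have g_scf: "g \<in> scfs n k"
      unfolding scfs_def g_def using that by (intro restrict_PiE_iff[THEN iffD2] ballI) (metis insertE singletonD)
    have "g ` profiles n k \<subseteq> {c, d}" using that(3) by (auto simp: g_def)
    then have "card (g ` profiles n k) \<le> card {c, d}" by (intro card_mono) auto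
    also have "card {c, d} \<le> 2" by (simp add: card_insert_if)
    finally have "g \<in> nonmanip_bar n k" using g_scf by (simp add: nonmanip_bar_def)
    moreover have "g (\<Phi> x) = h x" if "x \<in> \<Omega>" for x
      using \<Phi>_profiles[OF that] that bij by (simp add: g_def bij_betw_def)
    then have "{x \<in> \<Omega>. F x \<noteq> g (\<Phi> x)} = {x \<in> \<Omega>. F x \<noteq> h x}" by (metis (lifting))
    ultimately show ?thesis using far[of g] by simp
  qed
  \<comment> \<open>The constant outcome 1 is a competitor in \<open>far2\<close>, which yields the
    bound \<epsilon> \<le> 1 that \<open>many_manipulations\<close> requires.\<close>
  have "\<epsilon> * card \<Omega> \<le> card {x \<in> \<Omega>. F x \<noteq> (1::nat)}" using assms(2) by (intro far2[of 1 1]) auto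
  also have "card {x \<in> \<Omega>. F x \<noteq> (1::nat)} \<le> card \<Omega>" using finite_\<Omega> by (intro card_mono) auto
  finally have "\<epsilon> \<le> 1" using N by simp
  moreover have "1 \<le> k" "{1..n} \<noteq> {}" using assms(1,2) by auto
  ultimately have "\<epsilon> ^ 5 * card \<Omega> \<le> 10 ^ 9 * card {1..n} ^ 7 * k ^ 46 * card M"
    using assms(3) by (intro many_manipulations) (assumption | rule far1 far2, assumption+)+
  then have main: "\<epsilon> ^ 5 * card \<Omega> \<le> (10 ^ 9 * real n ^ 7 * real k ^ 46) * card M" by simp
  have "0 < 10 ^ 9 * real n ^ 7 * real k ^ 46" using assms(1,2) by simp
  then have "\<epsilon> ^ 5 / (10 ^ 9 * real n ^ 7 * real k ^ 46) \<le> card M / card \<Omega>"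
    using main N by (simp add: divide_le_eq le_divide_eq mult.commute)
  then show "measure_pmf.prob (profile_pmf n k) (r_manipulation_points 4 n k f)
           \<ge> \<epsilon> ^ 5 / (10 ^ 9 * real n ^ 7 * real k ^ 46)"
    unfolding prob M_def .
qed

end
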